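(* Let $K$ be a field, $S=K[x_1,\dots,x_n]$, $d\ge 2$, $\mathbf t=(t_1,\dots,t_{d-1})\in\mathbb Z_{\ge 0}^{d-1}$, and let $I\subset S$ be a (proper) $\mathbf t$-spread strongly stable ideal. Let $\mathbf x=x_1,\dots,x_n$. Then, for all $i\ge 1$, the $K$-vector space $H_i(\mathbf x;S/I)$ has as a basis the homology classes of the Koszul cycles $$e(u;\sigma)\quad\text{such that}\quad u\in G(I),\quad \sigma\subseteq[\max(u)-1]\setminus\operatorname{supp}_{\mathbf t}(u),\quad |\sigma|=i-1.$$
   Context: A monomial $u=x_{j_1}x_{j_2}\cdots x_{j_\ell}\in S$ with $j_1\le\dots\le j_\ell$ and $\ell\le d$ is $\mathbf t$-spread if $j_{r+1}-j_r\ge t_r$ for all $r=1,\dots,\ell-1$ (variables and $1$ are $\mathbf t$-spread). $G(I)$ denotes the minimal monomial generating set of a monomial ideal $I$. $I$ is a $\mathbf t$-spread monomial ideal if all $u\in G(I)$ are $\mathbf t$-spread; it is $\mathbf t$-spread strongly stable if moreover, for every $\mathbf t$-spread monomial $u\in I$ and all $j<i$ such that $x_i$ divides $u$ and $x_j(u/x_i)$ is $\mathbf t$-spread, one has $x_j(u/x_i)\in I$. For a monomial $u\neq 1$: $\operatorname{supp}(u)=\{i: x_i\mid u\}$, $\max(u)=\max\operatorname{supp}(u)$, $u'=u/x_{\max(u)}$. $[m]=\{1,\dots,m\}$ (with $[0]=\emptyset$), $[a,b]=\{c\in\mathbb Z:a\le c\le b\}$. For a $\mathbf t$-spread $u=x_{j_1}\cdots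 x_{j_\ell}$, $j_1\le\dots\le j_\ell$, the $\mathbf t$-spread support is $\operatorname{supp}_{\mathbf t}(u)=\bigcup_{r=1}^{\ell-1}[j_r,j_r+t_r-1]$. $K_\bullet(\mathbf x;S/I)$ is the Koszul complex of $\mathbf x$ on $S/I$, with basis elements $e_\tau=e_{k_1}\wedge\dots\wedge e_{k_i}$ for $\tau=\{k_1<\dots<k_i\}\subseteq[n]$ and $\partial(e_\tau)=\sum_{\ell=1}^{i}(-1)^{\ell+1}x_{k_\ell}e_{\tau\setminus\{k_\ell\}}$; $H_i(\mathbf x;S/I)$ is its $i$-th homology, and $\varepsilon:S\to S/I$ is the canonical map. For $k<\max(u)$ put $k^{(u)}=\min\{j\in\operatorname{supp}(u):j>k\}$. For a finite set $F\subseteq[\max(u)-1]$, $F^{(u)}$ is the multiset $\{k^{(u)}:k\in F\}$. For a finite multiset $A$ of elements of $[n]$, $\mathbf x_A=\prod_{i\in A}x_i$ and $e_A$ is the wedge product of the $e_i$, $i\in A$, in weakly increasing order (so $e_A=0$ if $A$ has a repetition); $\mathbf x_\emptyset=1$, and $e_\emptyset$ is neutral for $\wedge$. For a $\mathbf t$-spread monomial $u\in I$ and $\sigma=\{k_1<\dots<k_{i-1}\}\subseteq[\max(u)-1]\setminus\operatorname{supp}_{\mathbf t}(u)$, the element $e(u;\sigma)\in K_i(\mathbf x;S/I)$ is $$e(u;\sigma)=\sum_{F\subseteq\sigma}(-1)^{u(\sigma;F)}\,\varepsilon\big(\mathbf x_F\,u'/\mathbf x_{F^{(u)}}\big)\,e_{\sigma\setminus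 F}\wedge e_{F^{(u)}}\wedge e_{\max(u)},$$ where a term is understood to be $0$ whenever its wedge product is $0$ (when the wedge product is nonzero, $\mathbf x_{F^{(u)}}$ divides $u'$). The integers $u(\sigma;F)$ are defined by $u(\sigma;\emptyset)=0$ and, for $\emptyset\ne F\subseteq\sigma$ with $m=\max(\sigma)$, recursively: if $m\notin F$, then $u(\sigma;F)=u(\sigma\setminus\{m\};F)+|F|$; if $m\in F$, then, with $E=\{k\in\sigma:k^{(u)}=m^{(u)}\}$, $u(\sigma;F)=u(\sigma\setminus E;F\setminus E)+(|E|-1)(|F|+1)+1$. *)

theory Defs
  imports "HOL-Library.Poly_Mapping" "HOL-Algebra.QuotRing" "Jordan_Normal_Form.VS_Connect"
begin

section \<open>Monomials and polynomials\<close>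

text \<open>
  The monomial $x_{j_1} \cdots x_{j_\ell}$ is represented by the multiset
  \<open>{#j\<^sub>1, \<dots>, j\<^sub>\<ell>#}\<close> of its indices. Multiplication of monomials is then
  \<open>+\<close>, divisibility is \<open>\<subseteq>#\<close>, the degree is \<^const>\<open>size\<close>, and the
  support is \<^const>\<open>set_mset\<close>.
\<close>

type_synonym 'a mpoly = "nat multiset \<Rightarrow>\<^sub>0 'a"

definition monomials :: "nat \<Rightarrow> nat multiset set" where
  "monomials n = {u. set_mset u \<subseteq> {1..n}}"

definition xmon :: "nat multiset \<Rightarrow> 'a::field mpoly" where
  "xmon u = Poly_Mapping.single u 1"

definition const_poly :: "'a::field \<Rightarrow> 'a mpoly" where
  "const_poly a = Poly_Mapping.single {#} a"

definition poly_ring :: "nat \<Rightarrow> 'a::field mpoly ring" where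
  "poly_ring n = class_ring\<lparr>carrier := {p. Poly_Mapping.keys p \<subseteq> monomials n}\<rparr>"

definition monomial_ideal :: "nat \<Rightarrow> 'a::field mpoly set \<Rightarrow> bool" where
  "monomial_ideal n I \<longleftrightarrow> (\<exists>M \<subseteq> monomials n. I = Idl\<^bsub>poly_ring n\<^esub> (xmon ` M))"

text \<open>
  $G(I)$. The description is unique for every monomial ideal, see \<open>min_gens_eq\<close> below.
\<close>

definition min_gens :: "nat \<Rightarrow> 'a::field mpoly set \<Rightarrow> nat multiset set" where
  "min_gens n I = (THE G. G \<subseteq> monomials n \<and> Idl\<^bsub>poly_ring n\<^esub> (xmon ` G) = I \<and>
     (\<forall>H. H \<subset> G \<longrightarrow> Idl\<^bsub>poly_ring n\<^esub> (xmon ` H) \<noteq> I))"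

section \<open>\<open>t\<close>-spread strongly stable ideals\<close>

text \<open>
  The vector $\mathbf t = (t_1, \dots, t_{d-1})$ is a function on \<open>nat\<close>, of which only the
  values at \<open>1, \<dots>, d - 1\<close> matter. The index \<open>j\<^sub>r\<close> of a monomial \<open>u\<close>
  with \<open>j\<^sub>1 \<le> \<dots> \<le> j\<^sub>\<ell>\<close> is \<open>spread_idx u r\<close>, counted from 1.
\<close>

definition spread_idx :: "nat multiset \<Rightarrow> nat \<Rightarrow> nat" where
  "spread_idx u r = sorted_list_of_multiset u ! (r - 1)"

definition t_spread :: "nat \<Rightarrow> (nat \<Rightarrow> nat) \<Rightarrow> nat multiset \<Rightarrow> bool" where
  "t_spread d t u \<longleftrightarrow>
     size u \<le> d \<and> (\<forall>r \<in> {1..<size u}. spread_idx u r + t r \<le> spread_idx u (r + 1))"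

definition t_spread_ideal :: "nat \<Rightarrow> nat \<Rightarrow> (nat \<Rightarrow> nat) \<Rightarrow> 'a::field mpoly set \<Rightarrow> bool" where
  "t_spread_ideal n d t I \<longleftrightarrow> monomial_ideal n I \<and> (\<forall>u \<in> min_gens n I. t_spread d t u)"

definition t_spread_strongly_stable ::
    "nat \<Rightarrow> nat \<Rightarrow> (nat \<Rightarrow> nat) \<Rightarrow> 'a::field mpoly set \<Rightarrow> bool" where
  "t_spread_strongly_stable n d t I \<longleftrightarrow> t_spread_ideal n d t I \<and>
     (\<forall>u \<in> monomials n. t_spread d t u \<and> xmon u \<in> I \<longrightarrow>
        (\<forall>i \<in> set_mset u. \<forall>j. 1 \<le> j \<and> j < i \<and> t_spread d t (add_mset j (u - {#i#})) \<longrightarrow>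
           xmon (add_mset j (u - {#i#})) \<in> I))"

definition mon_max :: "nat multiset \<Rightarrow> nat" where
  "mon_max u = Max (set_mset u)"

text \<open>Half-open intervals, so that \<open>t r = 0\<close> contributes nothing.\<close>

definition t_supp :: "(nat \<Rightarrow> nat) \<Rightarrow> nat multiset \<Rightarrow> nat set" where
  "t_supp t u = (\<Union>r \<in> {1..<size u}. {spread_idx u r..<spread_idx u r + t r})"

section \<open>The Koszul complex of \<open>x\<^sub>1, \<dots>, x\<^sub>n\<close> on \<open>S / I\<close>\<close>

abbreviation quot_ring :: "nat \<Rightarrow> 'a::field mpoly set \<Rightarrow> 'a mpoly set ring" where
  "quot_ring n I \<equiv> poly_ring n Quot I"

definition eps :: "nat \<Rightarrow> 'a::field mpoly set \<Rightarrow> 'a mpoly \<Rightarrow> 'a mpoly set" where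
  "eps n I p = I +>\<^bsub>poly_ring n\<^esub> p"

definition faces :: "nat \<Rightarrow> nat \<Rightarrow> nat set set" where
  "faces n i = {\<tau>. \<tau> \<subseteq> {1..n} \<and> card \<tau> = i}"

text \<open>
  The free module $K_i$ over $S/I$ with basis \<open>e\<^sub>\<tau>\<close>, \<open>\<tau> \<in> faces n i\<close>: a chain is the
  family of its coefficients.
\<close>

definition koszul :: "nat \<Rightarrow> 'a::field mpoly set \<Rightarrow> nat \<Rightarrow>
    ('a mpoly set, nat set \<Rightarrow> 'a mpoly set) module" where
  "koszul n I i = ring.func_space (quot_ring n I) (faces n i)"

definition inversions :: "nat list \<Rightarrow> nat" where
  "inversions js = card {(a, b). a < b \<and> b < length js \<and> js ! b < js ! a}"

text \<open>
  \<open>e_wedge n I [j\<^sub>1, \<dots>, j\<^sub>i]\<close> is $e_{j_1} \wedge \dots \wedge e_{j_i} \in K_i$: zero if an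
  index is repeated, and otherwise the sign of the sorting permutation times the basis element of
  \<open>{j\<^sub>1, \<dots>, j\<^sub>i}\<close>.
\<close>

definition e_wedge :: "nat \<Rightarrow> 'a::field mpoly set \<Rightarrow> nat list \<Rightarrow> nat set \<Rightarrow> 'a mpoly set" where
  "e_wedge n I js = (\<lambda>\<tau> \<in> faces n (length js).
     if distinct js \<and> \<tau> = set js then eps n I ((- 1) ^ inversions js) else \<zero>\<^bsub>quot_ring n I\<^esub>)"

abbreviation e_basis :: "nat \<Rightarrow> 'a::field mpoly set \<Rightarrow> nat set \<Rightarrow> nat set \<Rightarrow> 'a mpoly set" where
  "e_basis n I \<tau> \<equiv> e_wedge n I (sorted_list_of_set \<tau>)"

text \<open>
  \<open>koszul_d n I i\<close> is $\partial \colon K_i \to K_{i-1}$ for \<open>i \<ge> 1\<close>, the linear extension of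
  \<open>koszul_d_basis n I i\<close>.
\<close>

definition koszul_d_basis :: "nat \<Rightarrow> 'a::field mpoly set \<Rightarrow> nat \<Rightarrow> nat set \<Rightarrow>
    nat set \<Rightarrow> 'a mpoly set" where
  "koszul_d_basis n I i \<tau> = (\<Oplus>\<^bsub>koszul n I (i - 1)\<^esub> l \<in> {1..i}.
     (let k = sorted_list_of_set \<tau> ! (l - 1) in
        eps n I ((- 1) ^ (l + 1) * xmon {#k#}) \<odot>\<^bsub>koszul n I (i - 1)\<^esub> e_basis n I (\<tau> - {k})))"

definition koszul_d :: "nat \<Rightarrow> 'a::field mpoly set \<Rightarrow> nat \<Rightarrow> (nat set \<Rightarrow> 'a mpoly set) \<Rightarrow>
    nat set \<Rightarrow> 'a mpoly set" where
  "koszul_d n I i c = (\<Oplus>\<^bsub>koszul n I (i - 1)\<^esub> \<tau> \<in> faces n i.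
     c \<tau> \<odot>\<^bsub>koszul n I (i - 1)\<^esub> koszul_d_basis n I i \<tau>)"

definition cycles :: "nat \<Rightarrow> 'a::field mpoly set \<Rightarrow> nat \<Rightarrow> (nat set \<Rightarrow> 'a mpoly set) set" where
  "cycles n I i = {z \<in> carrier (koszul n I i). koszul_d n I i z = \<zero>\<^bsub>koszul n I (i - 1)\<^esub>}"

definition boundaries :: "nat \<Rightarrow> 'a::field mpoly set \<Rightarrow> nat \<Rightarrow> (nat set \<Rightarrow> 'a mpoly set) set" where
  "boundaries n I i = koszul_d n I (i + 1) ` carrier (koszul n I (i + 1))"

definition homology_class :: "nat \<Rightarrow> 'a::field mpoly set \<Rightarrow> nat \<Rightarrow> (nat set \<Rightarrow> 'a mpoly set) \<Rightarrow>
    (nat set \<Rightarrow> 'a mpoly set) set" where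
  "homology_class n I i z = boundaries n I i +>\<^bsub>koszul n I i\<^esub> z"

text \<open>
  $H_i(\mathbf x; S/I)$ for \<open>i \<ge> 1\<close> as a \<open>K\<close>-vector space. The fields \<open>mult\<close> and \<open>one\<close> of the
  module record carry no meaning.
\<close>

definition koszul_homology :: "nat \<Rightarrow> 'a::field mpoly set \<Rightarrow> nat \<Rightarrow>
    ('a, (nat set \<Rightarrow> 'a mpoly set) set) module" where
  "koszul_homology n I i =
     \<lparr>carrier = homology_class n I i ` cycles n I i,
      mult = undefined,
      one = undefined,
      zero = boundaries n I i,
      add = set_add (koszul n I i),
      smult = (\<lambda>a C. \<Union>z \<in> C.
        homology_class n I i (eps n I (const_poly a) \<odot>\<^bsub>koszul n I i\<^esub> z))\<rparr>"

section \<open>The chains \<open>e(u; \<sigma>)\<close>\<close>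

text \<open>\<open>next_supp u k\<close> is $k^{(u)}$ and \<open>next_mset u F\<close> is the multiset $F^{(u)}$.\<close>

definition next_supp :: "nat multiset \<Rightarrow> nat \<Rightarrow> nat" where
  "next_supp u k = Min {j \<in> set_mset u. k < j}"

definition next_mset :: "nat multiset \<Rightarrow> nat set \<Rightarrow> nat multiset" where
  "next_mset u F = image_mset (next_supp u) (mset_set F)"

text \<open>The exponent $u(\sigma; F)$; the value 0 outside of finite \<open>F \<subseteq> \<sigma>\<close> is never used.\<close>

function sign_exp :: "nat multiset \<Rightarrow> nat set \<Rightarrow> nat set \<Rightarrow> nat" where
  "sign_exp u \<sigma> F =
     (if F = {} \<or> infinite \<sigma> \<or> \<not> F \<subseteq> \<sigma> then 0
      else if Max \<sigma> \<notin> F then sign_exp u (\<sigma> - {Max \<sigma>}) F + card F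
      else let E = {k \<in> \<sigma>. next_supp u k = next_supp u (Max \<sigma>)}
           in sign_exp u (\<sigma> - E) (F - E) + (card E - 1) * (card F + 1) + 1)"
  by pat_completeness auto
termination
proof (relation "measure (\<lambda>(u, \<sigma>, F). card \<sigma>)", goal_cases)
  case 1
  show ?case by simp
next
  case (2 u \<sigma> F)
  then have "finite \<sigma>" "Max \<sigma> \<in> \<sigma>" by (auto intro!: Max_in)
  then show ?case by (simp add: card_Diff1_less del: card_Diff_insert)
next
  case (3 u \<sigma> F E)
  then have "Max \<sigma> \<in> E" "Max \<sigma> \<in> \<sigma>" by (auto intro: Max_in)
  with 3 show ?case by (auto intro!: psubset_card_mono)
qed

declare sign_exp.simps [simp del]

text \<open>
  The multiset difference is the quotient $\mathbf x_F u' / \mathbf x_{F^{(u)}}$ whenever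
  $\mathbf x_{F^{(u)}}$ divides $u'$; otherwise the wedge product, and with it the term, is zero.
\<close>

definition koszul_cycle :: "nat \<Rightarrow> 'a::field mpoly set \<Rightarrow> nat multiset \<Rightarrow> nat set \<Rightarrow>
    nat set \<Rightarrow> 'a mpoly set" where
  "koszul_cycle n I u \<sigma> = (\<Oplus>\<^bsub>koszul n I (card \<sigma> + 1)\<^esub> F \<in> Pow \<sigma>.
     eps n I ((- 1) ^ sign_exp u \<sigma> F *
       xmon (mset_set F + (u - {#mon_max u#}) - next_mset u F))
     \<odot>\<^bsub>koszul n I (card \<sigma> + 1)\<^esub>
     e_wedge n I (sorted_list_of_set (\<sigma> - F) @ sorted_list_of_multiset (next_mset u F) @ [mon_max u]))"

definition cycle_index :: "nat \<Rightarrow> (nat \<Rightarrow> nat) \<Rightarrow> 'a::field mpoly set \<Rightarrow> nat \<Rightarrow>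
    (nat multiset \<times> nat set) set" where
  "cycle_index n t I i =
     {(u, \<sigma>). u \<in> min_gens n I \<and> \<sigma> \<subseteq> {1..mon_max u - 1} - t_supp t u \<and> card \<sigma> = i - 1}"

section \<open>The minimal monomial generators are well defined\<close>

lemma cring_poly_ring: "cring (poly_ring n)"
proof (rule cringI)
  have 1: "Poly_Mapping.keys p \<subseteq> monomials n \<Longrightarrow>
      Poly_Mapping.keys q \<subseteq> monomials n \<Longrightarrow> Poly_Mapping.keys (p + q) \<subseteq> monomials n"
    for p q :: "'b::field mpoly"
    using Poly_Mapping.keys_add[of p q] by blast
  show "abelian_group (poly_ring n)"
  proof (rule abelian_groupI)
    fix x :: "'b mpoly" assume "x \<in> carrier (poly_ring n)"
    then show "\<exists>y\<in>carrier (poly_ring n). y \<oplus>\<^bsub>poly_ring n\<^esub> x = \<zero>\<^bsub>poly_ring n\<^esub>"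
      by (intro bexI[of _ "- x"]) (auto simp: poly_ring_def Poly_Mapping.keys_minus)
  qed (auto simp: poly_ring_def algebra_simps dest: 1)
  show "Group.comm_monoid (poly_ring n)"
  proof (rule comm_monoidI)
    fix x y :: "'b mpoly"
    assume "x \<in> carrier (poly_ring n)" "y \<in> carrier (poly_ring n)"
    then show "x \<otimes>\<^bsub>poly_ring n\<^esub> y \<in> carrier (poly_ring n)"
      using keys_mult[of x y] by (fastforce simp: poly_ring_def monomials_def)
  qed (auto simp: poly_ring_def monomials_def algebra_simps)
qed (auto simp: poly_ring_def algebra_simps)

lemma xmon_in_carrier: "xmon u \<in> carrier (poly_ring n) \<longleftrightarrow> u \<in> monomials n"
  by (simp add: xmon_def poly_ring_def)

lemma xmon_mult: "xmon u * xmon v = (xmon (u + v) :: 'a::field mpoly)"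
  by (simp add: xmon_def mult_single)

lemma xmon_mem_Idl:
  assumes M: "M \<subseteq> monomials n" and v: "v \<in> monomials n"
  shows "xmon v \<in> Idl\<^bsub>poly_ring n\<^esub> (xmon ` M :: 'a::field mpoly set) \<longleftrightarrow> (\<exists>m \<in> M. m \<subseteq># v)"
proof
  let ?R = "poly_ring n :: 'a mpoly ring"
  interpret cring ?R by (rule cring_poly_ring)
  define J where "J = {p \<in> carrier ?R. \<forall>k \<in> Poly_Mapping.keys p. \<exists>m \<in> M. m \<subseteq># k}"
  have neg: "\<ominus>\<^bsub>?R\<^esub> p = - p" if "p \<in> carrier ?R" for p
    by (rule minus_equality) (use that in \<open>auto simp: poly_ring_def Poly_Mapping.keys_minus\<close>)
  have mulJ: "q * p \<in> J" if "p \<in> J" "q \<in> carrier ?R" for p q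
  proof -
    have "q \<otimes>\<^bsub>?R\<^esub> p \<in> carrier ?R" using that by (intro m_closed) (auto simp: J_def)
    moreover have "\<exists>m \<in> M. m \<subseteq># k" if k: "k \<in> Poly_Mapping.keys (q * p)" for k
    proof -
      obtain a b where ab: "k = a + b" "b \<in> Poly_Mapping.keys p"
        using keys_mult[of q p] k by blast
      then obtain m where "m \<in> M" "m \<subseteq># b" using \<open>p \<in> J\<close> by (auto simp: J_def)
      with ab show ?thesis by (metis mset_subset_eq_add_right subset_mset.order_trans)
    qed
    ultimately show ?thesis by (auto simp: J_def poly_ring_def)
  qed
  have idJ: "ideal J ?R"
  proof (rule idealI)
    show "ring ?R" by (rule ring_axioms)
    show "subgroup J (add_monoid ?R)"
    proof (rule subgroup.intro, goal_cases)
      case 1 show ?case by (auto simp: J_def)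
    next
      case (2 x y)
      then have "x \<oplus>\<^bsub>?R\<^esub> y \<in> carrier ?R" by (auto simp: J_def)
      moreover have "Poly_Mapping.keys (x + y) \<subseteq> Poly_Mapping.keys x \<union> Poly_Mapping.keys y"
        by (rule Poly_Mapping.keys_add)
      ultimately show ?case using 2 by (fastforce simp: J_def poly_ring_def)
    next
      case 3 show ?case by (auto simp: J_def poly_ring_def)
    next
      case (4 x)
      then have c: "x \<in> carrier ?R" by (auto simp: J_def)
      then have "\<ominus>\<^bsub>?R\<^esub> x \<in> carrier ?R" by simp
      with c neg[OF c] 4 show ?case by (auto simp: J_def a_inv_def Poly_Mapping.keys_minus)
    qed
  next
    fix p q assume p: "p \<in> J" and q: "q \<in> carrier ?R"
    show "q \<otimes>\<^bsub>?R\<^esub> p \<in> J" using mulJ[OF p q] by (simp add: poly_ring_def)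
    show "p \<otimes>\<^bsub>?R\<^esub> q \<in> J" using mulJ[OF p q] by (simp add: poly_ring_def mult.commute)
  qed
  have sub: "xmon ` M \<subseteq> J"
    using M xmon_in_carrier by (auto simp: J_def xmon_def)
  {
    assume "xmon v \<in> Idl\<^bsub>?R\<^esub> (xmon ` M)"
    then have "xmon v \<in> J" using genideal_minimal[OF idJ sub] by blast
    then show "\<exists>m \<in> M. m \<subseteq># v" by (auto simp: J_def xmon_def)
  next
    assume "\<exists>m \<in> M. m \<subseteq># v"
    then obtain m where m: "m \<in> M" "m \<subseteq># v" by blast
    have Mc: "xmon ` M \<subseteq> carrier ?R" using M xmon_in_carrier by blast
    have "v - m \<in> monomials n" using v by (auto simp: monomials_def dest: in_diffD)
    then have "xmon (v - m) \<in> carrier ?R" by (simp add: xmon_in_carrier)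
    then have "xmon (v - m) \<otimes>\<^bsub>?R\<^esub> xmon m \<in> Idl\<^bsub>?R\<^esub> (xmon ` M)"
      using m genideal_self[OF Mc] by (intro ideal.I_l_closed[OF genideal_ideal[OF Mc]]) auto
    moreover have "xmon (v - m) \<otimes>\<^bsub>?R\<^esub> xmon m = xmon v"
      using m by (simp add: poly_ring_def xmon_mult)
    ultimately show "xmon v \<in> Idl\<^bsub>?R\<^esub> (xmon ` M)" by simp
  }
qed

lemma min_gens_eq:
  assumes "monomial_ideal n I"
  shows "min_gens n I = {u \<in> monomials n. xmon u \<in> I \<and> (\<forall>v. v \<subset># u \<longrightarrow> xmon v \<notin> I)}"
    and "Idl\<^bsub>poly_ring n\<^esub> (xmon ` min_gens n I) = I"
proof -
  let ?R = "poly_ring n :: 'a mpoly ring"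
  interpret cring ?R by (rule cring_poly_ring)
  define G where "G = {u \<in> monomials n. xmon u \<in> I \<and> (\<forall>v. v \<subset># u \<longrightarrow> xmon v \<notin> I)}"
  obtain M where M: "M \<subseteq> monomials n" "I = Idl\<^bsub>?R\<^esub> (xmon ` M)"
    using assms by (auto simp: monomial_ideal_def)
  have Mc: "xmon ` N \<subseteq> carrier ?R" if "N \<subseteq> monomials n" for N
    using that xmon_in_carrier by blast
  have Gm: "G \<subseteq> monomials n" by (auto simp: G_def)
  have sub_mon: "v \<in> monomials n" if "u \<in> monomials n" "v \<subseteq># u" for u v
    using that set_mset_mono by (fastforce simp: monomials_def)
  have below: "\<exists>g \<in> G. g \<subseteq># u" if "u \<in> monomials n" "xmon u \<in> I" for u
    using that
  proof (induction "size u" arbitrary: u rule: less_induct)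
    case less
    show ?case
    proof (cases "u \<in> G")
      case False
      then obtain v where v: "v \<subset># u" "xmon v \<in> I" using less.prems by (auto simp: G_def)
      with less.hyps[of v] sub_mon[of u v] less.prems mset_subset_size[OF v(1)]
      obtain g where "g \<in> G" "g \<subseteq># v" by auto
      with v show ?thesis by (meson subset_mset.order_trans subset_mset.less_imp_le)
    qed auto
  qed
  have gen: "Idl\<^bsub>?R\<^esub> (xmon ` G) = I"
  proof
    have "xmon ` G \<subseteq> I" by (auto simp: G_def)
    then show "Idl\<^bsub>?R\<^esub> (xmon ` G) \<subseteq> I"
      using genideal_minimal[OF genideal_ideal[OF Mc[OF M(1)]]] M(2) by blast
    have "xmon m \<in> Idl\<^bsub>?R\<^esub> (xmon ` G)" if "m \<in> M" for m
    proof -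
      have "xmon m \<in> I" using genideal_self[OF Mc[OF M(1)]] that M(2) by blast
      then show ?thesis using below[of m] xmon_mem_Idl[OF Gm, of m] M(1) that by blast
    qed
    then show "I \<subseteq> Idl\<^bsub>?R\<^esub> (xmon ` G)"
      unfolding M(2) using genideal_ideal[OF Mc[OF Gm]] by (intro genideal_minimal) auto
  qed
  have least: "G \<subseteq> H" if H: "H \<subseteq> monomials n" "Idl\<^bsub>?R\<^esub> (xmon ` H) = I" for H
  proof
    fix g assume g: "g \<in> G"
    then obtain m where m: "m \<in> H" "m \<subseteq># g"
      using xmon_mem_Idl[OF H(1), of g] H(2) by (auto simp: G_def)
    have "xmon m \<in> I" using m genideal_self[OF Mc[OF H(1)]] H(2) by blast
    then show "g \<in> H" using g m by (auto simp: G_def subset_mset.le_less)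
  qed
  have eq: "min_gens n I = G"
    unfolding min_gens_def
  proof (rule the_equality)
    show "G \<subseteq> monomials n \<and> Idl\<^bsub>?R\<^esub> (xmon ` G) = I \<and>
        (\<forall>H. H \<subset> G \<longrightarrow> Idl\<^bsub>?R\<^esub> (xmon ` H) \<noteq> I)"
      using Gm gen least by blast
  next
    fix H
    assume "H \<subseteq> monomials n \<and> Idl\<^bsub>?R\<^esub> (xmon ` H) = I \<and>
        (\<forall>H'. H' \<subset> H \<longrightarrow> Idl\<^bsub>?R\<^esub> (xmon ` H') \<noteq> I)"
    then show "H = G" using least[of H] gen by blast
  qed
  then show "min_gens n I = {u \<in> monomials n. xmon u \<in> I \<and> (\<forall>v. v \<subset># u \<longrightarrow> xmon v \<notin> I)}"
    by (simp add: G_def)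
  show "Idl\<^bsub>poly_ring n\<^esub> (xmon ` min_gens n I) = I"
    using eq gen by simp
qed

end

theory Submission
  imports Defs "HOL-Library.Function_Algebras" "HOL-Library.List_Lexorder"
begin

text \<open>
  Order \<open>G(I)\<close> lexicographically by the increasing index lists. A \<open>t\<close>-spread monomial
  of \<open>I\<close> has a prefix in \<open>G(I)\<close>, and this shows that \<open>I\<close> has linear quotients: if
  \<open>J\<close> is generated by the generators preceding \<open>u\<close>, then \<open>J : u\<close> is generated by the
  \<open>x\<^sub>k\<close> with \<open>k < max(u)\<close> outside of the \<open>t\<close>-spread support of \<open>u\<close>.

  Over the Laurent polynomials, \<open>e(u; \<sigma>)\<close> is \<open>u'\<close> times the wedge product of the
  \<open>e\<^sub>k - (x\<^sub>k / x\<^sub>j) e\<^sub>j\<close>, where \<open>k \<in> \<sigma>\<close> and \<open>j > k\<close> is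
  the next index in the support of \<open>u\<close>, and of \<open>e\<close> with index \<open>max(u)\<close>.
  All factors but the last are cycles, so the differential of \<open>e(u; \<sigma>)\<close> is, up to sign,
  \<open>u\<close> times the same product without the last factor. Modulo \<open>J\<close> only \<open>u e\<^sub>\<sigma>\<close> is left
  of it. Since the Koszul homology of \<open>S / (J : u)\<close> has the classes of the \<open>e\<^sub>\<sigma>\<close> as a basis,
  adding the generators one at a time adds exactly the classes of the \<open>e(u; \<sigma>)\<close>.
\<close>

section \<open>Polynomials as coefficient families\<close>

text \<open>Adding a generator would usually be treated by the long exact sequence of
  \<open>0 -> S/(J:u) -> S/J -> S/(J+(u)) -> 0\<close>, with changing rings and a connecting map.
  Here all chains stay over \<open>S\<close>: congruence modulo a monomial ideal is a condition on
  the monomials occurring in the coefficients, and the connecting map becomes the decomposition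
  \<open>y = h + u c\<close>. This map sends the class of \<open>e(u; \<sigma>)\<close> to that of
  \<open>e_\<sigma>\<close> up to sign, so it is onto in every degree. Spanning uses this in the
  degree of \<open>\<sigma>\<close>, independence also one degree higher. That no new class dies
  comes from the absence of constant terms in boundaries. The Laurent product is never formed:
  everything is multiplied by the common denominator, which is cancelled at the end. The recursive
  sign exponent is compared with the sign of the product only modulo 2, and only for those
  \<open>F\<close> on which \<open>k \<mapsto> k^(u)\<close> is injective; for all others the wedge
  product vanishes. The monomials in the other terms of the differential need not be generators.
  Stability puts them into \<open>I\<close>, and a prefix of each is a generator before
  \<open>u\<close>.\<close>

abbreviation lookup :: "'a::field mpoly \<Rightarrow> nat multiset \<Rightarrow> 'a" where
  "lookup \<equiv> Poly_Mapping.lookup"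

abbreviation keys :: "'a::field mpoly \<Rightarrow> nat multiset set" where
  "keys \<equiv> Poly_Mapping.keys"

lemma sum_apply:
  fixes f :: "'i \<Rightarrow> 'b \<Rightarrow> 'c::comm_monoid_add"
  shows "(\<Sum>a\<in>A. f a) x = (\<Sum>a\<in>A. f a x)"
  by (induction A rule: infinite_finite_induct) auto

lemma mpoly_eq_sum: "p = (\<Sum>k\<in>keys p. Poly_Mapping.single k (lookup p k))"
  by (rule poly_mapping_eqI)
    (simp add: lookup_sum lookup_single when_def in_keys_iff sum.delta)

lemma lookup_xmon_mult:
  "lookup (xmon D * p) v = (if D \<subseteq># v then lookup p (v - D) else 0)"
proof -
  have "xmon D * p = (\<Sum>k\<in>keys p. Poly_Mapping.single (D + k) (lookup p k))"
    by (subst mpoly_eq_sum[of p]) (simp add: xmon_def sum_distrib_left mult_single)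
  then have "lookup (xmon D * p) v = (\<Sum>k\<in>keys p. if D + k = v then lookup p k else 0)"
    by (simp add: lookup_sum lookup_single when_def)
  also have "\<dots> = (if D \<subseteq># v then lookup p (v - D) else 0)"
  proof (cases "D \<subseteq># v")
    case True
    then have "D + k = v \<longleftrightarrow> k = v - D" for k by auto
    then show ?thesis using True by (simp add: sum.delta in_keys_iff)
  qed (auto intro!: sum.neutral)
  finally show ?thesis .
qed

lemma xmon_mult_cancel: "xmon D * p = xmon D * q \<longleftrightarrow> p = q"
proof
  assume eq: "xmon D * p = xmon D * q"
  show "p = q"
  proof (rule poly_mapping_eqI)
    fix v
    have "lookup (xmon D * p) (D + v) = lookup (xmon D * q) (D + v)" by (simp add: eq)
    then show "lookup p v = lookup q v" by (simp add: lookup_xmon_mult)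
  qed
qed simp

lemma keys_xmon_mult: "keys (xmon D * p) = (\<lambda>v. D + v) ` keys p"
  by (force simp: in_keys_iff lookup_xmon_mult image_iff subset_mset.le_iff_add split: if_splits)

lemma keys_xmon [simp]: "keys (xmon v :: 'a::field mpoly) = {v}"
  by (simp add: xmon_def)

text \<open>The linear left inverse of multiplication by \<open>xmon D\<close>: it divides the
  multiples of \<open>D\<close> and drops all other monomials.\<close>

definition shift :: "nat multiset \<Rightarrow> 'a::field mpoly \<Rightarrow> 'a mpoly" where
  "shift D p = Poly_Mapping.map_key (\<lambda>v. D + v) p"

lemma lookup_shift: "lookup (shift D p) v = lookup p (D + v)"
  unfolding shift_def by (subst map_key.rep_eq) (auto simp: inj_on_def)

lemma shift_add: "shift D (p + q) = shift D p + shift D q"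
  by (rule poly_mapping_eqI) (simp add: lookup_shift lookup_add)

lemma shift_minus: "shift D (- p) = - shift D p"
  by (rule poly_mapping_eqI) (simp add: lookup_shift)

lemma shift_zero [simp]: "shift D 0 = 0"
  by (rule poly_mapping_eqI) (simp add: lookup_shift)

lemma shift_xmon_mult [simp]: "shift D (xmon D * p) = p"
  by (rule poly_mapping_eqI) (simp add: lookup_shift lookup_xmon_mult)

lemma shift_var_mult:
  assumes "k \<noteq> l"
  shows "shift {#k#} (xmon {#l#} * p) = xmon {#l#} * shift {#k#} p"
  using assms by (intro poly_mapping_eqI) (auto simp: lookup_shift lookup_xmon_mult)

lemma keys_shift: "v \<in> keys (shift D p) \<longleftrightarrow> D + v \<in> keys p"
  by (simp add: in_keys_iff lookup_shift)

lemma xmon_mult_shift: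
  assumes "\<And>v. v \<in> keys p \<Longrightarrow> D \<subseteq># v"
  shows "xmon D * shift D p = p"
  using assms by (intro poly_mapping_eqI) (force simp: lookup_shift lookup_xmon_mult in_keys_iff)

definition restr :: "nat multiset set \<Rightarrow> 'a::field mpoly \<Rightarrow> 'a mpoly" where
  "restr M p = Poly_Mapping.mapp (\<lambda>v a. if v \<in> M then a else 0) p"

lemma lookup_restr: "lookup (restr M p) v = (if v \<in> M then lookup p v else 0)"
  by (auto simp: restr_def lookup_mapp when_def in_keys_iff)

lemma keys_restr: "keys (restr M p) = keys p \<inter> M"
  by (auto simp: in_keys_iff lookup_restr split: if_splits)

lemma restr_zero [simp]: "restr M 0 = 0"
  by (rule poly_mapping_eqI) (simp add: lookup_restr)

lemma keys_minus_mpoly: "keys (- p) = keys (p :: 'a::field mpoly)"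
  by (auto simp: in_keys_iff)

lemma keys_diff_mpoly: "keys (p - q) \<subseteq> keys p \<union> keys (q :: 'a::field mpoly)"
  by (auto simp: in_keys_iff lookup_minus)

lemma keys_sum_mpoly: "keys (sum f A) \<subseteq> (\<Union>a\<in>A. keys (f a :: 'a::field mpoly))"
proof
  fix v assume "v \<in> keys (sum f A)"
  then have "(\<Sum>a\<in>A. lookup (f a) v) \<noteq> 0" by (simp add: in_keys_iff lookup_sum)
  then obtain a where "a \<in> A" "lookup (f a) v \<noteq> 0" by (meson sum.neutral)
  then show "v \<in> (\<Union>a\<in>A. keys (f a))" by (auto simp: in_keys_iff)
qed

lemma keys_power_minus_one: "keys ((- 1) ^ j * p) = keys (p :: 'a::field mpoly)"
  by (cases "even j") (auto simp: keys_minus_mpoly)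

text \<open>These are the exponent sets of monomial ideals. The condition
  \<open>keys p \<subseteq> M\<close> replaces membership in such an ideal, without fixing the
  number of variables or forming a generated ideal.\<close>

definition upward :: "nat multiset set \<Rightarrow> bool" where
  "upward M \<longleftrightarrow> (\<forall>v\<in>M. \<forall>w. v + w \<in> M)"

definition up :: "nat multiset set \<Rightarrow> nat multiset set" where
  "up G = {v. \<exists>g\<in>G. g \<subseteq># v}"

lemma upward_up [simp]: "upward (up G)"
  by (auto simp: upward_def up_def intro: subset_mset.order_trans[OF _ mset_subset_eq_add_left])

lemma upward_keys_mult:
  assumes "upward M" "keys p \<subseteq> M"
  shows "keys (q * p) \<subseteq> M"
proof
  fix v assume "v \<in> keys (q * p)"
  then obtain a b where "v = a + b" "b \<in> keys p" using keys_mult[of q p] by blast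
  then show "v \<in> M" using assms unfolding upward_def by (metis add.commute subsetD)
qed

lemma keys_mult_monomials:
  assumes "keys p \<subseteq> monomials n" "keys q \<subseteq> monomials n"
  shows "keys (p * q) \<subseteq> monomials n"
  using assms keys_mult[of p q] by (fastforce simp: monomials_def)

lemma monomials_add [simp]: "u + v \<in> monomials n \<longleftrightarrow> u \<in> monomials n \<and> v \<in> monomials n"
  by (auto simp: monomials_def)

lemma empty_monomials [simp]: "{#} \<in> monomials n" by (simp add: monomials_def)

lemma add_mset_monomials [simp]:
  "add_mset k u \<in> monomials n \<longleftrightarrow> k \<in> {1..n} \<and> u \<in> monomials n"
  by (auto simp: monomials_def)

section \<open>Exterior multiplication and contraction\<close>

text \<open>The sign of moving \<open>e_k\<close> from the front to its sorted place among the
  \<open>e_l\<close> with \<open>l \<in> \<tau>\<close>. As \<open>k\<close> itself is not counted,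
  the value is the same whether or not \<open>k \<in> \<tau>\<close>, so \<open>ext\<close> and
  \<open>con\<close> can share it.\<close>

definition below_sign :: "nat \<Rightarrow> nat set \<Rightarrow> 'a::field mpoly" where
  "below_sign k \<tau> = (- 1) ^ card {l \<in> \<tau>. l < k}"

definition scal :: "'a::field mpoly \<Rightarrow> (nat set \<Rightarrow> 'a mpoly) \<Rightarrow> nat set \<Rightarrow> 'a mpoly" where
  "scal p c = (\<lambda>\<tau>. p * c \<tau>)"

text \<open>Left multiplication by \<open>e_k\<close>, read off at the coefficient of
  \<open>e_\<tau>\<close>. Chains of all degrees live in one function space, so the operators carry
  no degree.\<close>

definition ext :: "nat \<Rightarrow> (nat set \<Rightarrow> 'a::field mpoly) \<Rightarrow> nat set \<Rightarrow> 'a mpoly" where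
  "ext k c = (\<lambda>\<tau>. if k \<in> \<tau> then below_sign k \<tau> * c (\<tau> - {k}) else 0)"

definition con :: "nat \<Rightarrow> (nat set \<Rightarrow> 'a::field mpoly) \<Rightarrow> nat set \<Rightarrow> 'a mpoly" where
  "con k c = (\<lambda>\<tau>. if k \<in> \<tau> then 0 else below_sign k \<tau> * c (insert k \<tau>))"

text \<open>The Koszul differential over \<open>S\<close> as contraction with the vector of
  variables. In this form its square vanishes because single contractions anticommute; the
  alternating sum over positions is recovered in \<open>bdry_unit_chain\<close>.\<close>

definition bdry :: "nat \<Rightarrow> (nat set \<Rightarrow> 'a::field mpoly) \<Rightarrow> nat set \<Rightarrow> 'a mpoly" where
  "bdry n c = (\<Sum>k\<in>{1..n}. scal (xmon {#k#}) (con k c))"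

section \<open>Anticommutation of the elementary operators\<close>

lemma below_sign_square [simp]: "below_sign k \<tau> * below_sign k \<tau> = 1"
  "below_sign k \<tau> * (below_sign k \<tau> * p) = p"
  by (simp_all add: below_sign_def flip: mult.assoc power_add)

lemma below_sign_self [simp]: "below_sign k (insert k \<tau>) = below_sign k \<tau>"
  "below_sign k (\<tau> - {k}) = below_sign k \<tau>"
proof -
  have "{l \<in> insert k \<tau>. l < k} = {l \<in> \<tau>. l < k}" "{l \<in> \<tau> - {k}. l < k} = {l \<in> \<tau>. l < k}"
    by auto
  then show "below_sign k (insert k \<tau>) = below_sign k \<tau>"
    "below_sign k (\<tau> - {k}) = below_sign k \<tau>"
    by (simp_all add: below_sign_def)
qed

lemma below_sign_insert:
  assumes "l \<notin> \<tau>"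
  shows "below_sign k (insert l \<tau>) = (if l < k then - below_sign k \<tau> else below_sign k \<tau>)"
proof -
  have "{j \<in> insert l \<tau>. j < k} = (if l < k then insert l {j \<in> \<tau>. j < k} else {j \<in> \<tau>. j < k})"
    by auto
  then show ?thesis using assms by (simp add: below_sign_def)
qed

lemma below_sign_remove:
  assumes "l \<in> \<tau>"
  shows "below_sign k (\<tau> - {l}) = (if l < k then - below_sign k \<tau> else below_sign k \<tau>)"
  using below_sign_insert[of l "\<tau> - {l}" k, where 'a='a] assms by (auto simp: insert_absorb)

lemma ext_ext: "ext k (ext l c) = - ext l (ext k c)"
proof (cases "k = l")
  case False
  have c: "\<tau> - {k} - {l} = \<tau> - {l} - {k}" for \<tau> :: "nat set" by blast
  show ?thesis
    using False by (auto simp: ext_def below_sign_remove c intro!: HOL.ext)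
qed (auto simp: ext_def intro!: HOL.ext)

lemma con_con: "con k (con l c) = - con l (con k c)"
proof (cases "k = l")
  case False
  have c: "insert k (insert l \<tau>) = insert l (insert k \<tau>)" for \<tau> :: "nat set" by blast
  show ?thesis
    using False by (auto simp: con_def below_sign_insert c intro!: HOL.ext)
qed (auto simp: con_def intro!: HOL.ext)

lemma con_con_self: "con k (con k c) = 0"
  by (auto simp: con_def intro!: HOL.ext)

lemma con_ext: 
  assumes "k \<noteq> l"
  shows "con k (ext l c) = - ext l (con k c)"
proof -
  have c: "insert k \<tau> - {l} = insert k (\<tau> - {l})" for \<tau> using assms by auto
  show ?thesis
    using assms by (auto simp: con_def ext_def below_sign_remove below_sign_insert c intro!: HOL.ext)
qed

text \<open>Together with \<open>con_ext\<close> these are the Clifford relations. At each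
  \<open>\<tau>\<close> one summand survives, the first if \<open>k \<notin> \<tau>\<close> and the
  second otherwise.\<close>

lemma con_ext_self: "con k (ext k c) + ext k (con k c) = c"
  by (auto simp: con_def ext_def insert_absorb intro!: HOL.ext)

lemma scal_add: "scal p (c + d) = scal p c + scal p d"
  and scal_minus: "scal p (- c) = - scal p c"
  and scal_diff: "scal p (c - d) = scal p c - scal p d"
  and scal_zero [simp]: "scal p 0 = 0" "scal 0 c = 0"
  and scal_scal: "scal p (scal q c) = scal (p * q) c"
  and scal_one [simp]: "scal 1 c = c"
  and scal_left_add: "scal (p + q) c = scal p c + scal q c"
  and scal_left_minus: "scal (- p) c = - scal p c"
  and scal_apply [simp]: "scal p c \<tau> = p * c \<tau>"
  by (auto simp: scal_def algebra_simps intro!: HOL.ext)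

lemma scal_sum:
  fixes f :: "'i \<Rightarrow> nat set \<Rightarrow> 'a::field mpoly"
  shows "scal p (sum f A) = (\<Sum>a\<in>A. scal p (f a))"
  by (auto simp: scal_def sum_apply sum_distrib_left intro!: HOL.ext)

lemma ext_add: "ext k (c + d) = ext k c + ext k d"
  and ext_diff: "ext k (c - d) = ext k c - ext k d"
  and ext_zero [simp]: "ext k 0 = 0"
  and ext_scal: "ext k (scal p c) = scal p (ext k c)"
  by (auto simp: ext_def algebra_simps intro!: HOL.ext)

lemma con_add: "con k (c + d) = con k c + con k d"
  and con_minus: "con k (- c) = - con k c"
  and con_zero [simp]: "con k 0 = 0"
  and con_scal: "con k (scal p c) = scal p (con k c)"
  by (auto simp: con_def algebra_simps intro!: HOL.ext)

lemma ext_sum: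
  fixes f :: "'i \<Rightarrow> nat set \<Rightarrow> 'a::field mpoly"
  shows "ext k (sum f A) = (\<Sum>a\<in>A. ext k (f a))"
  using sum_comp_morphism[of "ext k" f A] by (simp add: ext_add o_def)

lemma con_sum:
  fixes f :: "'i \<Rightarrow> nat set \<Rightarrow> 'a::field mpoly"
  shows "con k (sum f A) = (\<Sum>a\<in>A. con k (f a))"
  using sum_comp_morphism[of "con k" f A] by (simp add: con_add o_def)

section \<open>The differential over the polynomial ring\<close>

lemma bdry_add: "bdry n (c + d) = bdry n c + bdry n d"
  by (simp add: bdry_def con_add scal_add sum.distrib)

lemma bdry_minus: "bdry n (- c) = - bdry n c"
  by (simp add: bdry_def con_minus scal_minus sum_negf)

lemma bdry_diff: "bdry n (c - d) = bdry n c - bdry n d"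
  using bdry_add[of n c "- d"] by (simp add: bdry_minus)

lemma bdry_zero [simp]: "bdry n 0 = 0"
  by (simp add: bdry_def)

lemma bdry_scal: "bdry n (scal p c) = scal p (bdry n c)"
  by (simp add: bdry_def con_scal scal_scal scal_sum mult.commute)

lemma bdry_sum:
  fixes f :: "'i \<Rightarrow> nat set \<Rightarrow> 'a::field mpoly"
  shows "bdry n (sum f A) = (\<Sum>a\<in>A. bdry n (f a))"
  using sum_comp_morphism[of "bdry n" f A] by (simp add: bdry_add o_def)

text \<open>The diagonal needs its own assumption, because in characteristic 2 antisymmetry does not
  make it vanish.\<close>

lemma sum_antisym_eq_0:
  fixes f :: "'i \<Rightarrow> 'i \<Rightarrow> 'b::ab_group_add"
  assumes "finite A" "\<And>k l. f k l = - f l k" "\<And>k. f k k = 0"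
  shows "(\<Sum>k\<in>A. \<Sum>l\<in>A. f k l) = 0"
  using assms(1)
proof (induction A rule: finite_induct)
  case (insert a A)
  have "(\<Sum>k\<in>A. f k a) = - (\<Sum>k\<in>A. f a k)"
    by (subst assms(2)) (simp add: sum_negf)
  with insert show ?case by (simp add: sum.distrib assms(3))
qed simp

lemma bdry_bdry: "bdry n (bdry n c) = 0"
proof -
  have "bdry n (bdry n c) =
    (\<Sum>k\<in>{1..n}. \<Sum>l\<in>{1..n}. scal (xmon {#k#} * xmon {#l#}) (con k (con l c)))"
    by (simp add: bdry_def con_sum con_scal scal_scal scal_sum)
  also have "\<dots> = 0"
  proof (rule sum_antisym_eq_0)
    fix k l
    have "scal (xmon {#k#} * xmon {#l#}) (con k (con l c)) =
       scal (xmon {#k#} * xmon {#l#}) (- con l (con k c))" by (simp only: con_con[of k l])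
    then show "scal (xmon {#k#} * xmon {#l#}) (con k (con l c)) =
       - scal (xmon {#l#} * xmon {#k#}) (con l (con k c))" by (simp add: scal_minus mult.commute)
  qed (simp_all add: con_con_self)
  finally show ?thesis .
qed

text \<open>The Leibniz rule for \<open>e_k\<close>: the summand of \<open>k\<close> produces
  \<open>x_k c\<close> by \<open>con_ext_self\<close>, and all other contractions anticommute with
  \<open>ext k\<close>.\<close>

lemma bdry_ext:
  assumes k: "k \<in> {1..n}"
  shows "bdry n (ext k c) = scal (xmon {#k#}) c - ext k (bdry n c)"
proof -
  have split: "bdry n b = scal (xmon {#k#}) (con k b) +
      (\<Sum>l\<in>{1..n}-{k}. scal (xmon {#l#}) (con l b))" for b :: "nat set \<Rightarrow> 'a mpoly"
    unfolding bdry_def by (rule sum.remove) (use k in auto)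
  have a1: "con k (ext k c) = c - ext k (con k c)"
    using con_ext_self[of k c] by (metis add_diff_cancel_right')
  have a2: "(\<Sum>l\<in>{1..n}-{k}. scal (xmon {#l#}) (con l (ext k c))) =
      - (\<Sum>l\<in>{1..n}-{k}. scal (xmon {#l#}) (ext k (con l c)))"
    by (simp add: con_ext scal_minus sum_negf)
  show ?thesis
    unfolding split ext_add ext_sum ext_scal a1 a2 scal_diff by simp
qed

section \<open>Chains and monomial ideals of coefficients\<close>

text \<open>For upward closed \<open>M\<close>, \<open>coeffs_in M (c - d)\<close> is congruence of
  chains modulo the monomial ideal with monomials \<open>M\<close>.\<close>

definition coeffs_in :: "nat multiset set \<Rightarrow> (nat set \<Rightarrow> 'a::field mpoly) \<Rightarrow> bool" where
  "coeffs_in M c \<longleftrightarrow> (\<forall>\<tau>. keys (c \<tau>) \<subseteq> M)"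

text \<open>Chains vanish off the faces instead of being undefined there, so that the pointwise
  group structure of functions applies.\<close>

definition poly_chains :: "nat \<Rightarrow> nat \<Rightarrow> (nat set \<Rightarrow> 'a::field mpoly) set" where
  "poly_chains n i = {c. coeffs_in (monomials n) c \<and> (\<forall>\<tau>. c \<tau> \<noteq> 0 \<longrightarrow> \<tau> \<in> faces n i)}"

section \<open>Closure properties of congruences and chains\<close>

lemma keys_below_sign_mult [simp]: "keys (below_sign k \<tau> * p) = keys p"
  by (simp add: below_sign_def keys_power_minus_one)

lemma coeffs_in_zero [simp]: "coeffs_in M 0"
  and coeffs_in_minus [simp]: "coeffs_in M (- c) \<longleftrightarrow> coeffs_in M c"
  and coeffs_in_ext: "coeffs_in M c \<Longrightarrow> coeffs_in M (ext k c)"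
  and coeffs_in_con: "coeffs_in M c \<Longrightarrow> coeffs_in M (con k c)"
  by (simp_all add: coeffs_in_def ext_def con_def keys_minus_mpoly)

lemma coeffs_in_add: "coeffs_in M c \<Longrightarrow> coeffs_in M d \<Longrightarrow> coeffs_in M (c + d)"
  unfolding coeffs_in_def plus_fun_apply
  by (intro allI subset_trans[OF Poly_Mapping.keys_add]) simp

lemma coeffs_in_diff: "coeffs_in M c \<Longrightarrow> coeffs_in M d \<Longrightarrow> coeffs_in M (c - d)"
  using coeffs_in_add[of M c "- d"] by simp

lemma coeffs_in_sum:
  assumes "\<And>a. a \<in> A \<Longrightarrow> coeffs_in M (f a)"
  shows "coeffs_in M (sum f A)"
  unfolding coeffs_in_def sum_apply
proof
  fix \<tau>
  have "keys (f a \<tau>) \<subseteq> M" if "a \<in> A" for a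
    using assms[OF that] by (simp add: coeffs_in_def)
  then show "keys (\<Sum>a\<in>A. f a \<tau>) \<subseteq> M"
    using keys_sum_mpoly[of "\<lambda>a. f a \<tau>" A] by blast
qed

lemma coeffs_in_scal: "upward M \<Longrightarrow> coeffs_in M c \<Longrightarrow> coeffs_in M (scal p c)"
  unfolding coeffs_in_def scal_apply by (intro allI upward_keys_mult) simp_all

lemma coeffs_in_scal_xmon:
  "(\<And>v. v \<in> M' \<Longrightarrow> D + v \<in> M) \<Longrightarrow> coeffs_in M' c \<Longrightarrow> coeffs_in M (scal (xmon D) c)"
  unfolding coeffs_in_def scal_apply keys_xmon_mult by (metis image_subset_iff subsetD)

lemma coeffs_in_bdry: "upward M \<Longrightarrow> coeffs_in M c \<Longrightarrow> coeffs_in M (bdry n c)"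
  unfolding bdry_def by (intro coeffs_in_sum coeffs_in_scal coeffs_in_con)

lemma coeffs_in_mono: "coeffs_in M c \<Longrightarrow> M \<subseteq> N \<Longrightarrow> coeffs_in N c"
  unfolding coeffs_in_def by blast

lemma chains_zero [simp]: "0 \<in> poly_chains n i"
  and chains_minus: "c \<in> poly_chains n i \<Longrightarrow> - c \<in> poly_chains n i"
  by (simp_all add: poly_chains_def)

lemma chains_add:
  assumes "c \<in> poly_chains n i" "d \<in> poly_chains n i"
  shows "c + d \<in> poly_chains n i"
proof -
  have "c \<tau> \<noteq> 0 \<or> d \<tau> \<noteq> 0" if "(c + d) \<tau> \<noteq> 0" for \<tau> using that by auto
  then show ?thesis using assms coeffs_in_add[of "monomials n" c d] by (auto simp: poly_chains_def)
qed

lemma chains_diff: "c \<in> poly_chains n i \<Longrightarrow> d \<in> poly_chains n i \<Longrightarrow> c - d \<in> poly_chains n i"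
  using chains_add[of c n i "- d"] chains_minus[of d n i] by simp

lemma chains_sum:
  assumes "\<And>a. a \<in> A \<Longrightarrow> f a \<in> poly_chains n i"
  shows "sum f A \<in> poly_chains n i"
proof -
  have "\<tau> \<in> faces n i" if "sum f A \<tau> \<noteq> 0" for \<tau>
  proof -
    have "\<not> (\<forall>a\<in>A. f a \<tau> = 0)"
      using that unfolding sum_apply by (metis sum.neutral)
    then obtain a where "a \<in> A" "f a \<tau> \<noteq> 0" by blast
    then show ?thesis using assms[of a] by (simp add: poly_chains_def)
  qed
  moreover have "coeffs_in (monomials n) (sum f A)"
    using assms by (intro coeffs_in_sum) (simp add: poly_chains_def)
  ultimately show ?thesis by (simp add: poly_chains_def)
qed

lemma chains_scal:
  assumes "keys p \<subseteq> monomials n" "c \<in> poly_chains n i"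
  shows "scal p c \<in> poly_chains n i"
proof -
  have "c \<tau> \<noteq> 0" if "p * c \<tau> \<noteq> 0" for \<tau> using that by auto
  moreover have "keys (p * c \<tau>) \<subseteq> monomials n" for \<tau>
    using assms by (intro keys_mult_monomials) (simp_all add: poly_chains_def coeffs_in_def)
  ultimately show ?thesis
    using assms by (simp add: poly_chains_def coeffs_in_def)
qed

lemma chains_ext:
  assumes "k \<in> {1..n}" "c \<in> poly_chains n i"
  shows "ext k c \<in> poly_chains n (Suc i)"
proof -
  have "\<tau> \<in> faces n (Suc i)" if "k \<in> \<tau>" "\<tau> - {k} \<in> faces n i" for \<tau>
  proof -
    have "finite \<tau>" using that by (auto simp: faces_def dest: finite_subset[OF _ finite_atLeastAtMost])
    then have "card \<tau> = Suc (card (\<tau> - {k}))" using that by (simp only: card_Suc_Diff1)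
    then show ?thesis using that assms(1) by (auto simp: faces_def)
  qed
  moreover have "k \<in> \<tau> \<and> c (\<tau> - {k}) \<noteq> 0" if "ext k c \<tau> \<noteq> 0" for \<tau>
    using that by (auto simp: ext_def split: if_splits)
  ultimately show ?thesis
    using assms(2) coeffs_in_ext[of "monomials n" c k] by (simp add: poly_chains_def)
qed

lemma chains_con:
  assumes "c \<in> poly_chains n (Suc i)"
  shows "con k c \<in> poly_chains n i"
proof -
  have "\<tau> \<in> faces n i" if "k \<notin> \<tau>" "insert k \<tau> \<in> faces n (Suc i)" for \<tau>
  proof -
    have "finite \<tau>" using that by (auto simp: faces_def dest: finite_subset[OF _ finite_atLeastAtMost])
    then show ?thesis using that by (auto simp: faces_def)
  qed
  moreover have "k \<notin> \<tau> \<and> c (insert k \<tau>) \<noteq> 0" if "con k c \<tau> \<noteq> 0" for \<tau>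
    using that by (auto simp: con_def split: if_splits)
  ultimately show ?thesis
    using assms coeffs_in_con[of "monomials n" c k] by (simp add: poly_chains_def)
qed

lemma chains_bdry: "c \<in> poly_chains n (Suc i) \<Longrightarrow> bdry n c \<in> poly_chains n i"
  unfolding bdry_def by (intro chains_sum chains_scal chains_con) (auto simp: keys_xmon)

section \<open>Koszul homology modulo variables\<close>

definition vars :: "nat set \<Rightarrow> nat multiset set" where
  "vars A = {v. set_mset v \<inter> A \<noteq> {}}"

lemma upward_vars [simp]: "upward (vars A)"
  by (auto simp: upward_def vars_def)

definition unit_chain :: "nat set \<Rightarrow> nat set \<Rightarrow> 'a::field mpoly" where
  "unit_chain \<rho> = (\<lambda>\<tau>. if \<tau> = \<rho> then 1 else 0)"

lemma unit_chain_in_chains: "\<rho> \<in> faces n i \<Longrightarrow> unit_chain \<rho> \<in> poly_chains n i"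
  by (auto simp: poly_chains_def coeffs_in_def unit_chain_def)

abbreviation shift_chain :: "nat \<Rightarrow> (nat set \<Rightarrow> 'a::field mpoly) \<Rightarrow> nat set \<Rightarrow> 'a mpoly" where
  "shift_chain k c \<equiv> (\<lambda>\<tau>. shift {#k#} (c \<tau>))"

text \<open>The effect of setting both \<open>x_k\<close> and \<open>e_k\<close> to zero, a
  projection onto the Koszul complex in the remaining variables.\<close>

definition kill_var :: "nat \<Rightarrow> (nat set \<Rightarrow> 'a::field mpoly) \<Rightarrow> nat set \<Rightarrow> 'a mpoly" where
  "kill_var k c = (\<lambda>\<tau>. if k \<in> \<tau> then 0 else restr {v. k \<notin># v} (c \<tau>))"

lemma shift_restr_split: "xmon {#k#} * shift {#k#} p + restr {v. k \<notin># v} p = p"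
  by (rule poly_mapping_eqI) (auto simp: lookup_add lookup_xmon_mult lookup_shift lookup_restr)

lemma shift_below_sign: "shift D (below_sign k \<tau> * p) = below_sign k \<tau> * shift D p"
  and restr_below_sign: "restr M (below_sign k \<tau> * p) = below_sign k \<tau> * restr M p"
proof -
  have "restr M (- p) = - restr M p" for p :: "'a mpoly"
    by (rule poly_mapping_eqI) (simp add: lookup_restr)
  then show "restr M (below_sign k \<tau> * p) = below_sign k \<tau> * restr M p"
    by (cases "even (card {l \<in> \<tau>. l < k})") (simp_all add: below_sign_def)
  show "shift D (below_sign k \<tau> * p) = below_sign k \<tau> * shift D p"
    by (cases "even (card {l \<in> \<tau>. l < k})") (simp_all add: below_sign_def shift_minus)
qed

lemma shift_sum: "shift D (sum f A) = (\<Sum>a\<in>A. shift D (f a))"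
  by (rule poly_mapping_eqI) (simp add: lookup_shift lookup_sum)

text \<open>Division by \<open>x_k\<close> followed by \<open>ext k\<close> is a homotopy from the
  identity to \<open>kill_var k\<close>. The division commutes with every summand of the
  differential except that of \<open>k\<close>; the defect there is the part of
  \<open>con k c\<close> free of \<open>x_k\<close>, and the Leibniz rule turns it into the
  difference of the two maps.\<close>

lemma shift_chain_homotopy:
  assumes k: "k \<in> {1..n}"
  shows "ext k (shift_chain k (bdry n c)) + bdry n (ext k (shift_chain k c)) = c - kill_var k c"
proof -
  let ?R = "\<lambda>c \<tau>. restr {v. k \<notin># v} (c \<tau>)"
  have split: "bdry n b = scal (xmon {#k#}) (con k b) +
      (\<Sum>l\<in>{1..n}-{k}. scal (xmon {#l#}) (con l b))" for b :: "nat set \<Rightarrow> 'a mpoly"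
    unfolding bdry_def by (rule sum.remove) (use k in auto)
  have con: "shift_chain k (con l c) = con l (shift_chain k c)" for l
    by (auto simp: con_def shift_below_sign)
  have "shift_chain k (bdry n c) - bdry n (shift_chain k c) =
      con k c - scal (xmon {#k#}) (shift_chain k (con k c))" (is "?l = ?r")
  proof (rule HOL.ext)
    fix \<tau>
    have "shift {#k#} (\<Sum>l\<in>{1..n}-{k}. xmon {#l#} * con l c \<tau>) =
        (\<Sum>l\<in>{1..n}-{k}. xmon {#l#} * con l (shift_chain k c) \<tau>)"
      by (simp add: shift_sum shift_var_mult flip: con)
    then show "?l \<tau> = ?r \<tau>" by (simp add: split shift_add sum_apply flip: con)
  qed
  also have "\<dots> = ?R (con k c)"
    by (rule HOL.ext) (use shift_restr_split[of k, where 'a='a] in \<open>simp add: algebra_simps\<close>)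
  finally have 1: "shift_chain k (bdry n c) - bdry n (shift_chain k c) = ?R (con k c)" .
  have "ext k (shift_chain k (bdry n c)) + bdry n (ext k (shift_chain k c)) =
      scal (xmon {#k#}) (shift_chain k c) +
      ext k (shift_chain k (bdry n c) - bdry n (shift_chain k c))"
    by (simp add: bdry_ext[OF k] ext_diff)
  also have "\<dots> = scal (xmon {#k#}) (shift_chain k c) + ext k (?R (con k c))"
    unfolding 1 ..
  also have "\<dots> = c - kill_var k c"
  proof (rule HOL.ext)
    fix \<tau>
    have "xmon {#k#} * shift {#k#} (c \<tau>) = c \<tau> - restr {v. k \<notin># v} (c \<tau>)"
      using shift_restr_split[of k "c \<tau>"] by (metis add_diff_cancel_right')
    moreover have "ext k (?R (con k c)) \<tau> = (if k \<in> \<tau> then restr {v. k \<notin># v} (c \<tau>) else 0)"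
      by (auto simp: ext_def con_def restr_below_sign insert_absorb)
    ultimately show "(scal (xmon {#k#}) (shift_chain k c) + ext k (?R (con k c))) \<tau> =
        (c - kill_var k c) \<tau>"
      by (simp add: kill_var_def)
  qed
  finally show ?thesis .
qed

text \<open>Each variable outside \<open>A\<close> is removed by the homotopy, at the price of a
  boundary. The cycle condition holds only modulo the variables in \<open>A\<close>, so division by
  \<open>x_k\<close> must preserve that ideal, which it does because
  \<open>k \<notin> A\<close>.\<close>

lemma kill_vars:
  fixes c :: "nat set \<Rightarrow> 'a::field mpoly"
  assumes c: "c \<in> poly_chains n i" and A: "coeffs_in (vars A) (bdry n c)"
    and B: "finite B" "B \<subseteq> {1..n} - A"
  shows "\<exists>w c'. w \<in> poly_chains n (Suc i) \<and> c' \<in> poly_chains n i \<and>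
     coeffs_in (vars A) (c - bdry n w - c') \<and>
     (\<forall>\<tau>. c' \<tau> \<noteq> 0 \<longrightarrow> \<tau> \<inter> B = {}) \<and> (\<forall>\<tau>. \<forall>v \<in> keys (c' \<tau>). set_mset v \<inter> B = {})"
  using B
proof (induction B rule: finite_induct)
  case empty
  have "0 \<in> poly_chains n (Suc i) \<and> c \<in> poly_chains n i \<and>
     coeffs_in (vars A) (c - bdry n 0 - c) \<and>
     (\<forall>\<tau>. c \<tau> \<noteq> 0 \<longrightarrow> \<tau> \<inter> {} = {}) \<and> (\<forall>\<tau>. \<forall>v \<in> keys (c \<tau>). set_mset v \<inter> {} = {})"
    using c by simp
  then show ?case by (intro exI[of _ 0] exI[of _ c])
next
  case (insert k B)
  have "B \<subseteq> {1..n} - A" using insert.prems by auto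
  from insert.IH[OF this] obtain w c' where w: "w \<in> poly_chains n (Suc i)" "c' \<in> poly_chains n i"
      "coeffs_in (vars A) (c - bdry n w - c')"
      "\<And>\<tau>. c' \<tau> \<noteq> 0 \<Longrightarrow> \<tau> \<inter> B = {}" "\<And>\<tau> v. v \<in> keys (c' \<tau>) \<Longrightarrow> set_mset v \<inter> B = {}"
    by (elim exE conjE) (rule that, assumption+, (erule allE, erule (1) mp)+, (erule allE)+, erule (1) bspec)
  have k: "k \<in> {1..n}" "k \<notin> A" using insert by auto
  have sc: "shift_chain k c' \<in> poly_chains n i"
  proof -
    have "c' \<tau> \<noteq> 0" if "shift {#k#} (c' \<tau>) \<noteq> 0" for \<tau> using that by auto
    moreover have "keys (shift {#k#} (c' \<tau>)) \<subseteq> monomials n" for \<tau>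
      using w(2) by (force simp: poly_chains_def coeffs_in_def keys_shift)
    ultimately show ?thesis using w(2) by (simp add: poly_chains_def coeffs_in_def)
  qed
  define w' where "w' = w + ext k (shift_chain k c')"
  have w': "w' \<in> poly_chains n (Suc i)"
    unfolding w'_def by (intro chains_add w chains_ext k sc)
  have "coeffs_in (vars A) (bdry n (c - bdry n w - c'))"
    using w(3) by (intro coeffs_in_bdry) auto
  then have "coeffs_in (vars A) (bdry n c - bdry n c')"
    by (simp add: bdry_diff bdry_bdry)
  from coeffs_in_diff[OF A this] have "coeffs_in (vars A) (bdry n c')" by simp
  then have "coeffs_in (vars A) (shift_chain k (bdry n c'))"
    using k by (auto simp: coeffs_in_def keys_shift vars_def) fastforce
  then have "coeffs_in (vars A) (ext k (shift_chain k (bdry n c')))"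
    by (rule coeffs_in_ext)
  also have "ext k (shift_chain k (bdry n c')) = c' - kill_var k c' - bdry n (ext k (shift_chain k c'))"
    using shift_chain_homotopy[OF k(1), of c'] by (metis add_diff_cancel_right')
  finally have "coeffs_in (vars A)
      (c - bdry n w - c' + (c' - kill_var k c' - bdry n (ext k (shift_chain k c'))))"
    using w(3) by (intro coeffs_in_add)
  also have "c - bdry n w - c' + (c' - kill_var k c' - bdry n (ext k (shift_chain k c'))) =
      c - bdry n w' - kill_var k c'"
    by (simp add: w'_def bdry_add)
  finally have "coeffs_in (vars A) (c - bdry n w' - kill_var k c')" .
  moreover have "kill_var k c' \<in> poly_chains n i"
  proof -
    have "c' \<tau> \<noteq> 0" if "kill_var k c' \<tau> \<noteq> 0" for \<tau>
      using that by (auto simp: kill_var_def split: if_splits)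
    moreover have "keys (kill_var k c' \<tau>) \<subseteq> keys (c' \<tau>)" for \<tau>
      by (auto simp: kill_var_def keys_restr)
    ultimately show ?thesis using w(2) unfolding poly_chains_def coeffs_in_def by blast
  qed
  moreover have "\<tau> \<inter> insert k B = {}" if "kill_var k c' \<tau> \<noteq> 0" for \<tau>
    using that w(4)[of \<tau>] by (cases "c' \<tau> = 0") (auto simp: kill_var_def split: if_splits)
  moreover have "set_mset v \<inter> insert k B = {}" if "v \<in> keys (kill_var k c' \<tau>)" for v \<tau>
    using that w(5)[of v \<tau>] by (auto simp: kill_var_def keys_restr split: if_splits)
  ultimately show ?case using w' by blast
qed

text \<open>Once the variables outside \<open>A\<close> are gone, every nonconstant monomial
  contains a variable in \<open>A\<close> and vanishes in the quotient. Only constant multiples of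
  the \<open>e_\<rho>\<close> with \<open>\<rho> \<subseteq> A\<close> survive, so these span the
  homology modulo the variables in \<open>A\<close>.\<close>

lemma koszul_mod_vars:
  fixes c :: "nat set \<Rightarrow> 'a::field mpoly"
  assumes c: "c \<in> poly_chains n i" and A: "coeffs_in (vars A) (bdry n c)" "A \<subseteq> {1..n}"
  shows "\<exists>a w. w \<in> poly_chains n (Suc i) \<and>
     coeffs_in (vars A) (c - bdry n w -
       (\<Sum>\<rho> | \<rho> \<subseteq> A \<and> card \<rho> = i. scal (const_poly (a \<rho>)) (unit_chain \<rho>)))"
proof -
  obtain w c' where w: "w \<in> poly_chains n (Suc i)" "c' \<in> poly_chains n i"
      "coeffs_in (vars A) (c - bdry n w - c')"
      "\<And>\<tau>. c' \<tau> \<noteq> 0 \<Longrightarrow> \<tau> \<inter> ({1..n} - A) = {}"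
      "\<And>\<tau> v. v \<in> keys (c' \<tau>) \<Longrightarrow> set_mset v \<inter> ({1..n} - A) = {}"
    using kill_vars[OF c A(1) finite_Diff[OF finite_atLeastAtMost] order_refl]
    by (elim exE conjE) (rule that, assumption+, (erule allE, erule (1) mp)+, (erule allE)+, erule (1) bspec)
  define a where "a \<rho> = lookup (c' \<rho>) {#}" for \<rho>
  let ?s = "\<Sum>\<rho> | \<rho> \<subseteq> A \<and> card \<rho> = i. scal (const_poly (a \<rho>)) (unit_chain \<rho>)"
  have fin: "finite {\<rho>. \<rho> \<subseteq> A \<and> card \<rho> = i}"
    by (rule finite_subset[of _ "Pow {1..n}"]) (use A(2) in auto)
  have s: "?s \<tau> = (if \<tau> \<subseteq> A \<and> card \<tau> = i then const_poly (a \<tau>) else 0)" for \<tau>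
    using fin by (simp add: sum_apply unit_chain_def if_distrib[of "\<lambda>x. _ * x"] sum.delta cong: if_cong)
  have "coeffs_in (vars A) (c' - ?s)"
    unfolding coeffs_in_def
  proof (intro allI subsetI)
    fix \<tau> v assume v: "v \<in> keys ((c' - ?s) \<tau>)"
    have face: "\<tau> \<in> faces n i" "\<tau> \<subseteq> A" if "c' \<tau> \<noteq> 0"
      using that w(2) w(4)[OF that] by (auto simp: poly_chains_def faces_def)
    have c'0: "c' \<tau> \<noteq> 0"
    proof
      assume 0: "c' \<tau> = 0"
      then have "const_poly (a \<tau>) = 0" by (simp add: a_def const_poly_def)
      with 0 v show False by (simp add: s split: if_splits)
    qed
    then have eq: "(c' - ?s) \<tau> = c' \<tau> - const_poly (a \<tau>)"
      using face by (simp add: s faces_def)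
    have "v \<noteq> {#}" using v unfolding eq
      by (auto simp: in_keys_iff lookup_minus const_poly_def a_def)
    moreover have "v \<in> keys (c' \<tau>)"
      using v \<open>v \<noteq> {#}\<close> unfolding eq
      by (auto simp: in_keys_iff lookup_minus const_poly_def lookup_single)
    moreover have "set_mset v \<subseteq> {1..n}"
      using calculation w(2) by (auto simp: poly_chains_def coeffs_in_def monomials_def)
    ultimately show "v \<in> vars A" using w(5)[of v \<tau>] by (auto simp: vars_def)
  qed
  from coeffs_in_add[OF w(3) this] show ?thesis using w(1) by (auto simp: algebra_simps)
qed

section \<open>Koszul homology of ideals with linear quotients\<close>

lemma const_poly_zero [simp]: "const_poly 0 = 0"
  by (simp add: const_poly_def)

lemma const_poly_mult: "const_poly (a * b) = const_poly a * const_poly b"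
  by (simp add: const_poly_def mult_single)

lemma keys_const_poly: "keys (const_poly a) \<subseteq> {{#}}"
  by (simp add: const_poly_def)

lemma keys_const_poly_monomials: "keys (const_poly a) \<subseteq> monomials n"
  using keys_const_poly[of a] by auto

text \<open>The differential is minimal: each of its summands carries a variable. The linear
  independence of the classes rests on this, since constant coefficients cannot come from
  boundaries.\<close>

lemma lookup_bdry_empty: "lookup (bdry n c \<tau>) {#} = 0"
  by (simp add: bdry_def sum_apply lookup_sum lookup_xmon_mult)

text \<open>Sorting the monomials of \<open>y\<close> by membership in \<open>up H\<close> leaves
  only multiples of \<open>u\<close> in the second part. This plays the role of the isomorphism
  between \<open>(J + (u)) / J\<close> and \<open>S / (J : u)\<close>.\<close>

lemma coeffs_in_up_insert_split:
  assumes "coeffs_in (up (insert u H)) y" "y \<in> poly_chains n i"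
  obtains h c where "y = h + scal (xmon u) c" "coeffs_in (up H) h" "c \<in> poly_chains n i"
proof
  define h where "h = (\<lambda>\<tau>. restr (up H) (y \<tau>))"
  define c where "c = (\<lambda>\<tau>. shift u (restr (- up H) (y \<tau>)))"
  have "restr (up H) p + restr (- up H) p = p" for p :: "'a mpoly"
    by (rule poly_mapping_eqI) (simp add: lookup_add lookup_restr)
  moreover have "xmon u * c \<tau> = restr (- up H) (y \<tau>)" for \<tau>
    unfolding c_def
    by (rule xmon_mult_shift) (use assms(1) in \<open>auto simp: keys_restr coeffs_in_def up_def\<close>)
  ultimately show "y = h + scal (xmon u) c"
    by (simp add: fun_eq_iff h_def)
  show "coeffs_in (up H) h"
    by (simp add: h_def coeffs_in_def keys_restr)
  have "y \<tau> \<noteq> 0" if "c \<tau> \<noteq> 0" for \<tau> using that by (auto simp: c_def)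
  moreover have "keys (c \<tau>) \<subseteq> monomials n" for \<tau>
    using assms(2) by (fastforce simp: c_def keys_shift keys_restr poly_chains_def coeffs_in_def)
  ultimately show "c \<in> poly_chains n i"
    using assms(2) by (simp add: poly_chains_def coeffs_in_def)
qed

lemma up_mono: "H \<subseteq> H' \<Longrightarrow> up H \<subseteq> up H'"
  by (auto simp: up_def)

text \<open>The generators are added in the order of \<open>rank\<close>, and \<open>A u\<close>
  lists the variables that generate the colon ideal at \<open>u\<close>. Assumption
  \<open>e_bdry\<close> describes the connecting map on \<open>e u \<sigma>\<close>; for the cycles
  of the theorem its sign arises when the differential passes the \<open>card \<sigma>\<close>
  factors of the product.\<close>

locale linear_quotients =
  fixes n :: nat and G :: "nat multiset set" and rank :: "nat multiset \<Rightarrow> 'r::linorder"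
    and A :: "nat multiset \<Rightarrow> nat set"
    and e :: "nat multiset \<Rightarrow> nat set \<Rightarrow> nat set \<Rightarrow> 'a::field mpoly"
  assumes finite_G: "finite G" and inj_rank: "inj_on rank G"
    and G_monomials: "G \<subseteq> monomials n"
    and A_subset: "u \<in> G \<Longrightarrow> A u \<subseteq> {1..n}"
    and colon: "u \<in> G \<Longrightarrow> u + v \<in> up {g \<in> G. rank g < rank u} \<longleftrightarrow> v \<in> vars (A u)"
    and e_chain: "u \<in> G \<Longrightarrow> \<sigma> \<subseteq> A u \<Longrightarrow> e u \<sigma> \<in> poly_chains n (Suc (card \<sigma>))"
    and e_bdry: "u \<in> G \<Longrightarrow> \<sigma> \<subseteq> A u \<Longrightarrow> coeffs_in (up {g \<in> G. rank g < rank u})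
      (bdry n (e u \<sigma>) - scal ((- 1) ^ card \<sigma> * xmon u) (unit_chain \<sigma>))"
begin

definition subs :: "nat multiset \<Rightarrow> nat \<Rightarrow> nat set set" where
  "subs u j = {\<sigma>. \<sigma> \<subseteq> A u \<and> card \<sigma> = j}"

definition idx :: "nat multiset set \<Rightarrow> nat \<Rightarrow> (nat multiset \<times> nat set) set" where
  "idx H j = {(u, \<sigma>). u \<in> H \<and> \<sigma> \<subseteq> A u \<and> card \<sigma> = j}"

definition comb :: "(nat multiset \<times> nat set \<Rightarrow> 'a) \<Rightarrow> nat multiset set \<Rightarrow> nat \<Rightarrow> nat set \<Rightarrow> 'a mpoly" where
  "comb a H j = (\<Sum>p\<in>idx H j. scal (const_poly (a p)) (e (fst p) (snd p)))"

definition ecomb :: "nat multiset \<Rightarrow> nat \<Rightarrow> (nat set \<Rightarrow> 'a) \<Rightarrow> nat set \<Rightarrow> 'a mpoly" where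
  "ecomb u j b = (\<Sum>\<sigma>\<in>subs u j. scal (const_poly (b \<sigma>)) (e u \<sigma>))"

definition ucomb :: "nat multiset \<Rightarrow> nat \<Rightarrow> (nat set \<Rightarrow> 'a) \<Rightarrow> nat set \<Rightarrow> 'a mpoly" where
  "ucomb u j b = (\<Sum>\<sigma>\<in>subs u j. scal (const_poly (b \<sigma>)) (unit_chain \<sigma>))"

lemma finite_subs: "u \<in> G \<Longrightarrow> finite (subs u j)"
  by (rule finite_subset[of _ "Pow {1..n}"]) (use A_subset in \<open>auto simp: subs_def\<close>)

lemma idx_eq: "idx H j = Sigma H (\<lambda>u. subs u j)"
  by (auto simp: idx_def subs_def)

lemma finite_idx: "H \<subseteq> G \<Longrightarrow> finite (idx H j)"
  unfolding idx_eq using finite_G finite_subs by (auto intro!: finite_SigmaI dest: finite_subset)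

lemma comb_insert:
  assumes "insert u H \<subseteq> G" "u \<notin> H"
  shows "comb a (insert u H) j = comb a H j + ecomb u j (\<lambda>\<sigma>. a (u, \<sigma>))"
proof -
  have un: "idx (insert u H) j = idx H j \<union> Pair u ` subs u j"
    by (auto simp: idx_eq)
  have "comb a (insert u H) j = comb a H j +
      (\<Sum>p\<in>Pair u ` subs u j. scal (const_poly (a p)) (e (fst p) (snd p)))"
    unfolding comb_def un
    by (rule sum.union_disjoint) (use assms finite_idx finite_subs in \<open>auto simp: idx_eq\<close>)
  also have "(\<Sum>p\<in>Pair u ` subs u j. scal (const_poly (a p)) (e (fst p) (snd p))) =
      ecomb u j (\<lambda>\<sigma>. a (u, \<sigma>))"
    by (subst sum.reindex) (auto simp: inj_on_def ecomb_def)
  finally show ?thesis .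
qed

lemma ecomb_chain: "u \<in> G \<Longrightarrow> ecomb u j b \<in> poly_chains n (Suc j)"
  unfolding ecomb_def
  by (intro chains_sum chains_scal keys_const_poly_monomials) (use e_chain in \<open>auto simp: subs_def\<close>)

text \<open>The coefficients are multiplied by \<open>(- 1) ^ j\<close> to cancel the sign in
  \<open>e_bdry\<close>. Every combination of the \<open>e_\<sigma>\<close> is thus in the image of
  the connecting map: \<open>u\<close> times it is a boundary modulo the ideal of the preceding
  generators.\<close>

lemma ecomb_bdry:
  assumes u: "u \<in> G"
  shows "coeffs_in (up {g \<in> G. rank g < rank u})
    (scal (xmon u) (ucomb u j b) - bdry n (ecomb u j (\<lambda>\<sigma>. (- 1) ^ j * b \<sigma>)))"
proof -
  have sq: "const_poly ((- 1) ^ j * x) * (- 1) ^ j = const_poly x" for x :: 'a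
    by (cases "even j") (simp_all add: const_poly_def single_uminus)
  have sq': "const_poly ((- 1) ^ j * x) * ((- 1) ^ j * xmon u) = xmon u * const_poly x" for x :: 'a
    using arg_cong[OF sq[of x], of "\<lambda>p. p * xmon u"]
    by (simp only: mult.assoc mult.commute[of "xmon u"])
  have "coeffs_in (up {g \<in> G. rank g < rank u})
    (- (\<Sum>\<sigma>\<in>subs u j. scal (const_poly ((- 1) ^ j * b \<sigma>))
       (bdry n (e u \<sigma>) - scal ((- 1) ^ j * xmon u) (unit_chain \<sigma>))))"
    unfolding coeffs_in_minus
    by (intro coeffs_in_sum coeffs_in_scal upward_up) (use e_bdry[OF u] in \<open>auto simp: subs_def\<close>)
  also have "- (\<Sum>\<sigma>\<in>subs u j. scal (const_poly ((- 1) ^ j * b \<sigma>))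
       (bdry n (e u \<sigma>) - scal ((- 1) ^ j * xmon u) (unit_chain \<sigma>))) =
     (\<Sum>\<sigma>\<in>subs u j. scal (const_poly ((- 1) ^ j * b \<sigma>)) (scal ((- 1) ^ j * xmon u) (unit_chain \<sigma>))) -
     (\<Sum>\<sigma>\<in>subs u j. scal (const_poly ((- 1) ^ j * b \<sigma>)) (bdry n (e u \<sigma>)))"
    by (simp add: scal_diff sum_subtractf)
  also have "(\<Sum>\<sigma>\<in>subs u j. scal (const_poly ((- 1) ^ j * b \<sigma>)) (scal ((- 1) ^ j * xmon u) (unit_chain \<sigma>)))
     = scal (xmon u) (ucomb u j b)"
    by (simp add: ucomb_def scal_sum scal_scal sq')
  also have "(\<Sum>\<sigma>\<in>subs u j. scal (const_poly ((- 1) ^ j * b \<sigma>)) (bdry n (e u \<sigma>))) =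
     bdry n (ecomb u j (\<lambda>\<sigma>. (- 1) ^ j * b \<sigma>))"
    by (simp add: ecomb_def bdry_sum bdry_scal)
  finally show ?thesis .
qed

lemma coeffs_in_colon:
  assumes "u \<in> G"
  shows "coeffs_in (up {g \<in> G. rank g < rank u}) (scal (xmon u) c) \<longleftrightarrow> coeffs_in (vars (A u)) c"
  by (auto simp: coeffs_in_def keys_xmon_mult image_subset_iff colon[OF assms])

lemma lower_set_induct [consumes 0, case_names empty insert]:
  assumes "P {}"
    and "\<And>u. u \<in> G \<Longrightarrow> P {g \<in> G. rank g < rank u} \<Longrightarrow> P (insert u {g \<in> G. rank g < rank u})"
  shows "P G"
proof -
  \<comment> \<open>The ranking induction inserts elements of weakly increasing rank. Carrying the
    downward closedness of \<open>H\<close> along identifies each stage with the set of all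
    generators before \<open>u\<close>; injectivity of \<open>rank\<close> excludes ties.\<close>
  have "H \<subseteq> G \<longrightarrow> (\<forall>g\<in>G. \<forall>s\<in>H. rank g < rank s \<longrightarrow> g \<in> H) \<longrightarrow> P H" if "finite H" for H
    using that
  proof (induction H rule: finite_ranking_induct[where f = rank])
    case empty
    show ?case using assms(1) by blast
  next
    case (insert u S)
    show ?case
    proof (cases "u \<in> S")
      case True
      with insert.IH show ?thesis by (simp add: insert_absorb)
    next
      case False
      show ?thesis
      proof (intro impI)
        assume sub: "insert u S \<subseteq> G"
          and low: "\<forall>g\<in>G. \<forall>s\<in>insert u S. rank g < rank s \<longrightarrow> g \<in> insert u S"
        have S: "S = {g \<in> G. rank g < rank u}"
        proof (intro equalityI subsetI)
          fix g assume g: "g \<in> S"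
          then have "rank g \<noteq> rank u" using sub False inj_rank by (auto simp: inj_on_def)
          with insert.hyps g sub show "g \<in> {g \<in> G. rank g < rank u}" by force
        qed (use low in auto)
        have "P S" using insert.IH sub by (auto simp: S)
        with assms(2)[of u] sub show "P (insert u S)" by (simp add: S)
      qed
    qed
  qed
  from this[OF finite_G] show ?thesis by blast
qed

text \<open>Let \<open>J\<close> be generated by the elements before \<open>u\<close>. If
  \<open>z\<close> is a cycle modulo \<open>J + (u)\<close>, then \<open>bdry n z = h + u c\<close>
  with \<open>h\<close> in \<open>J\<close>, and \<open>c\<close> is a cycle modulo
  \<open>J : u\<close>. Up to a boundary, \<open>c\<close> is a combination of the
  \<open>e_\<sigma>\<close>, which the matching combination of the \<open>e u \<sigma>\<close>
  removes. What is left is a cycle modulo \<open>J\<close>, to which the induction applies.\<close>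

lemma cycles_spanned:
  assumes "z \<in> poly_chains n (Suc j)" "coeffs_in (up G) (bdry n z)"
  shows "\<exists>a w. w \<in> poly_chains n (Suc (Suc j)) \<and> coeffs_in (up G) (z - bdry n w - comb a G j)"
proof -
  have "\<forall>z \<in> poly_chains n (Suc j). coeffs_in (up G) (bdry n z) \<longrightarrow>
    (\<exists>a w. w \<in> poly_chains n (Suc (Suc j)) \<and> coeffs_in (up G) (z - bdry n w - comb a G j))"
  proof (rule lower_set_induct, intro ballI impI)
    fix z :: "nat set \<Rightarrow> 'a mpoly"
    assume z: "z \<in> poly_chains n (Suc j)" "coeffs_in (up {}) (bdry n z)"
    have e: "up {} = {}" "vars {} = {}" by (auto simp: up_def vars_def)
    have no: "{\<rho>. \<rho> \<subseteq> {} \<and> card \<rho> = Suc j} = ({} :: nat set set)" by auto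
    have comb: "comb a {} j = 0" for a by (simp add: comb_def idx_def)
    \<comment> \<open>The ring \<open>S\<close> has no Koszul homology in positive degree, because
      the empty set of variables has no subset of size \<open>Suc j\<close>.\<close>
    from koszul_mod_vars[OF z(1), of "{}"] z(2)
    show "\<exists>a w. w \<in> poly_chains n (Suc (Suc j)) \<and> coeffs_in (up {}) (z - bdry n w - comb a {} j)"
      unfolding e no comb by simp
  next
    fix u assume u: "u \<in> G"
    define H where "H = {g \<in> G. rank g < rank u}"
    have H: "insert u H \<subseteq> G" "u \<notin> H" using u by (auto simp: H_def)
    assume IH: "\<forall>z \<in> poly_chains n (Suc j). coeffs_in (up {g \<in> G. rank g < rank u}) (bdry n z) \<longrightarrow>
      (\<exists>a w. w \<in> poly_chains n (Suc (Suc j)) \<and>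
        coeffs_in (up {g \<in> G. rank g < rank u}) (z - bdry n w - comb a {g \<in> G. rank g < rank u} j))"
    note IH = IH[folded H_def]
    show "\<forall>z \<in> poly_chains n (Suc j). coeffs_in (up (insert u {g \<in> G. rank g < rank u})) (bdry n z) \<longrightarrow>
      (\<exists>a w. w \<in> poly_chains n (Suc (Suc j)) \<and>
        coeffs_in (up (insert u {g \<in> G. rank g < rank u}))
          (z - bdry n w - comb a (insert u {g \<in> G. rank g < rank u}) j))"
      unfolding H_def[symmetric]
    proof (intro ballI impI)
      fix z :: "nat set \<Rightarrow> 'a mpoly"
      assume z: "z \<in> poly_chains n (Suc j)" "coeffs_in (up (insert u H)) (bdry n z)"
      obtain h c where hc: "bdry n z = h + scal (xmon u) c" "coeffs_in (up H) h" "c \<in> poly_chains n j"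
        using coeffs_in_up_insert_split[OF z(2) chains_bdry[OF z(1)]] .
      have "bdry n h + scal (xmon u) (bdry n c) = 0"
        using bdry_bdry[of n z] by (simp add: hc(1) bdry_add bdry_scal)
      then have "scal (xmon u) (bdry n c) = - bdry n h" by (metis add.commute minus_unique)
      moreover have "coeffs_in (up H) (bdry n h)" using hc(2) by (intro coeffs_in_bdry upward_up)
      ultimately have "coeffs_in (vars (A u)) (bdry n c)"
        using coeffs_in_colon[OF u, of "bdry n c"] by (simp add: H_def)
      then obtain b w where w: "w \<in> poly_chains n (Suc j)"
          "coeffs_in (vars (A u)) (c - bdry n w - ucomb u j b)"
        using koszul_mod_vars[OF hc(3) _ A_subset[OF u]] unfolding ucomb_def subs_def by blast
      define b' where "b' = (\<lambda>\<sigma>. (- 1) ^ j * b \<sigma>)"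
      \<comment> \<open>The differential of \<open>z'\<close> has coefficients in \<open>J\<close>.
        The subtracted \<open>scal (xmon u) w\<close> is harmless at the end, as it vanishes modulo
        \<open>J + (u)\<close>.\<close>
      define z' where "z' = z - scal (xmon u) w - ecomb u j b'"
      have um: "u \<in> monomials n" using u G_monomials by blast
      have z'1: "z' \<in> poly_chains n (Suc j)"
        unfolding z'_def by (intro chains_diff chains_scal z w ecomb_chain u) (simp add: um)
      have "bdry n z' = h + scal (xmon u) (c - bdry n w - ucomb u j b) +
          (scal (xmon u) (ucomb u j b) - bdry n (ecomb u j b'))"
        by (simp add: z'_def bdry_diff bdry_scal hc(1) scal_diff)
      moreover have "coeffs_in (up H) (scal (xmon u) (c - bdry n w - ucomb u j b))"
        using w(2) coeffs_in_colon[OF u, of "c - bdry n w - ucomb u j b"] by (simp add: H_def)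
      moreover have "coeffs_in (up H) (scal (xmon u) (ucomb u j b) - bdry n (ecomb u j b'))"
        using ecomb_bdry[OF u] by (simp add: H_def b'_def)
      ultimately have "coeffs_in (up H) (bdry n z')"
        using hc(2) by (simp only: coeffs_in_add)
      with IH z'1 obtain a w' where w': "w' \<in> poly_chains n (Suc (Suc j))"
          "coeffs_in (up H) (z' - bdry n w' - comb a H j)"
        by blast
      define a' where "a' = (\<lambda>p. if fst p = u then b' (snd p) else a p)"
      have "comb a' H j = comb a H j"
        unfolding comb_def by (rule sum.cong) (use H in \<open>auto simp: idx_def a'_def\<close>)
      then have "comb a' (insert u H) j = comb a H j + ecomb u j b'"
        by (simp add: comb_insert[OF H]) (simp add: a'_def)
      then have "z - bdry n w' - comb a' (insert u H) j =
          (z' - bdry n w' - comb a H j) + scal (xmon u) w"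
        by (simp add: z'_def)
      moreover have "coeffs_in (up (insert u H)) (z' - bdry n w' - comb a H j)"
        using w'(2) by (rule coeffs_in_mono) (auto intro: up_mono[THEN subsetD, rotated])
      moreover have "coeffs_in (up (insert u H)) (scal (xmon u) w)"
        by (rule coeffs_in_scal_xmon[of UNIV]) (auto simp: up_def coeffs_in_def)
      ultimately have "coeffs_in (up (insert u H)) (z - bdry n w' - comb a' (insert u H) j)"
        by (simp only: coeffs_in_add)
      with w'(1) show "\<exists>a w. w \<in> poly_chains n (Suc (Suc j)) \<and>
          coeffs_in (up (insert u H)) (z - bdry n w - comb a (insert u H) j)"
        by blast
    qed
  qed
  with assms show ?thesis by blast
qed

text \<open>As soon as \<open>u\<close> joins the ideal, the leading term
  \<open>u e_\<sigma>\<close> of the differential vanishes too, and \<open>e u \<sigma>\<close>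
  becomes a cycle.\<close>

lemma bdry_e_in_up:
  assumes "u \<in> G" "\<sigma> \<subseteq> A u"
  shows "coeffs_in (up (insert u {g \<in> G. rank g < rank u})) (bdry n (e u \<sigma>))"
proof -
  have "coeffs_in (up (insert u {g \<in> G. rank g < rank u}))
      (bdry n (e u \<sigma>) - scal ((- 1) ^ card \<sigma> * xmon u) (unit_chain \<sigma>))"
    using e_bdry[OF assms] by (rule coeffs_in_mono) (auto intro: up_mono[THEN subsetD, rotated])
  moreover have "coeffs_in (up (insert u {g \<in> G. rank g < rank u}))
      (scal (xmon u) (scal ((- 1) ^ card \<sigma>) (unit_chain \<sigma>)))"
    by (rule coeffs_in_scal_xmon[of UNIV]) (auto simp: up_def coeffs_in_def)
  ultimately show ?thesis
    using coeffs_in_add[of _ "bdry n (e u \<sigma>) - scal ((- 1) ^ card \<sigma> * xmon u) (unit_chain \<sigma>)"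
        "scal (xmon u) (scal ((- 1) ^ card \<sigma>) (unit_chain \<sigma>))"]
    by (simp add: scal_scal mult.commute)
qed

lemma lookup_ucomb_empty:
  assumes "u \<in> G" "\<sigma> \<in> subs u j"
  shows "lookup (ucomb u j b \<sigma>) {#} = b \<sigma>"
proof -
  have "lookup (ucomb u j b \<sigma>) {#} = (\<Sum>\<rho>\<in>subs u j. if \<rho> = \<sigma> then b \<rho> else 0)"
    unfolding ucomb_def sum_apply lookup_sum
    by (rule sum.cong) (auto simp: unit_chain_def const_poly_def)
  then show ?thesis using assms finite_subs by simp
qed

text \<open>With \<open>J\<close> as before, a relation modulo \<open>J + (u)\<close> has the form
  \<open>h + u c\<close>. Applying the differential shows that \<open>ucomb u j b - bdry n c\<close>
  has its coefficients in \<open>J : u\<close>, an ideal generated by variables. Its constant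
  coefficients are the \<open>b \<sigma>\<close>, so these vanish, and it remains to turn the
  relation into one modulo \<open>J\<close>.\<close>

lemma cycles_independent:
  assumes "w \<in> poly_chains n (Suc (Suc j))" "coeffs_in (up G) (comb a G j - bdry n w)"
    and "p \<in> idx G j"
  shows "a p = 0"
proof -
  have "\<forall>w \<in> poly_chains n (Suc (Suc j)). coeffs_in (up G) (comb a G j - bdry n w) \<longrightarrow>
    (\<forall>p \<in> idx G j. a p = 0)"
  proof (rule lower_set_induct)
    fix u assume u: "u \<in> G"
    define H where "H = {g \<in> G. rank g < rank u}"
    have H: "insert u H \<subseteq> G" "u \<notin> H" using u by (auto simp: H_def)
    assume IH: "\<forall>w \<in> poly_chains n (Suc (Suc j)).
      coeffs_in (up {g \<in> G. rank g < rank u}) (comb a {g \<in> G. rank g < rank u} j - bdry n w) \<longrightarrow>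
      (\<forall>p \<in> idx {g \<in> G. rank g < rank u} j. a p = 0)"
    note IH = IH[folded H_def]
    show "\<forall>w \<in> poly_chains n (Suc (Suc j)).
      coeffs_in (up (insert u {g \<in> G. rank g < rank u}))
        (comb a (insert u {g \<in> G. rank g < rank u}) j - bdry n w) \<longrightarrow>
      (\<forall>p \<in> idx (insert u {g \<in> G. rank g < rank u}) j. a p = 0)"
      unfolding H_def[symmetric]
    proof (intro ballI impI)
      fix w :: "nat set \<Rightarrow> 'a mpoly" and p
      assume w: "w \<in> poly_chains n (Suc (Suc j))"
          "coeffs_in (up (insert u H)) (comb a (insert u H) j - bdry n w)"
        and p: "p \<in> idx (insert u H) j"
      let ?E = "ecomb u j (\<lambda>\<sigma>. a (u, \<sigma>))"
      have um: "u \<in> monomials n" using u G_monomials by blast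
      have comb_chain: "comb a H' j \<in> poly_chains n (Suc j)" if "H' \<subseteq> G" for H'
        unfolding comb_def
        by (intro chains_sum chains_scal keys_const_poly_monomials)
          (use that e_chain in \<open>auto simp: idx_def\<close>)
      have "comb a (insert u H) j - bdry n w \<in> poly_chains n (Suc j)"
        by (intro chains_diff chains_bdry w comb_chain H)
      then obtain h c where hc: "comb a (insert u H) j - bdry n w = h + scal (xmon u) c"
          "coeffs_in (up H) h" "c \<in> poly_chains n (Suc j)"
        using coeffs_in_up_insert_split[OF w(2)] by blast
      have combH: "coeffs_in (up H) (bdry n (comb a H j))"
        unfolding comb_def bdry_sum bdry_scal
      proof (intro coeffs_in_sum coeffs_in_scal upward_up)
        fix q assume "q \<in> idx H j"
        then have q: "fst q \<in> G" "rank (fst q) < rank u" "snd q \<subseteq> A (fst q)"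
          by (auto simp: idx_def H_def)
        show "coeffs_in (up H) (bdry n (e (fst q) (snd q)))"
          using bdry_e_in_up[OF q(1,3)] q by (auto simp: H_def elim!: coeffs_in_mono intro!: up_mono)
      qed
      \<comment> \<open>The sign that \<open>ecomb_bdry\<close> inserts is put in beforehand, so
        that it cancels.\<close>
      define b where "b = (\<lambda>\<sigma>. (- 1) ^ j * a (u, \<sigma>))"
      have ab: "(\<lambda>\<sigma>. (- 1) ^ j * b \<sigma>) = (\<lambda>\<sigma>. a (u, \<sigma>))"
        by (auto simp: b_def simp flip: mult.assoc power_add)
      have U: "coeffs_in (up H) (scal (xmon u) (ucomb u j b) - bdry n ?E)"
        using ecomb_bdry[OF u, of j b] unfolding ab H_def .
      have "bdry n (comb a H j) + bdry n ?E = bdry n h + scal (xmon u) (bdry n c)"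
      proof -
        have "bdry n (comb a (insert u H) j - bdry n w) = bdry n (h + scal (xmon u) c)"
          by (simp only: hc(1))
        then show ?thesis by (simp add: comb_insert[OF H] bdry_add bdry_diff bdry_bdry bdry_scal)
      qed
      then have "scal (xmon u) (ucomb u j b - bdry n c) =
          (scal (xmon u) (ucomb u j b) - bdry n ?E) + (bdry n h - bdry n (comb a H j))"
        by (simp add: scal_diff algebra_simps)
      moreover have "coeffs_in (up H) (bdry n h)" using hc(2) by (intro coeffs_in_bdry upward_up)
      ultimately have "coeffs_in (up H) (scal (xmon u) (ucomb u j b - bdry n c))"
        using U combH by (simp only: coeffs_in_add coeffs_in_diff)
      then have Uc: "coeffs_in (vars (A u)) (ucomb u j b - bdry n c)"
        using coeffs_in_colon[OF u, of "ucomb u j b - bdry n c"] by (simp add: H_def)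
      have au: "a (u, \<sigma>) = 0" if "\<sigma> \<in> subs u j" for \<sigma>
      proof -
        have "{#} \<notin> keys ((ucomb u j b - bdry n c) \<sigma>)"
        proof -
          have "keys ((ucomb u j b - bdry n c) \<sigma>) \<subseteq> vars (A u)"
            using Uc by (simp only: coeffs_in_def)
          then show ?thesis by (auto simp: vars_def)
        qed
        then have "b \<sigma> = 0"
          by (simp add: in_keys_iff lookup_minus lookup_ucomb_empty[OF u that] lookup_bdry_empty)
        then show ?thesis by (simp add: b_def)
      qed
      then have E0: "?E = 0" and U0: "ucomb u j b = 0"
        by (simp_all add: ecomb_def ucomb_def b_def)
      have "coeffs_in (vars (A u)) (bdry n c)" using Uc by (simp add: U0)
      \<comment> \<open>Now \<open>c\<close> is itself a cycle modulo \<open>J : u\<close>, one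
        degree above the \<open>e_\<sigma>\<close> of the relation. Since the classes of that degree
        lift too, \<open>u c\<close> is a boundary modulo \<open>J\<close> and is absorbed into
        \<open>w\<close>. In terms of exact sequences, the homology modulo \<open>J\<close> injects
        into that modulo \<open>J + (u)\<close>.\<close>
      then obtain d w' where w': "w' \<in> poly_chains n (Suc (Suc j))"
          "coeffs_in (vars (A u)) (c - bdry n w' - ucomb u (Suc j) d)"
        using koszul_mod_vars[OF hc(3) _ A_subset[OF u]] unfolding ucomb_def subs_def by blast
      define d' where "d' = (\<lambda>\<sigma>. (- 1) ^ Suc j * d \<sigma>)"
      let ?w = "w + scal (xmon u) w' + ecomb u (Suc j) d'"
      have "comb a H j - bdry n ?w = h + scal (xmon u) (c - bdry n w' - ucomb u (Suc j) d) +
          (scal (xmon u) (ucomb u (Suc j) d) - bdry n (ecomb u (Suc j) d'))"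
        using hc(1) by (simp add: comb_insert[OF H] E0 bdry_add bdry_scal scal_diff scal_add algebra_simps)
      moreover have "coeffs_in (up H) (scal (xmon u) (c - bdry n w' - ucomb u (Suc j) d))"
        using w'(2) coeffs_in_colon[OF u, of "c - bdry n w' - ucomb u (Suc j) d"] by (simp add: H_def)
      moreover have "coeffs_in (up H) (scal (xmon u) (ucomb u (Suc j) d) - bdry n (ecomb u (Suc j) d'))"
        using ecomb_bdry[OF u, of "Suc j" d] by (simp only: H_def d'_def)
      ultimately have "coeffs_in (up H) (comb a H j - bdry n ?w)"
        using hc(2) by (simp only: coeffs_in_add)
      moreover have "?w \<in> poly_chains n (Suc (Suc j))"
        by (intro chains_add chains_scal w w' ecomb_chain u) (simp add: um)
      ultimately have "\<forall>p \<in> idx H j. a p = 0" using IH by blast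
      then show "a p = 0" using p au by (auto simp: idx_def subs_def)
    qed
  qed (simp add: idx_def)
  with assms show ?thesis by blast
qed

end

section \<open>Linear quotients of spread strongly stable ideals\<close>

abbreviation sl :: "nat multiset \<Rightarrow> nat list" where
  "sl \<equiv> sorted_list_of_multiset"

lemma length_sl [simp]: "length (sl u) = size u"
  by (metis mset_sorted_list_of_multiset size_mset)

lemma sl_mset: "sorted xs \<Longrightarrow> sl (mset xs) = xs"
  by (simp add: sorted_sort_id)

lemma inj_sl: "inj_on sl A"
  by (metis inj_onI mset_sorted_list_of_multiset)

lemma sorted_nth_le_iff:
  fixes xs :: "nat list"
  assumes "sorted xs" "r < length xs"
  shows "xs ! r \<le> x \<longleftrightarrow> r < length (filter (\<lambda>y. y \<le> x) xs)"
  using assms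
proof (induction xs arbitrary: r)
  case (Cons y ys)
  show ?case
  proof (cases "y \<le> x")
    case True
    then show ?thesis using Cons by (cases r) auto
  next
    case False
    then have "\<forall>z\<in>set (y # ys). \<not> z \<le> x" using Cons.prems by auto
    moreover have "(y # ys) ! r \<in> set (y # ys)" using Cons.prems(2) by (rule nth_mem)
    ultimately show ?thesis by (metis filter_False less_nat_zero_code list.size(3))
  qed
qed simp

text \<open>Dropping entries from a sorted list can only raise the entry at a given position. In
  terms of counts: a divisor has at most as many indices below a given bound as its
  multiple.\<close>

lemma sl_submset_nth:
  assumes "g \<subseteq># mset w" "sorted w" "r < size g"
  shows "w ! r \<le> sl g ! r"
proof -
  let ?x = "sl g ! r"
  have rw: "r < length w" using assms size_mset_mono[OF assms(1)] by simp
  have "r < length (filter (\<lambda>y. y \<le> ?x) (sl g))"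
    using sorted_nth_le_iff[of "sl g" r ?x] assms(3) by simp
  also have "\<dots> = size (filter_mset (\<lambda>y. y \<le> ?x) g)"
    by (metis mset_filter mset_sorted_list_of_multiset size_mset)
  also have "\<dots> \<le> size (filter_mset (\<lambda>y. y \<le> ?x) (mset w))"
    by (intro size_mset_mono multiset_filter_mono assms)
  also have "\<dots> = length (filter (\<lambda>y. y \<le> ?x) w)"
    by (metis mset_filter size_mset)
  finally show ?thesis using sorted_nth_le_iff[OF assms(2) rw] by simp
qed

text \<open>List positions start at 0, so the gap after position \<open>r\<close> is
  \<open>t (Suc r)\<close>. Gaps are natural numbers, hence such a list is automatically
  sorted.\<close>

definition spread_list :: "nat \<Rightarrow> (nat \<Rightarrow> nat) \<Rightarrow> nat list \<Rightarrow> bool" where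
  "spread_list d t xs \<longleftrightarrow> length xs \<le> d \<and> (\<forall>r. Suc r < length xs \<longrightarrow> xs ! r + t (Suc r) \<le> xs ! Suc r)"

lemma spread_list_sorted: "spread_list d t xs \<Longrightarrow> sorted xs"
  unfolding spread_list_def sorted_iff_nth_Suc using add_leD1 by blast

lemma t_spread_iff: "t_spread d t u \<longleftrightarrow> spread_list d t (sl u)"
proof -
  have "(\<forall>r \<in> {1..<size u}. spread_idx u r + t r \<le> spread_idx u (r + 1)) \<longleftrightarrow>
     (\<forall>r. Suc r < size u \<longrightarrow> sl u ! r + t (Suc r) \<le> sl u ! Suc r)" (is "?l \<longleftrightarrow> ?r")
  proof
    assume l: ?l
    show ?r
    proof (intro allI impI)
      fix r assume "Suc r < size u"
      then show "sl u ! r + t (Suc r) \<le> sl u ! Suc r" using l by (force simp: spread_idx_def)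
    qed
  next
    assume r: ?r
    show ?l
    proof
      fix r assume "r \<in> {1..<size u}"
      then show "spread_idx u r + t r \<le> spread_idx u (r + 1)"
        using r[rule_format, of "r - 1"] by (simp add: spread_idx_def)
    qed
  qed
  then show ?thesis by (simp add: t_spread_def spread_list_def)
qed

lemma t_spread_mset: "spread_list d t xs \<Longrightarrow> t_spread d t (mset xs)"
  using spread_list_sorted[of d t xs] by (simp add: t_spread_iff sorted_sort_id)

lemma spread_list_take: "spread_list d t xs \<Longrightarrow> spread_list d t (take s xs)"
  by (auto simp: spread_list_def)

lemma list_less_nthI:
  fixes xs ys :: "nat list"
  assumes "take r xs = take r ys" "r < length xs" "r < length ys" "xs ! r < ys ! r"
  shows "xs < ys"
  using assms unfolding list_less_def lexord_take_index_conv by auto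

definition linear_vars :: "(nat \<Rightarrow> nat) \<Rightarrow> nat multiset \<Rightarrow> nat set" where
  "linear_vars t u = {1..mon_max u - 1} - t_supp t u"

text \<open>The ideal enters only through the set \<open>M\<close> of its monomials and the minimal
  elements \<open>G\<close> of that set, so this part is combinatorial and independent of the
  field.\<close>

locale spread_stable =
  fixes n d :: nat and t :: "nat \<Rightarrow> nat" and M G :: "nat multiset set"
  assumes M_monomials: "M \<subseteq> monomials n"
    and empty_notin_M: "{#} \<notin> M"
    and G_eq: "G = {u \<in> M. \<forall>v. v \<subset># u \<longrightarrow> v \<notin> M}"
    and G_spread: "u \<in> G \<Longrightarrow> t_spread d t u"
    and stable: "u \<in> M \<Longrightarrow> t_spread d t u \<Longrightarrow> i \<in># u \<Longrightarrow> 1 \<le> j \<Longrightarrow> j < i \<Longrightarrow>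
      t_spread d t (add_mset j (u - {#i#})) \<Longrightarrow> add_mset j (u - {#i#}) \<in> M"
begin

lemma G_sub_M: "u \<in> G \<Longrightarrow> u \<in> M"
  and G_minimal: "u \<in> G \<Longrightarrow> v \<in> M \<Longrightarrow> v \<subseteq># u \<Longrightarrow> v = u"
  by (auto simp: G_eq subset_mset.le_less)

lemma M_range: "v \<in> M \<Longrightarrow> k \<in># v \<Longrightarrow> k \<in> {1..n}"
  using M_monomials unfolding monomials_def by blast

lemma gen_below: "v \<in> M \<Longrightarrow> \<exists>g\<in>G. g \<subseteq># v"
proof (induction "size v" arbitrary: v rule: less_induct)
  case less
  show ?case
  proof (cases "v \<in> G")
    case False
    then obtain w where w: "w \<subset># v" "w \<in> M" using less.prems by (auto simp: G_eq)
    then obtain g where "g \<in> G" "g \<subseteq># w" using less.hyps[of w] mset_subset_size by blast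
    then show ?thesis using w(1) by (meson subset_mset.order_trans subset_mset.less_imp_le)
  qed auto
qed

lemma finite_G: "finite G"
proof -
  have "G \<subseteq> mset ` {xs. set xs \<subseteq> {1..n} \<and> length xs \<le> d}"
  proof
    fix u assume u: "u \<in> G"
    then have "set (sl u) \<subseteq> {1..n}" "length (sl u) \<le> d"
      using G_spread[OF u] G_sub_M[OF u] M_monomials by (auto simp: t_spread_def monomials_def)
    then show "u \<in> mset ` {xs. set xs \<subseteq> {1..n} \<and> length xs \<le> d}"
      by (metis (mono_tags, lifting) image_eqI mem_Collect_eq mset_sorted_list_of_multiset)
  qed
  then show ?thesis by (rule finite_subset) (simp add: finite_lists_length_le)
qed

text \<open>The entries are lowered one at a time from the left. The intermediate list is spread
  also at the seam, because there
  \<open>ys ! r + t (Suc r) \<le> xs ! r + t (Suc r) \<le> xs ! Suc r\<close>; lowering from the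
  right could violate a gap.\<close>

lemma borel_moves:
  assumes xs: "spread_list d t xs" "mset xs \<in> M" and ys: "spread_list d t ys"
    and le: "length ys = length xs" "\<And>r. r < length xs \<Longrightarrow> ys ! r \<le> xs ! r"
    and pos: "\<And>r. r < length xs \<Longrightarrow> 1 \<le> ys ! r"
  shows "mset ys \<in> M"
proof -
  define zs where "zs m = take m ys @ drop m xs" for m
  have nth: "zs m ! r = (if r < m then ys ! r else xs ! r)" if "r < length xs" "m \<le> length xs" for m r
    using that le(1) by (simp add: zs_def nth_append)
  have len: "length (zs m) = length xs" if "m \<le> length xs" for m
    using that le(1) by (simp add: zs_def)
  have spread: "spread_list d t (zs m)" if m: "m \<le> length xs" for m
    unfolding spread_list_def len[OF m]
  proof (intro conjI allI impI)
    show "length xs \<le> d" using xs by (simp add: spread_list_def)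
    fix r assume r: "Suc r < length xs"
    have x: "xs ! r + t (Suc r) \<le> xs ! Suc r" and y: "ys ! r + t (Suc r) \<le> ys ! Suc r"
      using r xs(1) ys le(1) by (auto simp: spread_list_def)
    have "ys ! r \<le> xs ! r" using le(2) r by simp
    then show "zs m ! r + t (Suc r) \<le> zs m ! Suc r"
      using x y r m by (auto simp: nth)
  qed
  have "m \<le> length xs \<Longrightarrow> mset (zs m) \<in> M" for m
  proof (induction m)
    case 0 then show ?case using xs by (simp add: zs_def)
  next
    case (Suc m)
    then have m: "m < length xs" and IH: "mset (zs m) \<in> M" by auto
    have eq: "zs (Suc m) = (zs m)[m := ys ! m]"
      by (rule nth_equalityI) (use Suc.prems in \<open>auto simp: len nth nth_list_update\<close>)
    show ?case
    proof (cases "ys ! m = xs ! m")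
      case True
      then have "zs (Suc m) = zs m"
        unfolding eq by (metis list_update_id m nat_less_le nth order_less_irrefl)
      then show ?thesis using IH by simp
    next
      case False
      have new: "mset (zs (Suc m)) = add_mset (ys ! m) (mset (zs m) - {#xs ! m#})"
        unfolding eq using m by (simp add: mset_update len nth)
      show ?thesis
        unfolding new
      proof (rule stable)
        show "t_spread d t (mset (zs m))" using m by (intro t_spread_mset spread) simp
        show "xs ! m \<in># mset (zs m)" using m nth[of m m] len[of m] by (metis less_imp_le_nat nth_mem order_less_irrefl set_mset_mset)
        show "1 \<le> ys ! m" "ys ! m < xs ! m" using pos[OF m] le(2)[OF m] False by auto
        show "t_spread d t (add_mset (ys ! m) (mset (zs m) - {#xs ! m#}))"
          unfolding new[symmetric] using m by (intro t_spread_mset spread) simp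
      qed (rule IH)
    qed
  qed
  from this[of "length xs"] show ?thesis using le(1) by (simp add: zs_def)
qed

text \<open>Take the shortest prefix in \<open>M\<close>. A proper divisor in \<open>M\<close> would
  give a generator \<open>g\<close> of smaller degree. The prefix of \<open>w\<close> of length
  \<open>size g\<close> lies entrywise below \<open>g\<close>, so stability would put this shorter
  prefix into \<open>M\<close>.\<close>

lemma prefix_in_G:
  assumes w: "spread_list d t w" "mset w \<in> M"
  shows "\<exists>s \<le> length w. mset (take s w) \<in> G"
proof -
  define s where "s = (LEAST s. mset (take s w) \<in> M)"
  have ex: "mset (take (length w) w) \<in> M" using w(2) by simp
  have s: "mset (take s w) \<in> M" unfolding s_def by (rule LeastI) (rule ex)
  have least: "s \<le> s'" if "mset (take s' w) \<in> M" for s'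
    unfolding s_def by (rule Least_le) (rule that)
  have "v \<notin> M" if v: "v \<subset># mset (take s w)" for v
  proof
    assume "v \<in> M"
    then obtain g where g: "g \<in> G" "g \<subseteq># v" using gen_below by blast
    have gs: "size g < s"
      using size_mset_mono[OF g(2)] mset_subset_size[OF v] by simp
    then have sw: "size g < length w" using least[OF ex] by simp
    have gw: "g \<subseteq># mset w"
      by (metis append_take_drop_id g(2) mset_append mset_subset_eq_add_left subset_mset.less_imp_le
          subset_mset.order_trans v)
    have "mset (take (size g) w) \<in> M"
    proof (rule borel_moves)
      show "spread_list d t (sl g)" using G_spread[OF g(1)] by (simp add: t_spread_iff)
      show "mset (sl g) \<in> M" using G_sub_M[OF g(1)] by simp
      show "spread_list d t (take (size g) w)" using w(1) by (rule spread_list_take)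
      show "length (take (size g) w) = length (sl g)" using sw by simp
      fix r assume r: "r < length (sl g)"
      then show "take (size g) w ! r \<le> sl g ! r"
        using sl_submset_nth[OF gw spread_list_sorted[OF w(1)]] by simp
      have "w ! r \<in># mset w" using r sw by simp
      then have "w ! r \<in> {1..n}" by (rule M_range[OF w(2)])
      then show "1 \<le> take (size g) w ! r" using r by simp
    qed
    with least gs show False by fastforce
  qed
  then have "mset (take s w) \<in> G" using s by (simp add: G_eq)
  then show ?thesis using least[OF ex] by blast
qed

text \<open>The position is that of the first index above \<open>k\<close>. Since \<open>k\<close>
  avoids the interval of the \<open>t\<close>-spread support that starts at the preceding index, it
  keeps the required distance from that index and can take the place at \<open>r\<close>.\<close>

lemma swap_position:
  assumes u: "u \<in> G" and k: "k \<in> linear_vars t u"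
  obtains r where "r < size u" "sl u ! r = next_supp u k" "k < sl u ! r"
    "\<And>r'. r = Suc r' \<Longrightarrow> sl u ! r' + t r \<le> k"
proof -
  let ?xs = "sl u"
  have k1: "1 \<le> k" "k < mon_max u" "k \<notin> t_supp t u" using k by (auto simp: linear_vars_def)
  have "u \<noteq> {#}" using G_sub_M[OF u] empty_notin_M by blast
  then have "mon_max u \<in># u" by (simp add: mon_max_def)
  then obtain r0 where r0: "r0 < size u" "?xs ! r0 = mon_max u"
    by (metis in_set_conv_nth length_sl set_sorted_list_of_multiset)
  define r where "r = (LEAST r. r < size u \<and> k < ?xs ! r)"
  have r: "r < size u \<and> k < ?xs ! r" unfolding r_def by (rule LeastI[of _ r0]) (use r0 k1 in auto)
  have least: "r \<le> r'" if "r' < size u" "k < ?xs ! r'" for r'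
    unfolding r_def by (rule Least_le) (use that in auto)
  have "next_supp u k = ?xs ! r"
    unfolding next_supp_def
  proof (rule Min_eqI)
    fix y assume "y \<in> {j \<in> set_mset u. k < j}"
    then have "y \<in> set ?xs" "k < y" by auto
    then obtain r' where r': "r' < size u" "y = ?xs ! r'" by (metis in_set_conv_nth length_sl)
    then show "?xs ! r \<le> y" using least[of r'] \<open>k < y\<close> by (auto intro!: sorted_nth_mono)
  next
    have "?xs ! r \<in> set ?xs" by (rule nth_mem) (use r in simp)
    then show "?xs ! r \<in> {j \<in> set_mset u. k < j}" using r by simp
  qed simp
  moreover have "?xs ! r' + t r \<le> k" if "r = Suc r'" for r'
  proof -
    have "\<not> k < ?xs ! r'" using least[of r'] r that by auto
    moreover have "k \<notin> {spread_idx u r..<spread_idx u r + t r}"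
      using k1(3) r that by (auto simp: t_supp_def)
    ultimately show ?thesis using that by (auto simp: spread_idx_def)
  qed
  ultimately show ?thesis using r that by metis
qed

text \<open>The place of \<open>k^(u)\<close> receives \<open>k\<close>, for all
  \<open>k \<in> F\<close>. Distances are recorded against the original preceding index, since this
  bound survives when the preceding entry is lowered later. The multiset equation is written with
  \<open>+\<close> to avoid truncated subtraction.\<close>

lemma swaps:
  assumes u: "u \<in> G" and F: "F \<subseteq> linear_vars t u" "inj_on (next_supp u) F"
  shows "\<exists>w. length w = size u \<and> mset w + next_mset u F = mset_set F + u \<and>
    (\<forall>r < size u. 1 \<le> w ! r \<and> w ! r \<le> sl u ! r \<and>
       (w ! r \<noteq> sl u ! r \<longrightarrow> w ! r \<in> F \<and> next_supp u (w ! r) = sl u ! r) \<and>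
       (\<forall>r'. r = Suc r' \<longrightarrow> sl u ! r' + t r \<le> w ! r)) \<and>
    (F \<noteq> {} \<longrightarrow> (\<exists>r < size u. w ! r < sl u ! r))"
proof -
  have "finite F" using F(1) by (rule finite_subset) (simp add: linear_vars_def)
  then show ?thesis using F
  proof (induction F rule: finite_induct)
    case empty
    have "\<forall>r < size u. 1 \<le> sl u ! r"
    proof (intro allI impI)
      fix r assume "r < size u"
      then have "sl u ! r \<in> set (sl u)" by (metis length_sl nth_mem)
      then have "sl u ! r \<in># u" by simp
      then show "1 \<le> sl u ! r" using M_range[OF G_sub_M[OF u]] by fastforce
    qed
    moreover have "sl u ! r' + t (Suc r') \<le> sl u ! Suc r'" if "Suc r' < size u" for r'
      using G_spread[OF u] that by (simp add: t_spread_iff spread_list_def)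
    ultimately show ?case by (intro exI[of _ "sl u"]) (auto simp: next_mset_def)
  next
    case (insert k F)
    have "F \<subseteq> linear_vars t u" "inj_on (next_supp u) F"
      using insert.prems by (auto simp: inj_on_insert)
    from insert.IH[OF this] obtain w where w0: "length w = size u \<and>
        mset w + next_mset u F = mset_set F + u \<and>
        (\<forall>r < size u. 1 \<le> w ! r \<and> w ! r \<le> sl u ! r \<and>
          (w ! r \<noteq> sl u ! r \<longrightarrow> w ! r \<in> F \<and> next_supp u (w ! r) = sl u ! r) \<and>
          (\<forall>r'. r = Suc r' \<longrightarrow> sl u ! r' + t r \<le> w ! r))"
      by (elim exE conjE) (rule that, intro conjI, assumption+)
    then have w: "length w = size u" "mset w + next_mset u F = mset_set F + u"
      "\<And>r. r < size u \<Longrightarrow> 1 \<le> w ! r" "\<And>r. r < size u \<Longrightarrow> w ! r \<le> sl u ! r"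
      "\<And>r. r < size u \<Longrightarrow> w ! r \<noteq> sl u ! r \<Longrightarrow> w ! r \<in> F \<and> next_supp u (w ! r) = sl u ! r"
      "\<And>r'. Suc r' < size u \<Longrightarrow> sl u ! r' + t (Suc r') \<le> w ! Suc r'"
      by auto
    obtain r where r: "r < size u" "sl u ! r = next_supp u k" "k < sl u ! r"
      "\<And>r'. r = Suc r' \<Longrightarrow> sl u ! r' + t r \<le> k"
      using swap_position[OF u, of k] insert.prems by auto
    \<comment> \<open>Position \<open>r\<close> is still untouched: otherwise it would hold an
      element of \<open>F\<close> with the same successor as \<open>k\<close>, against
      injectivity.\<close>
    have wr: "w ! r = next_supp u k"
    proof (rule ccontr)
      assume "\<not> ?thesis"
      then have "w ! r \<in> F" "next_supp u (w ! r) = next_supp u k" using w(5)[OF r(1)] r(2) by auto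
      then show False using insert.prems(2) insert.hyps(2) by (metis inj_on_def insertCI)
    qed
    have k1: "1 \<le> k" using insert.prems by (auto simp: linear_vars_def)
    have "next_supp u k \<in># mset w" using r(1) w(1) wr by (metis nth_mem set_mset_mset)
    then have swap: "mset (w[r := k]) + {#next_supp u k#} = add_mset k (mset w)"
      using r(1) w(1) wr by (simp add: mset_update)
    have "mset (w[r := k]) + next_mset u (insert k F) =
        (mset (w[r := k]) + {#next_supp u k#}) + next_mset u F"
      using insert.hyps by (simp add: next_mset_def)
    also have "\<dots> = add_mset k (mset w + next_mset u F)" unfolding swap by simp
    also have "\<dots> = mset_set (insert k F) + u" unfolding w(2) using insert.hyps by simp
    finally have "mset (w[r := k]) + next_mset u (insert k F) = mset_set (insert k F) + u" .
    moreover have "w[r := k] ! r < sl u ! r" using r w(1) by simp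
    then have "\<exists>r' < size u. w[r := k] ! r' < sl u ! r'" using r(1) by blast
    moreover have "\<forall>r' < size u. 1 \<le> w[r := k] ! r' \<and> w[r := k] ! r' \<le> sl u ! r' \<and>
       (w[r := k] ! r' \<noteq> sl u ! r' \<longrightarrow>
         w[r := k] ! r' \<in> insert k F \<and> next_supp u (w[r := k] ! r') = sl u ! r') \<and>
       (\<forall>q. r' = Suc q \<longrightarrow> sl u ! q + t r' \<le> w[r := k] ! r')"
      using w r k1 by (auto simp: nth_list_update)
    moreover have "length (w[r := k]) = size u" using w(1) by simp
    ultimately show ?case by (intro exI[of _ "w[r := k]"] conjI impI)
  qed
qed

text \<open>The swapped monomial is spread and lies entrywise below \<open>u\<close>, so it is in
  \<open>M\<close> and has a prefix in \<open>G\<close>. This prefix contains the first changed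
  position, since a shorter one would divide \<open>u\<close> and hence equal \<open>u\<close> by
  minimality. So it precedes \<open>u\<close> lexicographically.\<close>

lemma swapped_in_M:
  assumes u: "u \<in> G" and F: "F \<subseteq> linear_vars t u" "inj_on (next_supp u) F" "F \<noteq> {}"
  shows "\<exists>g\<in>G. sl g < sl u \<and> g \<subseteq># mset_set F + u - next_mset u F"
proof -
  let ?xs = "sl u"
  obtain w where w: "length w = size u" "mset w + next_mset u F = mset_set F + u"
      "\<And>r. r < size u \<Longrightarrow> 1 \<le> w ! r" "\<And>r. r < size u \<Longrightarrow> w ! r \<le> ?xs ! r"
      "\<And>r'. Suc r' < size u \<Longrightarrow> ?xs ! r' + t (Suc r') \<le> w ! Suc r'"
      "\<exists>r < size u. w ! r < ?xs ! r"
    using swaps[OF u F(1,2)] F(3) by auto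
  have xs: "spread_list d t ?xs" using G_spread[OF u] by (simp add: t_spread_iff)
  have ws: "spread_list d t w"
    unfolding spread_list_def
  proof (intro conjI allI impI)
    show "length w \<le> d" using xs w(1) by (simp add: spread_list_def)
    fix r assume "Suc r < length w"
    then show "w ! r + t (Suc r) \<le> w ! Suc r"
      using w(4)[of r] w(5)[of r] w(1) by simp
  qed
  have "mset w \<in> M"
    by (rule borel_moves[OF xs]) (use G_sub_M[OF u] ws w in auto)
  from prefix_in_G[OF ws this] obtain s where s: "s \<le> length w" "mset (take s w) \<in> G" by blast
  define r where "r = (LEAST r. r < size u \<and> w ! r < ?xs ! r)"
  have r: "r < size u \<and> w ! r < ?xs ! r" unfolding r_def by (rule LeastI_ex) (rule w(6))
  have "w ! r' = ?xs ! r'" if "r' < r" for r'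
    using not_less_Least[of r' "\<lambda>r. r < size u \<and> w ! r < ?xs ! r"] that r w(4)[of r']
    unfolding r_def[symmetric] by force
  then have tr: "take r w = take r ?xs"
    using r w(1) by (intro nth_equalityI) auto
  have rs: "r < s"
  proof (rule ccontr)
    assume "\<not> r < s"
    then have "take s w = take s ?xs" using tr by (metis min.absorb1 not_less take_take)
    then have "mset (take s w) \<subseteq># u"
      by (metis append_take_drop_id mset_append mset_sorted_list_of_multiset mset_subset_eq_add_left)
    then have "mset (take s w) = u" using G_minimal[OF u G_sub_M[OF s(2)]] by blast
    then have "s = size u" using s(1) by (metis length_take min.absorb2 size_mset)
    then show False using \<open>\<not> r < s\<close> r by simp
  qed
  have "sl (mset (take s w)) = take s w"
    by (rule sl_mset) (rule spread_list_sorted[OF spread_list_take[OF ws]])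
  also have "take s w < ?xs"
    by (rule list_less_nthI[of r]) (use tr rs r s in auto)
  finally have "sl (mset (take s w)) < sl u" .
  moreover have "mset (take s w) \<subseteq># mset w"
    by (metis append_take_drop_id mset_append mset_subset_eq_add_left)
  moreover have "mset w = mset_set F + u - next_mset u F"
    using w(2) by (metis add_diff_cancel_right')
  ultimately show ?thesis using s(2) by metis
qed

text \<open>One direction is the swap of a single \<open>k\<close>. For the other, compare
  \<open>g\<close> and \<open>u\<close> at the first position where they differ. The entry
  \<open>k\<close> of \<open>g\<close> is smaller; it avoids the \<open>t\<close>-spread support of
  \<open>u\<close>, because the earlier entries agree and \<open>g\<close> is spread; and it occurs
  in \<open>g\<close> more often than in \<open>u\<close>, so it divides \<open>v\<close>.\<close>

lemma colon_linear_vars: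
  assumes u: "u \<in> G"
  shows "u + v \<in> up {g \<in> G. sl g < sl u} \<longleftrightarrow> v \<in> vars (linear_vars t u)"
proof
  assume "v \<in> vars (linear_vars t u)"
  then obtain k where k: "k \<in># v" "k \<in> linear_vars t u" by (auto simp: vars_def)
  then obtain g where g: "g \<in> G" "sl g < sl u" "g \<subseteq># mset_set {k} + u - next_mset u {k}"
    using swapped_in_M[OF u, of "{k}"] by auto
  have "g \<subseteq># mset_set {k} + u" using g(3) by (meson diff_subset_eq_self subset_mset.order_trans)
  also have "\<dots> \<subseteq># u + v" using k(1) by simp
  finally show "u + v \<in> up {g \<in> G. sl g < sl u}" using g by (auto simp: up_def)
next
  assume "u + v \<in> up {g \<in> G. sl g < sl u}"
  then obtain g where g: "g \<in> G" "sl g < sl u" "g \<subseteq># u + v" by (auto simp: up_def)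
  let ?xs = "sl u" and ?ys = "sl g"
  \<comment> \<open>A proper prefix is lexicographically smaller as well; this case is excluded
    because minimal generators do not divide each other.\<close>
  have "\<not> (size g < size u \<and> take (size g) ?xs = ?ys)"
  proof
    assume a: "size g < size u \<and> take (size g) ?xs = ?ys"
    then have "g \<subseteq># u"
      by (metis append_take_drop_id mset_append mset_sorted_list_of_multiset mset_subset_eq_add_left)
    with G_minimal[OF u G_sub_M[OF g(1)]] a show False by auto
  qed
  then obtain i where i: "i < size g" "i < size u" "take i ?ys = take i ?xs" "?ys ! i < ?xs ! i"
    using g(2) unfolding list_less_def lexord_take_index_conv by auto
  define k where "k = ?ys ! i"
  have kg: "k \<in> set ?ys" unfolding k_def by (rule nth_mem) (use i in simp)
  then have k1: "1 \<le> k" using M_range[OF G_sub_M[OF g(1)], of k] by simp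
  have "?xs ! i \<in> set ?xs" by (rule nth_mem) (use i in simp)
  then have "?xs ! i \<le> mon_max u" by (simp add: mon_max_def)
  then have kmax: "k < mon_max u" using i(4) by (simp add: k_def)
  have "k \<notin> {spread_idx u r..<spread_idx u r + t r}" if r: "r \<in> {1..<size u}" for r
  proof (cases "r \<le> i")
    case True
    then obtain r' where r': "r = Suc r'" "r' < i" using r by (cases r) auto
    have "?xs ! r' = ?ys ! r'" using i(3) r'(2) by (metis nth_take)
    moreover have "?ys ! r' + t r \<le> ?ys ! r"
      using G_spread[OF g(1)] r' i(1) by (auto simp: t_spread_iff spread_list_def)
    moreover have "?ys ! r \<le> ?ys ! i" by (rule sorted_nth_mono) (use True i in auto)
    ultimately show ?thesis using r' by (simp add: spread_idx_def k_def)
  next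
    case False
    have "?xs ! i \<le> ?xs ! (r - 1)" by (rule sorted_nth_mono) (use False r in auto)
    then show ?thesis using i(4) by (simp add: spread_idx_def k_def)
  qed
  then have kA: "k \<in> linear_vars t u" using k1 kmax by (auto simp: linear_vars_def t_supp_def)
  \<comment> \<open>All copies of \<open>k\<close> in \<open>u\<close> are among the first
    \<open>i\<close> entries, which are shared with \<open>g\<close>; position \<open>i\<close>
    gives \<open>g\<close> one more.\<close>
  have "count u k = count (mset (take i ?xs @ drop i ?xs)) k" by simp
  also have "\<dots> = count (mset (take i ?ys)) k + count (mset (drop i ?xs)) k"
    using i(3) by (simp only: mset_append count_union)
  also have "count (mset (drop i ?xs)) k = 0"
  proof -
    have "k < y" if y: "y \<in> set (drop i ?xs)" for y
    proof -
      obtain r where r: "r < length (drop i ?xs)" "drop i ?xs ! r = y"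
        using y unfolding in_set_conv_nth by blast
      have "y = ?xs ! (i + r)"
        unfolding r(2)[symmetric] by (rule nth_drop) (use i(2) in simp)
      moreover have "?xs ! i \<le> ?xs ! (i + r)" by (rule sorted_nth_mono) (use r(1) in auto)
      ultimately show ?thesis using i(4) by (simp add: k_def)
    qed
    then have "k \<notin> set (drop i ?xs)" by blast
    then show ?thesis by simp
  qed
  also have "count (mset (take i ?ys)) k + 0 < count (mset (take (Suc i) ?ys)) k"
    using i(1) by (simp add: take_Suc_conv_app_nth k_def)
  also have "\<dots> \<le> count g k"
  proof -
    have "count g k = count (mset (take (Suc i) ?ys @ drop (Suc i) ?ys)) k" by simp
    then show ?thesis by (simp only: mset_append count_union)
  qed
  also have "\<dots> \<le> count u k + count v k" using mset_subset_eq_count[OF g(3), of k] by simp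
  finally have "k \<in># v" by (metis add.right_neutral count_eq_zero_iff less_irrefl)
  then show "v \<in> vars (linear_vars t u)" using kA by (auto simp: vars_def)
qed

end

section \<open>Wedge products of basis elements\<close>

definition wedge_list :: "nat list \<Rightarrow> nat set \<Rightarrow> 'a::field mpoly" where
  "wedge_list js = foldr ext js (unit_chain {})"

text \<open>Pairs starting at the new head count the entries below \<open>k\<close>; the other pairs
  are those of \<open>js\<close>, shifted by one.\<close>

lemma inversions_Cons:
  assumes "distinct (k # js)"
  shows "inversions (k # js) = card {l \<in> set js. l < k} + inversions js"
proof -
  let ?A = "(\<lambda>b. (0 :: nat, Suc b)) ` {b. b < length js \<and> js ! b < k}"
  let ?B = "map_prod Suc Suc ` {(a, b). a < b \<and> b < length js \<and> js ! b < js ! a}"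
  have "{(a, b). a < b \<and> b < length (k # js) \<and> (k # js) ! b < (k # js) ! a} = ?A \<union> ?B"
  proof (intro equalityI subsetI)
    fix p assume "p \<in> {(a, b). a < b \<and> b < length (k # js) \<and> (k # js) ! b < (k # js) ! a}"
    then obtain a b where p: "p = (a, b)" "a < b" "b < length (k # js)"
        "(k # js) ! b < (k # js) ! a" by auto
    then obtain b' where b': "b = Suc b'" by (cases b) auto
    show "p \<in> ?A \<union> ?B"
    proof (cases a)
      case 0
      then show ?thesis using p b' by (intro UnI1) auto
    next
      case (Suc a')
      then have "p = map_prod Suc Suc (a', b')" using p b' by simp
      then show ?thesis using p b' Suc by (intro UnI2) (rule image_eqI, auto)
    qed
  qed auto
  moreover have "finite ?A" "?A \<inter> ?B = {}" by auto
  moreover have "finite {(a, b). a < b \<and> b < length js \<and> js ! b < js ! a}"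
    by (rule finite_subset[of _ "{..length js} \<times> {..length js}"]) auto
  ultimately have "inversions (k # js) = card ?A + card ?B"
    unfolding inversions_def by (simp only: card_Un_disjoint finite_imageI)
  also have "card ?B = inversions js"
    unfolding inversions_def by (rule card_image) (auto simp: inj_on_def)
  also have "card ?A = card {b. b < length js \<and> js ! b < k}"
    by (rule card_image) (auto simp: inj_on_def)
  also have "\<dots> = card ((\<lambda>b. js ! b) ` {b. b < length js \<and> js ! b < k})"
    using assms by (intro card_image[symmetric]) (auto simp: inj_on_def nth_eq_iff_index_eq)
  also have "(\<lambda>b. js ! b) ` {b. b < length js \<and> js ! b < k} = {l \<in> set js. l < k}"
    by (auto simp: in_set_conv_nth)
  finally show ?thesis .
qed

text \<open>The inversions caused by the head are counted by the exponent of
  \<open>below_sign\<close>. Iterated exterior multiplication therefore has the sign of the sorting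
  permutation, as required for the comparison with \<open>e_wedge\<close>.\<close>

lemma wedge_list_apply:
  "(wedge_list js \<tau> :: 'a::field mpoly) = (if distinct js \<and> \<tau> = set js then (- 1) ^ inversions js else 0)"
proof (induction js arbitrary: \<tau>)
  case Nil
  show ?case by (simp add: wedge_list_def unit_chain_def inversions_def cong: if_cong)
next
  case (Cons k js)
  have "(wedge_list (k # js) \<tau> :: 'a mpoly) = ext k (wedge_list js) \<tau>"
    by (simp add: wedge_list_def)
  also have "\<dots> = (if k \<in> \<tau> \<and> distinct js \<and> \<tau> - {k} = set js
      then below_sign k \<tau> * (- 1) ^ inversions js else 0)"
    by (simp add: ext_def Cons.IH)
  also have "k \<in> \<tau> \<and> distinct js \<and> \<tau> - {k} = set js \<longleftrightarrow> distinct (k # js) \<and> \<tau> = set (k # js)"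
    by auto
  also have "(if distinct (k # js) \<and> \<tau> = set (k # js)
      then below_sign k \<tau> * (- 1) ^ inversions js else 0 :: 'a mpoly) =
    (if distinct (k # js) \<and> \<tau> = set (k # js) then (- 1) ^ inversions (k # js) else 0)"
  proof (cases "distinct (k # js) \<and> \<tau> = set (k # js)")
    case True
    then have "{l \<in> \<tau>. l < k} = {l \<in> set js. l < k}" by auto
    then show ?thesis using True inversions_Cons[of k js] by (simp add: below_sign_def power_add)
  next
    case False
    then show ?thesis by (simp only: if_False)
  qed
  finally show ?case .
qed

lemma wedge_list_not_distinct: "\<not> distinct js \<Longrightarrow> wedge_list js = 0"
  by (simp add: fun_eq_iff wedge_list_apply)

lemma inversions_sorted: "sorted js \<Longrightarrow> inversions js = 0"
proof -
  assume "sorted js"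
  then have "{(a, b). a < b \<and> b < length js \<and> js ! b < js ! a} = {}"
    by (auto simp: not_less intro!: sorted_nth_mono)
  then show ?thesis by (simp only: inversions_def card.empty)
qed

lemma wedge_list_sorted:
  assumes "finite \<sigma>"
  shows "wedge_list (sorted_list_of_set \<sigma>) = unit_chain \<sigma>"
  using assms by (auto simp: fun_eq_iff wedge_list_apply unit_chain_def inversions_sorted)

lemma wedge_list_chain:
  assumes "set js \<subseteq> {1..n}"
  shows "(wedge_list js :: nat set \<Rightarrow> 'a::field mpoly) \<in> poly_chains n (length js)"
  using assms
proof (induction js)
  case Nil
  show ?case
    unfolding wedge_list_def by (simp add: unit_chain_in_chains faces_def)
next
  case (Cons k js)
  have "(wedge_list (k # js) :: nat set \<Rightarrow> 'a mpoly) = ext k (wedge_list js)"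
    by (simp add: wedge_list_def)
  moreover have "ext k (wedge_list js :: nat set \<Rightarrow> 'a mpoly) \<in> poly_chains n (Suc (length js))"
    by (rule chains_ext) (use Cons in auto)
  ultimately show ?case by simp
qed

lemma ext_foldr_ext: "ext j (foldr ext js c) = scal ((- 1) ^ length js) (foldr ext js (ext j c))"
proof (induction js)
  case (Cons k js)
  have "ext j (foldr ext (k # js) c) = - ext k (ext j (foldr ext js c))"
    by (simp add: ext_ext[of j k])
  also have "\<dots> = - ext k (scal ((- 1) ^ length js) (foldr ext js (ext j c)))"
    by (simp only: Cons.IH)
  also have "\<dots> = scal ((- 1) ^ length (k # js)) (foldr ext (k # js) (ext j c))"
    by (simp add: ext_scal flip: scal_left_minus)
  finally show ?case .
qed simp

section \<open>The cycles as products\<close>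

text \<open>Exterior multiplication by the cycle \<open>x_j e_k - x_k e_j\<close> with
  \<open>j = k^(u)\<close>. This is \<open>x_j\<close> times the corresponding factor of the Laurent
  product, which keeps everything polynomial.\<close>

definition swap_factor :: "nat multiset \<Rightarrow> nat \<Rightarrow> (nat set \<Rightarrow> 'a::field mpoly) \<Rightarrow> nat set \<Rightarrow> 'a mpoly" where
  "swap_factor u k c = scal (xmon {#next_supp u k#}) (ext k c) - scal (xmon {#k#}) (ext (next_supp u k) c)"

text \<open>The sign exponent of the summand of \<open>F\<close> in the expanded product: a minus
  sign for every \<open>k \<in> F\<close>, and a transposition for every later
  \<open>l \<in> \<sigma> - F\<close>, since the successor's basis element starts in the place of
  \<open>k\<close> and has to move right past \<open>e_l\<close>.\<close>

definition swap_sign :: "nat set \<Rightarrow> nat set \<Rightarrow> nat" where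
  "swap_sign \<sigma> F = card F + card {(k, l). k \<in> F \<and> l \<in> \<sigma> - F \<and> k < l}"

lemma swap_factor_scal: "swap_factor u k (scal p c) = scal p (swap_factor u k c)"
  by (simp add: swap_factor_def ext_scal scal_scal scal_diff mult.commute)

lemma swap_factor_sum:
  fixes f :: "'i \<Rightarrow> nat set \<Rightarrow> 'a::field mpoly"
  shows "swap_factor u k (sum f B) = (\<Sum>b\<in>B. swap_factor u k (f b))"
  by (simp add: swap_factor_def ext_sum scal_sum sum_subtractf)

lemma foldr_swap_factor_scal:
  "foldr (swap_factor u) ks (scal p c) = scal p (foldr (swap_factor u) ks c)"
proof (induction ks)
  case (Cons k ks)
  have "foldr (swap_factor u) (k # ks) (scal p c) =
      swap_factor u k (foldr (swap_factor u) ks (scal p c))" by simp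
  also have "\<dots> = swap_factor u k (scal p (foldr (swap_factor u) ks c))"
    by (simp only: Cons.IH)
  also have "\<dots> = scal p (foldr (swap_factor u) (k # ks) c)" by (simp add: swap_factor_scal)
  finally show ?case .
qed simp

text \<open>The factors anticommute with the differential because each
  \<open>x\<^sub>j e\<^sub>k - x\<^sub>k e\<^sub>j\<close> is a cycle.\<close>

lemma bdry_swap_factor:
  assumes "k \<in> {1..n}" "next_supp u k \<in> {1..n}"
  shows "bdry n (swap_factor u k c) = - swap_factor u k (bdry n c)"
  by (simp add: swap_factor_def bdry_diff bdry_scal bdry_ext[OF assms(1)] bdry_ext[OF assms(2)]
      scal_diff scal_scal mult.commute)

lemma bdry_foldr_swap_factor:
  assumes "\<And>k. k \<in> set ks \<Longrightarrow> k \<in> {1..n} \<and> next_supp u k \<in> {1..n}"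
  shows "bdry n (foldr (swap_factor u) ks c) =
    scal ((- 1) ^ length ks) (foldr (swap_factor u) ks (bdry n c))"
  using assms
proof (induction ks)
  case (Cons k ks)
  have k: "k \<in> {1..n}" "next_supp u k \<in> {1..n}" using Cons.prems[of k] by auto
  have IH: "bdry n (foldr (swap_factor u) ks c) =
      scal ((- 1) ^ length ks) (foldr (swap_factor u) ks (bdry n c))"
    by (rule Cons.IH) (use Cons.prems in auto)
  have "bdry n (foldr (swap_factor u) (k # ks) c) =
      - swap_factor u k (scal ((- 1) ^ length ks) (foldr (swap_factor u) ks (bdry n c)))"
    by (simp add: bdry_swap_factor[OF k] IH)
  also have "\<dots> = scal ((- 1) ^ length (k # ks)) (foldr (swap_factor u) (k # ks) (bdry n c))"
    by (simp add: swap_factor_scal flip: scal_left_minus)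
  finally show ?case .
qed simp

lemma sorted_list_of_set_insert_less:
  assumes "finite B" "\<And>x. x \<in> B \<Longrightarrow> (k::nat) < x"
  shows "sorted_list_of_set (insert k B) = k # sorted_list_of_set B"
proof -
  have "set (sorted_list_of_set (insert k B)) = set (k # sorted_list_of_set B)"
    using assms(1) by (simp only: set_sorted_list_of_set finite_insert list.set)
  moreover have "sorted (k # sorted_list_of_set B)" "distinct (k # sorted_list_of_set B)"
    using assms by (auto intro: less_imp_le)
  ultimately show ?thesis
    by (intro sorted_distinct_set_unique sorted_sorted_list_of_set distinct_sorted_list_of_set)
qed

lemma next_mset_insert:
  "finite F \<Longrightarrow> k \<notin> F \<Longrightarrow> next_mset u (insert k F) = add_mset (next_supp u k) (next_mset u F)"
  by (simp add: next_mset_def)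

text \<open>The new element is smaller than all others, so its factor is outermost. If
  \<open>k \<notin> F\<close>, then \<open>e_k\<close> already stands in front and no sign arises.
  If \<open>k \<in> F\<close>, the basis element of its successor passes all
  \<open>card (S - F)\<close> factors of the first block to head the second, and every pair
  \<open>(k, l)\<close> with \<open>l \<in> S - F\<close> is new in
  \<open>swap_sign\<close>.\<close>

lemma foldr_swap_factor_expand:
  assumes "finite S"
  shows "foldr (swap_factor u) (sorted_list_of_set S) c =
    (\<Sum>F\<in>Pow S. scal ((- 1) ^ swap_sign S F * xmon (next_mset u (S - F) + mset_set F))
       (foldr ext (sorted_list_of_set (S - F) @ map (next_supp u) (sorted_list_of_set F)) c))"
  using assms
proof (induction S rule: finite_linorder_min_induct)
  case empty
  show ?case by (simp add: swap_sign_def next_mset_def flip: xmon_def single_one)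
     (simp add: xmon_def)
next
  case (insert k S)
  have kS: "k \<notin> S" using insert.hyps by blast
  define T where "T S F = scal ((- 1) ^ swap_sign S F * xmon (next_mset u (S - F) + mset_set F))
       (foldr ext (sorted_list_of_set (S - F) @ map (next_supp u) (sorted_list_of_set F)) c)" for S F
  have out: "scal (xmon {#next_supp u k#}) (ext k (T S F)) = T (insert k S) F"
    and into: "- scal (xmon {#k#}) (ext (next_supp u k) (T S F)) = T (insert k S) (insert k F)"
    if F: "F \<subseteq> S" for F
  proof -
    have fin: "finite F" "finite (S - F)" using F insert.hyps(1) finite_subset by auto
    have kF: "k \<notin> F" using F kS by blast
    have e1: "insert k S - F = insert k (S - F)" using kF by blast
    have e2: "insert k S - insert k F = S - F" using kS by blast
    have l1: "sorted_list_of_set (insert k (S - F)) = k # sorted_list_of_set (S - F)"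
      by (rule sorted_list_of_set_insert_less) (use insert.hyps fin in auto)
    have l2: "sorted_list_of_set (insert k F) = k # sorted_list_of_set F"
      by (rule sorted_list_of_set_insert_less) (use insert.hyps fin F in auto)
    have "{(a, b). a \<in> F \<and> b \<in> insert k S - F \<and> a < b} = {(a, b). a \<in> F \<and> b \<in> S - F \<and> a < b}"
      using insert.hyps F by (auto dest: order.asym)
    then have s1: "swap_sign (insert k S) F = swap_sign S F" by (simp add: swap_sign_def)
    have "{(a, b). a \<in> insert k F \<and> b \<in> insert k S - insert k F \<and> a < b} =
        {(a, b). a \<in> F \<and> b \<in> S - F \<and> a < b} \<union> Pair k ` (S - F)"
      unfolding e2 using insert.hyps by auto
    moreover have "finite {(a, b). a \<in> F \<and> b \<in> S - F \<and> a < b}"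
      by (rule finite_subset[of _ "F \<times> (S - F)"]) (use fin in auto)
    ultimately have "card {(a, b). a \<in> insert k F \<and> b \<in> insert k S - insert k F \<and> a < b} =
        card {(a, b). a \<in> F \<and> b \<in> S - F \<and> a < b} + card (Pair k ` (S - F))"
      using fin kF by (simp only: card_Un_disjoint finite_imageI) (subst card_Un_disjoint, auto)
    moreover have "card (Pair k ` (S - F)) = card (S - F)"
      by (rule card_image) (auto simp: inj_on_def)
    ultimately have s2: "swap_sign (insert k S) (insert k F) = Suc (card (S - F) + swap_sign S F)"
      using fin kF by (simp add: swap_sign_def)
    have n1: "next_mset u (insert k (S - F)) = add_mset (next_supp u k) (next_mset u (S - F))"
      by (rule next_mset_insert) (use fin kS in auto)
    have x: "xmon {#j#} * (s * xmon v) = s * xmon (add_mset j v)" for j v and s :: "'a mpoly"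
      by (metis add_mset_add_single mult.left_commute union_commute xmon_mult)
    show "scal (xmon {#next_supp u k#}) (ext k (T S F)) = T (insert k S) F"
      unfolding T_def e1 l1 s1 n1 by (simp add: ext_scal scal_scal x)
    have m: "mset_set (insert k F) = add_mset k (mset_set F)" using fin kF by simp
    have "ext (next_supp u k)
        (foldr ext (sorted_list_of_set (S - F) @ map (next_supp u) (sorted_list_of_set F)) c) =
      scal ((- 1) ^ card (S - F)) (foldr ext (sorted_list_of_set (S - F) @
         next_supp u k # map (next_supp u) (sorted_list_of_set F)) c)"
      using ext_foldr_ext[of "next_supp u k" "sorted_list_of_set (S - F)"
          "foldr ext (map (next_supp u) (sorted_list_of_set F)) c"] by simp
    moreover have "- scal (xmon {#k#}) (scal ((- 1) ^ s * xmon v) (scal ((- 1) ^ r) W)) =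
        scal ((- 1) ^ Suc (r + s) * xmon (add_mset k v)) W"
      for r s v and W :: "nat set \<Rightarrow> 'a mpoly"
    proof -
      have "xmon (add_mset k v) = (xmon {#k#} * xmon v :: 'a mpoly)" by (simp add: xmon_mult)
      then show ?thesis by (simp add: scal_scal power_add mult_ac flip: scal_left_minus)
    qed
    ultimately show "- scal (xmon {#k#}) (ext (next_supp u k) (T S F)) = T (insert k S) (insert k F)"
      unfolding T_def e2 l2 s2 m by (simp add: ext_scal)
  qed
  have IH: "foldr (swap_factor u) (sorted_list_of_set S) c = (\<Sum>F\<in>Pow S. T S F)"
    unfolding T_def by (rule insert.IH)
  have "sorted_list_of_set (insert k S) = k # sorted_list_of_set S"
    by (rule sorted_list_of_set_insert_less) (use insert.hyps in auto)
  then have "foldr (swap_factor u) (sorted_list_of_set (insert k S)) c =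
      swap_factor u k (\<Sum>F\<in>Pow S. T S F)"
    by (simp only: foldr.simps o_apply IH)
  also have "\<dots> = (\<Sum>F\<in>Pow S. T (insert k S) F + T (insert k S) (insert k F))"
    unfolding swap_factor_sum
    by (rule sum.cong) (auto simp: swap_factor_def out simp flip: into)
  also have "\<dots> = (\<Sum>F\<in>Pow S. T (insert k S) F) + (\<Sum>F\<in>insert k ` Pow S. T (insert k S) F)"
    unfolding sum.distrib
    by (subst sum.reindex) (use kS in \<open>auto simp: inj_on_def\<close>)
  also have "\<dots> = (\<Sum>F\<in>Pow (insert k S). T (insert k S) F)"
    unfolding Pow_insert using insert.hyps(1) kS by (subst sum.union_disjoint) auto
  finally show ?case by (simp only: T_def)
qed

section \<open>The sign exponent\<close>

lemma next_supp_props: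
  assumes "k \<in> {1..mon_max u - 1}" "u \<noteq> {#}"
  shows "next_supp u k \<in># u" "k < next_supp u k" "\<And>j. j \<in># u \<Longrightarrow> k < j \<Longrightarrow> next_supp u k \<le> j"
proof -
  have "mon_max u \<in># u" using assms by (simp add: mon_max_def)
  then have ne: "{j \<in> set_mset u. k < j} \<noteq> {}" using assms(1) by auto
  have "Min {j \<in> set_mset u. k < j} \<in> {j \<in> set_mset u. k < j}"
    by (rule Min_in) (use ne in auto)
  then show "next_supp u k \<in># u" "k < next_supp u k" by (auto simp: next_supp_def)
  show "next_supp u k \<le> j" if "j \<in># u" "k < j" for j
    unfolding next_supp_def by (rule Min_le) (use that in auto)
qed

lemma next_supp_mono:
  assumes "k \<le> l" "k \<in> {1..mon_max u - 1}" "l \<in> {1..mon_max u - 1}" "u \<noteq> {#}"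
  shows "next_supp u k \<le> next_supp u l"
  using next_supp_props(3)[OF assms(2,4) next_supp_props(1)[OF assms(3,4)]]
    next_supp_props(2)[OF assms(3,4)] assms(1) by linarith

lemma sl_next_mset:
  assumes "F \<subseteq> {1..mon_max u - 1}" "u \<noteq> {#}"
  shows "sl (next_mset u F) = map (next_supp u) (sorted_list_of_set F)"
proof -
  have fin: "finite F" using assms(1) by (rule finite_subset) simp
  have "sorted (map (next_supp u) (sorted_list_of_set F))"
    unfolding sorted_map
    by (rule sorted_wrt_mono_rel[OF _ sorted_sorted_list_of_set])
      (use assms fin in \<open>auto intro!: next_supp_mono\<close>)
  moreover have "next_mset u F = mset (map (next_supp u) (sorted_list_of_set F))"
    using fin unfolding next_mset_def mset_map
    by (metis mset_sorted_list_of_multiset sorted_list_of_mset_set)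
  ultimately show ?thesis by (simp only: sl_mset)
qed

text \<open>Let \<open>m\<close> be the maximum of \<open>\<sigma>\<close>. If
  \<open>m \<notin> F\<close>, removing it loses one pair \<open>(k, m)\<close> for every
  \<open>k \<in> F\<close>. If \<open>m \<in> F\<close>, then \<open>m\<close> is the only element
  of \<open>F\<close> in \<open>E\<close>, and all of \<open>E\<close> lies above
  \<open>F - {m}\<close>. Removing \<open>E\<close> loses \<open>(card F - 1) * (card E - 1)\<close>
  pairs and one element of \<open>F\<close>. This matches the recursion modulo 2, as
  \<open>card F - 1\<close> and \<open>card F + 1\<close> have the same parity.\<close>

lemma even_sign_exp_swap_sign:
  assumes "finite \<sigma>" "F \<subseteq> \<sigma>" "\<sigma> \<subseteq> {1..mon_max u - 1}" "u \<noteq> {#}" "inj_on (next_supp u) F"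
  shows "even (sign_exp u \<sigma> F + swap_sign \<sigma> F)"
  using assms
proof (induction "card \<sigma>" arbitrary: \<sigma> F rule: less_induct)
  case less
  have finF: "finite F" using less.prems finite_subset by blast
  show ?case
  proof (cases "F = {}")
    case True
    then show ?thesis by (simp add: sign_exp.simps swap_sign_def)
  next
    case F: False
    define m where "m = Max \<sigma>"
    have m: "m \<in> \<sigma>" "\<And>k. k \<in> \<sigma> \<Longrightarrow> k \<le> m"
      using less.prems F by (auto simp: m_def intro: Max_in)
    have rec: "sign_exp u \<sigma> F = (if m \<notin> F then sign_exp u (\<sigma> - {m}) F + card F
        else let E = {k \<in> \<sigma>. next_supp u k = next_supp u m}
           in sign_exp u (\<sigma> - E) (F - E) + (card E - 1) * (card F + 1) + 1)"
      using F less.prems by (subst sign_exp.simps) (simp add: m_def)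
    show ?thesis
    proof (cases "m \<in> F")
      case False
      have "even (sign_exp u (\<sigma> - {m}) F + swap_sign (\<sigma> - {m}) F)"
      proof (rule less.hyps)
        show "card (\<sigma> - {m}) < card \<sigma>" using less.prems(1) m(1) by (rule card_Diff1_less)
      qed (use less.prems False in auto)
      moreover have "swap_sign \<sigma> F = swap_sign (\<sigma> - {m}) F + card F"
      proof -
        have "{(k, l). k \<in> F \<and> l \<in> \<sigma> - F \<and> k < l} =
            {(k, l). k \<in> F \<and> l \<in> \<sigma> - {m} - F \<and> k < l} \<union> (\<lambda>k. (k, m)) ` F"
          using m less.prems(2) False by (auto simp: order.strict_iff_order)
        moreover have "finite {(k, l). k \<in> F \<and> l \<in> \<sigma> - {m} - F \<and> k < l}"
          by (rule finite_subset[of _ "F \<times> \<sigma>"]) (use finF less.prems in auto)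
        moreover have "card ((\<lambda>k. (k, m)) ` F) = card F"
          by (rule card_image) (auto simp: inj_on_def)
        moreover have "{(k, l). k \<in> F \<and> l \<in> \<sigma> - {m} - F \<and> k < l} \<inter> (\<lambda>k. (k, m)) ` F = {}"
          by auto
        ultimately show ?thesis using finF by (simp add: swap_sign_def card_Un_disjoint)
      qed
      ultimately show ?thesis using False by (simp add: rec)
    next
      case True
      define E where "E = {k \<in> \<sigma>. next_supp u k = next_supp u m}"
      have mE: "m \<in> E" using m by (simp add: E_def)
      have finE: "finite E" using less.prems by (simp add: E_def)
      have FE: "F \<inter> E = {m}"
        using less.prems(5) True mE by (auto simp: E_def inj_on_def)
      have even: "even (sign_exp u (\<sigma> - E) (F - E) + swap_sign (\<sigma> - E) (F - E))"
      proof (rule less.hyps)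
        show "card (\<sigma> - E) < card \<sigma>"
          using less.prems(1) mE m(1) by (intro psubset_card_mono) auto
      qed (use less.prems in \<open>auto intro: inj_on_subset\<close>)
      have FmE: "F - E = F - {m}" using FE by blast
      have EF: "E - {m} = E - F" using FE by blast
      \<comment> \<open>Successors are monotone, so an element of \<open>F\<close> at or above some
        \<open>l \<in> E\<close> would have the same successor as \<open>m\<close>, which
        injectivity reserves for \<open>m\<close>.\<close>
      have lt: "k < l" if "k \<in> F - {m}" "l \<in> E" for k l
      proof (rule ccontr)
        assume "\<not> k < l"
        then have "next_supp u l \<le> next_supp u k"
          using that less.prems by (intro next_supp_mono) (auto simp: E_def)
        moreover have "next_supp u k \<le> next_supp u m"
          using that less.prems m True by (intro next_supp_mono) auto
        ultimately have "next_supp u k = next_supp u m" using that by (simp add: E_def)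
        then show False using that less.prems(5) True by (auto simp: inj_on_def)
      qed
      have "{(k, l). k \<in> F \<and> l \<in> \<sigma> - F \<and> k < l} =
          {(k, l). k \<in> F - E \<and> l \<in> \<sigma> - E - (F - E) \<and> k < l} \<union> (F - {m}) \<times> (E - {m})"
        (is "?P = ?Q \<union> ?R")
      proof (intro equalityI subsetI)
        fix p assume "p \<in> ?P"
        then obtain k l where p: "p = (k, l)" "k \<in> F" "l \<in> \<sigma>" "l \<notin> F" "k < l" by auto
        then have "k \<noteq> m" using m(2)[of l] by auto
        then show "p \<in> ?Q \<union> ?R" using p FmE True by auto
      next
        fix p assume "p \<in> ?Q \<union> ?R"
        then show "p \<in> ?P"
        proof
          assume "p \<in> ?Q"
          then show ?thesis by auto
        next
          assume "p \<in> ?R"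
          then show ?thesis using lt EF by (auto simp: E_def)
        qed
      qed
      moreover have "finite ?Q"
        by (rule finite_subset[of _ "F \<times> \<sigma>"]) (use finF less.prems in auto)
      moreover have "finite ?R" using finF finE by blast
      moreover have "?Q \<inter> ?R = {}" by auto
      ultimately have "card ?P = card ?Q + card ?R" by (simp only: card_Un_disjoint)
      moreover have "card ?R = (card F - 1) * (card E - 1)"
        using True mE finF finE by (simp add: card_cartesian_product)
      moreover have "card F = Suc (card (F - E))"
        using True finF unfolding FmE by (metis card_Suc_Diff1)
      ultimately have "swap_sign \<sigma> F = swap_sign (\<sigma> - E) (F - E) + 1 + (card F - 1) * (card E - 1)"
        by (simp add: swap_sign_def)
      moreover obtain f e where "card F = Suc f" "card E = Suc e"
        using True mE finF finE by (metis card_Suc_Diff1)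
      ultimately show ?thesis using even True
        unfolding rec E_def[symmetric] by (simp add: Let_def algebra_simps)
    qed
  qed
qed

section \<open>Lifts of the cycles to polynomial chains\<close>

definition lift_cycle :: "nat multiset \<Rightarrow> nat set \<Rightarrow> nat set \<Rightarrow> 'a::field mpoly" where
  "lift_cycle u \<sigma> = (\<Sum>F\<in>Pow \<sigma>.
     scal ((- 1) ^ sign_exp u \<sigma> F *
         xmon (mset_set F + (u - {#mon_max u#}) - next_mset u F))
       (wedge_list (sorted_list_of_set (\<sigma> - F) @ sl (next_mset u F) @ [mon_max u])))"

lemma next_mset_diff:
  assumes "finite \<sigma>" "F \<subseteq> \<sigma>"
  shows "next_mset u (\<sigma> - F) + next_mset u F = next_mset u \<sigma>"
proof -
  have "mset_set \<sigma> = mset_set (\<sigma> - F) + mset_set F"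
    using assms finite_subset by (subst mset_set_Union[symmetric]) (auto simp: Un_absorb2)
  then show ?thesis by (simp add: next_mset_def)
qed

lemma distinct_sl_subset:
  assumes "distinct (sl N)" "set_mset N \<subseteq> set_mset b"
  shows "N \<subseteq># b"
proof (rule mset_subset_eqI)
  fix a
  have "count N a = (if a \<in># N then 1 else 0)"
    using assms(1) unfolding distinct_count_atmost_1 by simp
  then show "count N a \<le> count b a" using assms(2) by (auto simp: Suc_le_eq subset_iff)
qed

lemma set_next_mset:
  assumes "F \<subseteq> {1..mon_max u - 1}" "u \<noteq> {#}"
  shows "set_mset (next_mset u F) \<subseteq> set_mset u"
proof -
  have "finite F" using assms(1) by (rule finite_subset) simp
  then show ?thesis using next_supp_props(1)[OF _ assms(2)] assms(1) by (auto simp: next_mset_def)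
qed

text \<open>The common denominator \<open>next_mset u \<sigma>\<close> turns each summand into a
  summand of the expanded product of the \<open>swap_factor\<close>s.\<close>

lemma clear_denominator:
  assumes "finite \<sigma>" "F \<subseteq> \<sigma>" "distinct js \<Longrightarrow> next_mset u F \<subseteq># b"
  shows "scal (xmon (next_mset u \<sigma>)) (scal (s * xmon (mset_set F + b - next_mset u F)) (wedge_list js))
    = scal (xmon b) (scal (s * xmon (next_mset u (\<sigma> - F) + mset_set F)) (wedge_list js))"
proof (cases "distinct js")
  case True
  have "next_mset u \<sigma> + (mset_set F + b - next_mset u F) = b + (next_mset u (\<sigma> - F) + mset_set F)"
  proof -
    obtain b' where "b = next_mset u F + b'"
      using assms(3)[OF True] by (auto simp: mset_subset_eq_exists_conv)
    then show ?thesis by (simp add: union_ac flip: next_mset_diff[OF assms(1,2)])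
  qed
  then have "xmon (next_mset u \<sigma>) * (s * xmon (mset_set F + b - next_mset u F)) =
      xmon b * (s * xmon (next_mset u (\<sigma> - F) + mset_set F))"
    by (metis mult.left_commute xmon_mult)
  then show ?thesis by (simp only: scal_scal)
qed (simp add: wedge_list_not_distinct)

context
  fixes u :: "nat multiset" and \<sigma> :: "nat set" and n :: nat
  assumes u: "u \<in> monomials n" "u \<noteq> {#}" and \<sigma>: "\<sigma> \<subseteq> {1..mon_max u - 1}"
begin

lemma finite_sigma: "finite \<sigma>"
  using \<sigma> by (rule finite_subset) simp

lemma mon_max_mem: "mon_max u \<in># u"
  using u by (simp add: mon_max_def)

lemma mon_max_range: "mon_max u \<in> {1..n}"
  using u(1) mon_max_mem unfolding monomials_def by blast

lemma sigma_range: "\<sigma> \<subseteq> {1..n}"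
proof
  fix x assume "x \<in> \<sigma>"
  then have "x \<in> {1..mon_max u - 1}" using \<sigma> by blast
  then show "x \<in> {1..n}" using mon_max_range by auto
qed

lemma inj_next_supp:
  assumes "F \<subseteq> \<sigma>" "distinct (sl (next_mset u F))"
  shows "inj_on (next_supp u) F"
proof -
  have "distinct (map (next_supp u) (sorted_list_of_set F))"
    using assms(2) sl_next_mset[of F u] assms(1) \<sigma> u(2) by auto
  then show ?thesis
    using finite_subset[OF assms(1) finite_sigma] by (simp add: distinct_map)
qed

lemma next_mset_subset:
  assumes "F \<subseteq> \<sigma>" "distinct (xs @ sl (next_mset u F))"
  shows "next_mset u F \<subseteq># u"
  using assms set_next_mset[of F u] \<sigma> u(2) by (intro distinct_sl_subset) auto

text \<open>If the wedge product is nonzero, the indices \<open>k^(u)\<close> are distinct, lie in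
  the support of \<open>u\<close> and differ from \<open>mon_max u\<close>. The multiset difference
  in \<open>lift_cycle\<close> is then an exact quotient.\<close>

lemma next_mset_subset_max:
  assumes "F \<subseteq> \<sigma>" "distinct (xs @ sl (next_mset u F) @ [mon_max u])"
  shows "next_mset u F \<subseteq># u - {#mon_max u#}"
proof (rule distinct_sl_subset)
  have "mon_max u \<notin># next_mset u F" using assms(2) by auto
  moreover have "set_mset (next_mset u F) \<subseteq> set_mset u"
    using assms(1) \<sigma> u(2) by (intro set_next_mset) auto
  moreover have "u = add_mset (mon_max u) (u - {#mon_max u#})" using mon_max_mem by simp
  then have "set_mset u = insert (mon_max u) (set_mset (u - {#mon_max u#}))"
    by (metis set_mset_add_mset_insert)
  ultimately show "set_mset (next_mset u F) \<subseteq> set_mset (u - {#mon_max u#})"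
    by (metis insertE subsetD subsetI)
qed (use assms(2) in auto)

text \<open>This is the product formula, multiplied by the common denominator. The parity comparison
  of the signs is available for distinct wedge indices; in the remaining summands both sides are
  0.\<close>

lemma scal_lift_cycle:
  "scal (xmon (next_mset u \<sigma>)) (lift_cycle u \<sigma>) =
    scal (xmon (u - {#mon_max u#}))
      (foldr (swap_factor u) (sorted_list_of_set \<sigma>) (wedge_list [mon_max u]))"
proof -
  let ?js = "\<lambda>F. sorted_list_of_set (\<sigma> - F) @ sl (next_mset u F) @ [mon_max u]"
  have "scal (xmon (next_mset u \<sigma>)) (lift_cycle u \<sigma>) =
    (\<Sum>F\<in>Pow \<sigma>. scal (xmon (u - {#mon_max u#}))
       (scal ((- 1) ^ swap_sign \<sigma> F * xmon (next_mset u (\<sigma> - F) + mset_set F)) (wedge_list (?js F))))"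
    unfolding lift_cycle_def scal_sum
  proof (rule sum.cong)
    fix F assume "F \<in> Pow \<sigma>"
    then have F: "F \<subseteq> \<sigma>" by simp
    have sg: "scal ((- 1) ^ sign_exp u \<sigma> F * p) (wedge_list (?js F)) =
        scal ((- 1) ^ swap_sign \<sigma> F * p) (wedge_list (?js F))" for p
    proof (cases "distinct (?js F)")
      case True
      then have "even (sign_exp u \<sigma> F + swap_sign \<sigma> F)"
        by (intro even_sign_exp_swap_sign finite_sigma F \<sigma> u inj_next_supp) auto
      then have "even (sign_exp u \<sigma> F) \<longleftrightarrow> even (swap_sign \<sigma> F)" by simp
      then show ?thesis by (simp add: minus_one_power_iff)
    qed (simp add: wedge_list_not_distinct)
    show "scal (xmon (next_mset u \<sigma>)) (scal ((- 1) ^ sign_exp u \<sigma> F *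
         xmon (mset_set F + (u - {#mon_max u#}) - next_mset u F)) (wedge_list (?js F))) =
      scal (xmon (u - {#mon_max u#}))
       (scal ((- 1) ^ swap_sign \<sigma> F * xmon (next_mset u (\<sigma> - F) + mset_set F)) (wedge_list (?js F)))"
      by (simp only: clear_denominator[OF finite_sigma F next_mset_subset_max[OF F]] sg)
  qed simp
  also have "\<dots> = scal (xmon (u - {#mon_max u#}))
      (foldr (swap_factor u) (sorted_list_of_set \<sigma>) (wedge_list [mon_max u]))"
    unfolding foldr_swap_factor_expand[OF finite_sigma] scal_sum
  proof (rule sum.cong)
    fix F assume "F \<in> Pow \<sigma>"
    then have "sl (next_mset u F) = map (next_supp u) (sorted_list_of_set F)"
      using \<sigma> u(2) by (intro sl_next_mset) auto
    then show "scal (xmon (u - {#mon_max u#}))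
       (scal ((- 1) ^ swap_sign \<sigma> F * xmon (next_mset u (\<sigma> - F) + mset_set F)) (wedge_list (?js F))) =
      scal (xmon (u - {#mon_max u#}))
       (scal ((- 1) ^ swap_sign \<sigma> F * xmon (next_mset u (\<sigma> - F) + mset_set F))
        (foldr ext (sorted_list_of_set (\<sigma> - F) @ map (next_supp u) (sorted_list_of_set F))
          (wedge_list [mon_max u])))"
      by (simp add: wedge_list_def)
  qed simp
  finally show ?thesis .
qed

text \<open>The differential passes the swap factors and turns the last basis element into its
  variable, which completes \<open>u'\<close> to \<open>u\<close>. The product is then expanded
  again and the common denominator cancelled. Now \<open>F^(u)\<close> may contain
  \<open>mon_max u\<close>, since it is \<open>u\<close> rather than \<open>u'\<close> that is
  divided.\<close>

lemma bdry_lift_cycle: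
  "bdry n (lift_cycle u \<sigma>) = (\<Sum>F\<in>Pow \<sigma>.
     scal ((- 1) ^ (card \<sigma> + swap_sign \<sigma> F) * xmon (mset_set F + u - next_mset u F))
       (wedge_list (sorted_list_of_set (\<sigma> - F) @ sl (next_mset u F))))" (is "_ = ?R")
proof -
  let ?js = "\<lambda>F. sorted_list_of_set (\<sigma> - F) @ sl (next_mset u F)"
  have nr: "k \<in> {1..n} \<and> next_supp u k \<in> {1..n}" if "k \<in> set (sorted_list_of_set \<sigma>)" for k
  proof -
    have k: "k \<in> \<sigma>" using that finite_sigma by simp
    then have "next_supp u k \<in># u" using next_supp_props(1)[of k u] \<sigma> u(2) by blast
    then show ?thesis using k sigma_range u(1) unfolding monomials_def by blast
  qed
  have bd: "bdry n (foldr (swap_factor u) (sorted_list_of_set \<sigma>) c) =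
      scal ((- 1) ^ card \<sigma>) (foldr (swap_factor u) (sorted_list_of_set \<sigma>) (bdry n c))" for c
    using bdry_foldr_swap_factor[of "sorted_list_of_set \<sigma>" n u c] nr by simp
  have con0: "con k (unit_chain {}) = 0" for k
    by (auto simp: con_def unit_chain_def fun_eq_iff)
  have bdry0: "bdry n (unit_chain {}) = 0" by (simp add: bdry_def con0)
  have max: "bdry n (wedge_list [mon_max u]) = scal (xmon {#mon_max u#}) (wedge_list [])"
    by (simp add: wedge_list_def bdry_ext[OF mon_max_range] bdry0)
  have mm: "xmon (u - {#mon_max u#}) * xmon {#mon_max u#} = xmon u"
    using mon_max_mem by (simp add: xmon_mult)
  have c: "xmon (u - {#mon_max u#}) * ((- 1) ^ card \<sigma> * xmon {#mon_max u#}) = (- 1) ^ card \<sigma> * xmon u"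
    unfolding mm[symmetric] by (simp only: mult_ac)
  have "scal (xmon (next_mset u \<sigma>)) (bdry n (lift_cycle u \<sigma>)) =
      scal ((- 1) ^ card \<sigma>) (scal (xmon u)
        (foldr (swap_factor u) (sorted_list_of_set \<sigma>) (wedge_list [])))"
    unfolding bdry_scal[symmetric] scal_lift_cycle
    unfolding bdry_scal bd max foldr_swap_factor_scal scal_scal
    by (simp add: c)
  also have "\<dots> = (\<Sum>F\<in>Pow \<sigma>. scal ((- 1) ^ card \<sigma>) (scal (xmon u)
       (scal ((- 1) ^ swap_sign \<sigma> F * xmon (next_mset u (\<sigma> - F) + mset_set F)) (wedge_list (?js F)))))"
    unfolding foldr_swap_factor_expand[OF finite_sigma] scal_sum
  proof (rule sum.cong)
    fix F assume "F \<in> Pow \<sigma>"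
    then have "sl (next_mset u F) = map (next_supp u) (sorted_list_of_set F)"
      using \<sigma> u(2) by (intro sl_next_mset) auto
    then show "scal ((- 1) ^ card \<sigma>) (scal (xmon u)
       (scal ((- 1) ^ swap_sign \<sigma> F * xmon (next_mset u (\<sigma> - F) + mset_set F))
        (foldr ext (sorted_list_of_set (\<sigma> - F) @ map (next_supp u) (sorted_list_of_set F))
          (wedge_list [])))) =
      scal ((- 1) ^ card \<sigma>) (scal (xmon u)
       (scal ((- 1) ^ swap_sign \<sigma> F * xmon (next_mset u (\<sigma> - F) + mset_set F)) (wedge_list (?js F))))"
      by (simp add: wedge_list_def)
  qed simp
  also have "\<dots> = scal (xmon (next_mset u \<sigma>)) ?R"
    unfolding scal_sum
  proof (rule sum.cong)
    fix F assume "F \<in> Pow \<sigma>"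
    then have F: "F \<subseteq> \<sigma>" by simp
    have cd: "scal (xmon (next_mset u \<sigma>)) (scal (s * xmon (mset_set F + u - next_mset u F)) (wedge_list (?js F)))
      = scal (xmon u) (scal (s * xmon (next_mset u (\<sigma> - F) + mset_set F)) (wedge_list (?js F)))" for s
      by (rule clear_denominator[OF finite_sigma F]) (rule next_mset_subset[OF F])
    show "scal ((- 1) ^ card \<sigma>) (scal (xmon u)
       (scal ((- 1) ^ swap_sign \<sigma> F * xmon (next_mset u (\<sigma> - F) + mset_set F)) (wedge_list (?js F)))) =
      scal (xmon (next_mset u \<sigma>)) (scal ((- 1) ^ (card \<sigma> + swap_sign \<sigma> F) *
        xmon (mset_set F + u - next_mset u F)) (wedge_list (?js F)))"
      unfolding cd by (simp add: scal_scal power_add mult_ac)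
  qed simp
  finally have eq: "scal (xmon (next_mset u \<sigma>)) (bdry n (lift_cycle u \<sigma>)) =
      scal (xmon (next_mset u \<sigma>)) ?R" .
  show ?thesis
  proof (rule HOL.ext)
    fix \<tau>
    from eq have "xmon (next_mset u \<sigma>) * bdry n (lift_cycle u \<sigma>) \<tau> = xmon (next_mset u \<sigma>) * ?R \<tau>"
      unfolding scal_apply[symmetric] by (rule fun_cong)
    then show "bdry n (lift_cycle u \<sigma>) \<tau> = ?R \<tau>" by (simp only: xmon_mult_cancel)
  qed
qed

lemma lift_cycle_term:
  assumes F: "F \<subseteq> \<sigma>"
  shows "length (sorted_list_of_set (\<sigma> - F) @ sl (next_mset u F) @ [mon_max u]) = Suc (card \<sigma>)"
    and "set (sorted_list_of_set (\<sigma> - F) @ sl (next_mset u F) @ [mon_max u]) \<subseteq> {1..n}"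
    and "mset_set F + (u - {#mon_max u#}) - next_mset u F \<in> monomials n"
proof -
  have F: "F \<subseteq> \<sigma>" "finite F" using F finite_sigma finite_subset by auto
  let ?js = "sorted_list_of_set (\<sigma> - F) @ sl (next_mset u F) @ [mon_max u]"
  have N: "set_mset (next_mset u F) \<subseteq> set_mset u" using F(1) \<sigma> u(2) by (intro set_next_mset) auto
  have uN: "set_mset u \<subseteq> {1..n}" using u(1) by (simp add: monomials_def)
  have "card F + card (\<sigma> - F) = card \<sigma>"
    using F finite_sigma by (metis card_Diff_subset card_mono le_add_diff_inverse)
  then show "length ?js = Suc (card \<sigma>)"
    using finite_sigma F(2) by (simp add: next_mset_def)
  show "set ?js \<subseteq> {1..n}"
    using finite_sigma sigma_range N uN mon_max_range by auto
  show "mset_set F + (u - {#mon_max u#}) - next_mset u F \<in> monomials n"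
  proof -
    have "mset_set F \<in> monomials n" "u - {#mon_max u#} \<in> monomials n"
      using F sigma_range uN by (auto simp: monomials_def dest!: in_diffD)
    then have "set_mset (mset_set F + (u - {#mon_max u#})) \<subseteq> {1..n}"
      unfolding monomials_def by simp
    moreover have "set_mset (mset_set F + (u - {#mon_max u#}) - next_mset u F) \<subseteq>
        set_mset (mset_set F + (u - {#mon_max u#}))"
      by (meson in_diffD subsetI)
    ultimately show ?thesis unfolding monomials_def by (simp only: mem_Collect_eq)
  qed
qed

lemma lift_cycle_chain: "lift_cycle u \<sigma> \<in> poly_chains n (Suc (card \<sigma>))"
  unfolding lift_cycle_def
proof (rule chains_sum)
  fix F assume "F \<in> Pow \<sigma>"
  then have F: "F \<subseteq> \<sigma>" by simp
  show "scal ((- 1) ^ sign_exp u \<sigma> F *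
      xmon (mset_set F + (u - {#mon_max u#}) - next_mset u F))
      (wedge_list (sorted_list_of_set (\<sigma> - F) @ sl (next_mset u F) @ [mon_max u]))
    \<in> poly_chains n (Suc (card \<sigma>))"
    using lift_cycle_term(3)[OF F] wedge_list_chain[OF lift_cycle_term(2)[OF F]]
    unfolding lift_cycle_term(1)[OF F]
    by (intro chains_scal) (simp_all add: keys_power_minus_one)
qed

end

context spread_stable
begin

lemma linear_vars_subset:
  assumes "u \<in> G"
  shows "linear_vars t u \<subseteq> {1..mon_max u - 1}" "linear_vars t u \<subseteq> {1..n}" "u \<in> monomials n" "u \<noteq> {#}"
proof -
  show u: "u \<in> monomials n" "u \<noteq> {#}"
    using G_sub_M[OF assms] M_monomials empty_notin_M by auto
  show 1: "linear_vars t u \<subseteq> {1..mon_max u - 1}" by (auto simp: linear_vars_def)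
  show "linear_vars t u \<subseteq> {1..n}" by (rule sigma_range[OF u 1])
qed

text \<open>The summand of \<open>F = {}\<close> in the differential is the leading term
  \<open>u e_\<sigma>\<close>. For any other \<open>F\<close>, either two elements share a successor
  and the wedge product vanishes, or the coefficient is a swapped monomial, which is a multiple of a
  generator before \<open>u\<close>.\<close>

lemma linear_quotients:
  "linear_quotients n G sl (linear_vars t) (lift_cycle :: _ \<Rightarrow> _ \<Rightarrow> _ \<Rightarrow> 'a::field mpoly)"
proof
  show "finite G" by (rule finite_G)
  show "inj_on sl G" by (rule inj_sl)
  show "G \<subseteq> monomials n" using linear_vars_subset by blast
  fix u assume u: "u \<in> G"
  show "linear_vars t u \<subseteq> {1..n}" by (rule linear_vars_subset(2)[OF u])
  show "(u + v \<in> up {g \<in> G. sl g < sl u}) = (v \<in> vars (linear_vars t u))" for v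
    by (rule colon_linear_vars[OF u])
  fix \<sigma> assume \<sigma>: "\<sigma> \<subseteq> linear_vars t u"
  then have \<sigma>': "\<sigma> \<subseteq> {1..mon_max u - 1}" using linear_vars_subset(1)[OF u] by blast
  note ctxt = linear_vars_subset(3,4)[OF u] \<sigma>'
  show "lift_cycle u \<sigma> \<in> poly_chains n (Suc (card \<sigma>))" by (rule lift_cycle_chain[OF ctxt])
  let ?U = "up {g \<in> G. sl g < sl u}"
  let ?T = "\<lambda>F. scal ((- 1) ^ (card \<sigma> + swap_sign \<sigma> F) * xmon (mset_set F + u - next_mset u F))
       (wedge_list (sorted_list_of_set (\<sigma> - F) @ sl (next_mset u F))) :: nat set \<Rightarrow> 'a mpoly"
  have fin: "finite \<sigma>" by (rule finite_sigma[OF ctxt])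
  have "?T {} = scal ((- 1) ^ card \<sigma> * xmon u) (unit_chain \<sigma>)"
    using fin by (simp add: swap_sign_def next_mset_def wedge_list_sorted)
  moreover have "(\<Sum>F\<in>Pow \<sigma>. ?T F) = ?T {} + (\<Sum>F\<in>Pow \<sigma> - {{}}. ?T F)"
    by (rule sum.remove) (use fin in auto)
  ultimately have "bdry n (lift_cycle u \<sigma>) - scal ((- 1) ^ card \<sigma> * xmon u) (unit_chain \<sigma>) =
      (\<Sum>F\<in>Pow \<sigma> - {{}}. ?T F)"
    unfolding bdry_lift_cycle[OF ctxt] by simp
  moreover have "coeffs_in ?U (?T F)" if "F \<in> Pow \<sigma> - {{}}" for F
  proof (cases "distinct (sl (next_mset u F))")
    case True
    have F: "F \<subseteq> \<sigma>" "F \<noteq> {}" using that by auto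
    have "\<exists>g\<in>G. sl g < sl u \<and> g \<subseteq># mset_set F + u - next_mset u F"
      by (rule swapped_in_M[OF u _ inj_next_supp[OF ctxt F(1) True] F(2)]) (use F \<sigma> in blast)
    then have "mset_set F + u - next_mset u F \<in> ?U" by (auto simp: up_def)
    then have "keys (xmon (mset_set F + u - next_mset u F) :: 'a mpoly) \<subseteq> ?U" by simp
    then have "keys (p * xmon (mset_set F + u - next_mset u F) :: 'a mpoly) \<subseteq> ?U" for p
      by (rule upward_keys_mult[OF upward_up])
    then have "keys (p * xmon (mset_set F + u - next_mset u F) * q :: 'a mpoly) \<subseteq> ?U" for p q
      by (subst mult.commute) (rule upward_keys_mult[OF upward_up])
    then show ?thesis unfolding coeffs_in_def scal_apply by blast
  next
    case False
    then have "wedge_list (sorted_list_of_set (\<sigma> - F) @ sl (next_mset u F)) = (0 :: nat set \<Rightarrow> 'a mpoly)"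
      by (intro wedge_list_not_distinct) simp
    then show ?thesis by simp
  qed
  ultimately show "coeffs_in ?U (bdry n (lift_cycle u \<sigma>) -
      scal ((- 1) ^ card \<sigma> * xmon u) (unit_chain \<sigma> :: nat set \<Rightarrow> 'a mpoly))"
    by (simp only: coeffs_in_sum)
qed

end

section \<open>The Koszul complex as a quotient of polynomial chains\<close>

lemma con_unit_chain:
  "con k (unit_chain \<tau>) = (if k \<in> \<tau> then scal (below_sign k \<tau>) (unit_chain (\<tau> - {k})) else 0)"
  by (auto simp: con_def unit_chain_def fun_eq_iff)

text \<open>The \<open>l\<close>-th element of \<open>\<tau>\<close> has \<open>l - 1\<close>
  elements below it, and \<open>l - 1\<close> has the parity of \<open>l + 1\<close>. So contraction
  gives the alternating sum that defines the Koszul differential.\<close>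

lemma bdry_unit_chain:
  assumes "\<tau> \<in> faces n i"
  shows "bdry n (unit_chain \<tau>) = (\<Sum>l\<in>{1..i}. let k = sorted_list_of_set \<tau> ! (l - 1) in
     scal ((- 1) ^ (l + 1) * xmon {#k#}) (unit_chain (\<tau> - {k})))"
proof -
  have \<tau>: "\<tau> \<subseteq> {1..n}" "card \<tau> = i" "finite \<tau>"
    using assms by (auto simp: faces_def intro: finite_subset)
  let ?xs = "sorted_list_of_set \<tau>"
  have len: "length ?xs = i" using \<tau> by simp
  have bij: "bij_betw (\<lambda>l. ?xs ! (l - 1)) {1..i} \<tau>"
  proof (rule bij_betwI')
    fix x y assume "x \<in> {1..i}" "y \<in> {1..i}"
    then show "(?xs ! (x - 1) = ?xs ! (y - 1)) = (x = y)"
      using len by (subst nth_eq_iff_index_eq) auto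
  next
    fix x assume "x \<in> {1..i}"
    then have "?xs ! (x - 1) \<in> set ?xs" using len by (intro nth_mem) auto
    then show "?xs ! (x - 1) \<in> \<tau>" using \<tau> by simp
  next
    fix y assume "y \<in> \<tau>"
    then have "y \<in> set ?xs" using \<tau> by simp
    then obtain m where "m < i" "?xs ! m = y" using len by (metis in_set_conv_nth)
    then show "\<exists>x\<in>{1..i}. y = ?xs ! (x - 1)" by (intro bexI[of _ "Suc m"]) auto
  qed
  have sign: "below_sign (?xs ! (l - 1)) \<tau> = (- 1) ^ (l + 1)" if l: "l \<in> {1..i}" for l
  proof -
    obtain m where m: "l = Suc m" "m < i" using l by (cases l) auto
    have "{j \<in> \<tau>. j < ?xs ! m} = set (take m ?xs)"
    proof (intro equalityI subsetI)
      fix j assume "j \<in> {j \<in> \<tau>. j < ?xs ! m}"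
      then have j: "j \<in> set ?xs" "j < ?xs ! m" using \<tau> by auto
      then obtain r where r: "r < i" "?xs ! r = j" using len by (metis in_set_conv_nth)
      have "r < m"
        using sorted_nth_mono[of ?xs m r] r j(2) len by (metis not_less sorted_sorted_list_of_set)
      then show "j \<in> set (take m ?xs)" using r m len by (auto simp: in_set_conv_nth)
    next
      fix j assume "j \<in> set (take m ?xs)"
      then obtain r where r: "r < m" "?xs ! r = j" using m len by (auto simp: in_set_conv_nth)
      have "sorted_wrt (<) ?xs" by simp
      then have "?xs ! r < ?xs ! m" using sorted_wrt_nth_less[of "(<)" ?xs r m] r m len by simp
      moreover have "j \<in> set ?xs" using r m len nth_mem[of r ?xs] by simp
      ultimately show "j \<in> {j \<in> \<tau>. j < ?xs ! m}" using r \<tau> by simp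
    qed
    also have "card \<dots> = m" using m len by (simp add: distinct_card)
    finally show ?thesis by (simp add: m below_sign_def)
  qed
  have "bdry n (unit_chain \<tau>) =
      (\<Sum>k\<in>{1..n}. if k \<in> \<tau> then scal (below_sign k \<tau> * xmon {#k#}) (unit_chain (\<tau> - {k})) else 0)"
    unfolding bdry_def
    by (rule sum.cong) (simp_all add: con_unit_chain scal_scal mult.commute)
  also have "\<dots> = (\<Sum>k\<in>\<tau>. scal (below_sign k \<tau> * xmon {#k#}) (unit_chain (\<tau> - {k})))"
    using \<tau>(1) by (subst sum.inter_restrict[symmetric]) (auto simp: Int_absorb1)
  also have "\<dots> = (\<Sum>l\<in>{1..i}. let k = ?xs ! (l - 1) in
     scal (below_sign k \<tau> * xmon {#k#}) (unit_chain (\<tau> - {k})))"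
    unfolding Let_def by (rule sum.reindex_bij_betw[OF bij, symmetric])
  also have "\<dots> = (\<Sum>l\<in>{1..i}. let k = ?xs ! (l - 1) in
     scal ((- 1) ^ (l + 1) * xmon {#k#}) (unit_chain (\<tau> - {k})))"
    by (rule sum.cong[OF refl]) (simp only: sign Let_def)
  finally show ?thesis .
qed

lemma finite_faces: "finite (faces n i)"
  by (rule finite_subset[of _ "Pow {1..n}"]) (auto simp: faces_def)

lemma chain_eq_sum_units:
  assumes "c \<in> poly_chains n i"
  shows "c = (\<Sum>\<tau>\<in>faces n i. scal (c \<tau>) (unit_chain \<tau>))"
proof (rule HOL.ext)
  fix \<rho>
  have "(\<Sum>\<tau>\<in>faces n i. scal (c \<tau>) (unit_chain \<tau>)) \<rho> = (\<Sum>\<tau>\<in>faces n i. if \<tau> = \<rho> then c \<tau> else 0)"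
    unfolding sum_apply by (rule sum.cong) (auto simp: unit_chain_def)
  also have "\<dots> = c \<rho>"
    using assms finite_faces by (auto simp: poly_chains_def sum.delta)
  finally show "c \<rho> = (\<Sum>\<tau>\<in>faces n i. scal (c \<tau>) (unit_chain \<tau>)) \<rho>" ..
qed

section \<open>The quotient ring and reduction of chains modulo the ideal\<close>

lemma poly_ring_simps [simp]:
  "carrier (poly_ring n) = {p. keys p \<subseteq> monomials n}"
  "add (poly_ring n) = (+)" "mult (poly_ring n) = (*)"
  "zero (poly_ring n) = 0" "one (poly_ring n) = 1"
  by (simp_all add: poly_ring_def)

lemma poly_ring_minus:
  assumes "keys p \<subseteq> monomials n" "keys q \<subseteq> monomials n"
  shows "p \<ominus>\<^bsub>poly_ring n\<^esub> q = p - q"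
proof -
  interpret R: cring "poly_ring n :: 'a mpoly ring" by (rule cring_poly_ring)
  have "\<ominus>\<^bsub>poly_ring n\<^esub> q = - q"
    by (rule R.minus_equality) (use assms in \<open>simp_all add: keys_minus_mpoly\<close>)
  then show ?thesis by (simp add: a_minus_def)
qed

text \<open>Assumption \<open>mem_I\<close> replaces cosets by supports: two polynomials in the
  given variables agree in \<open>S / I\<close> exactly if every monomial of their difference is a
  multiple of an element of \<open>G\<close>.\<close>

locale koszul_setting =
  fixes n :: nat and I :: "'a::field mpoly set" and G :: "nat multiset set"
  assumes ideal_I: "ideal I (poly_ring n)"
    and mem_I: "p \<in> I \<longleftrightarrow> keys p \<subseteq> monomials n \<and> keys p \<subseteq> up G"
begin

abbreviation "R \<equiv> poly_ring n :: 'a mpoly ring"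
abbreviation "Q \<equiv> quot_ring n I"

lemma cring_Q: "cring Q"
  by (rule ideal.quotient_is_cring[OF ideal_I cring_poly_ring])

lemma eps_hom: "eps n I \<in> Ring.ring_hom R Q"
proof -
  have "eps n I = (\<lambda>p. I +>\<^bsub>R\<^esub> p)" by (simp add: eps_def fun_eq_iff)
  then show ?thesis using ideal.rcos_ring_hom[OF ideal_I] by simp
qed

lemma eps_closed: "keys p \<subseteq> monomials n \<Longrightarrow> eps n I p \<in> carrier Q"
  using ring_hom_closed[OF eps_hom] by simp

lemma eps_add: "keys p \<subseteq> monomials n \<Longrightarrow> keys q \<subseteq> monomials n \<Longrightarrow>
    eps n I (p + q) = eps n I p \<oplus>\<^bsub>Q\<^esub> eps n I q"
  using ring_hom_add[OF eps_hom, of p q] by simp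

lemma eps_mult: "keys p \<subseteq> monomials n \<Longrightarrow> keys q \<subseteq> monomials n \<Longrightarrow>
    eps n I (p * q) = eps n I p \<otimes>\<^bsub>Q\<^esub> eps n I q"
  using ring_hom_mult[OF eps_hom, of p q] by simp

lemma eps_eq_iff: "keys p \<subseteq> monomials n \<Longrightarrow> keys q \<subseteq> monomials n \<Longrightarrow>
    eps n I p = eps n I q \<longleftrightarrow> keys (p - q) \<subseteq> up G"
proof -
  assume pq: "keys p \<subseteq> monomials n" "keys q \<subseteq> monomials n"
  interpret R: cring R by (rule cring_poly_ring)
  have "eps n I p = eps n I q \<longleftrightarrow> p \<ominus>\<^bsub>R\<^esub> q \<in> I"
    using R.quotient_eq_iff_same_a_r_cos[OF ideal_I, of p q] pq by (simp add: eps_def)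
  also have "\<dots> \<longleftrightarrow> keys (p - q) \<subseteq> up G"
    using pq keys_diff_mpoly[of p q] by (auto simp: poly_ring_minus mem_I)
  finally show ?thesis .
qed

lemma eps_zero: "eps n I 0 = \<zero>\<^bsub>Q\<^esub>"
proof -
  interpret R: cring R by (rule cring_poly_ring)
  interpret Q: cring Q by (rule cring_Q)
  show ?thesis using ring_hom_zero[OF eps_hom R.ring_axioms Q.ring_axioms] by simp
qed

lemma eps_surj:
  assumes "X \<in> carrier Q"
  obtains p where "keys p \<subseteq> monomials n" "X = eps n I p"
  using assms by (auto simp: FactRing_def A_RCOSETS_def' eps_def)

text \<open>Reduction of the coefficients modulo \<open>I\<close>. Elements of
  \<open>koszul n I i\<close> are undefined off the faces, whence the restriction.\<close>

definition proj :: "nat \<Rightarrow> (nat set \<Rightarrow> 'a mpoly) \<Rightarrow> nat set \<Rightarrow> 'a mpoly set" where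
  "proj i c = (\<lambda>\<tau>\<in>faces n i. eps n I (c \<tau>))"

lemma koszul_simps:
  "carrier (koszul n I i) = faces n i \<rightarrow>\<^sub>E carrier Q"
  "x \<oplus>\<^bsub>koszul n I i\<^esub> y = (\<lambda>\<tau>\<in>faces n i. x \<tau> \<oplus>\<^bsub>Q\<^esub> y \<tau>)"
  "\<zero>\<^bsub>koszul n I i\<^esub> = (\<lambda>\<tau>\<in>faces n i. \<zero>\<^bsub>Q\<^esub>)"
  "a \<odot>\<^bsub>koszul n I i\<^esub> x = (\<lambda>\<tau>\<in>faces n i. a \<otimes>\<^bsub>Q\<^esub> x \<tau>)"
proof -
  interpret Q: cring Q by (rule cring_Q)
  show "carrier (koszul n I i) = faces n i \<rightarrow>\<^sub>E carrier Q"
    "x \<oplus>\<^bsub>koszul n I i\<^esub> y = (\<lambda>\<tau>\<in>faces n i. x \<tau> \<oplus>\<^bsub>Q\<^esub> y \<tau>)"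
    "\<zero>\<^bsub>koszul n I i\<^esub> = (\<lambda>\<tau>\<in>faces n i. \<zero>\<^bsub>Q\<^esub>)"
    "a \<odot>\<^bsub>koszul n I i\<^esub> x = (\<lambda>\<tau>\<in>faces n i. a \<otimes>\<^bsub>Q\<^esub> x \<tau>)"
    by (simp_all add: koszul_def Q.func_space_def)
qed

lemma abelian_group_koszul: "abelian_group (koszul n I i)"
proof -
  interpret Q: cring Q by (rule cring_Q)
  have "module Q (koszul n I i)"
    unfolding koszul_def by (rule Q.func_space_is_module)
  then show ?thesis by (rule Module.module.axioms(2))
qed

abbreviation polys :: "(nat set \<Rightarrow> 'a mpoly) \<Rightarrow> bool" where
  "polys \<equiv> coeffs_in (monomials n)"

lemma polysD: "polys c \<Longrightarrow> keys (c \<tau>) \<subseteq> monomials n"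
  by (simp add: coeffs_in_def)

lemma chains_polys: "c \<in> poly_chains n i \<Longrightarrow> polys c"
  by (simp add: poly_chains_def)

lemma polys_scal: "keys p \<subseteq> monomials n \<Longrightarrow> polys c \<Longrightarrow> polys (scal p c)"
  by (simp add: coeffs_in_def keys_mult_monomials)

lemma proj_closed: "polys c \<Longrightarrow> proj i c \<in> carrier (koszul n I i)"
  unfolding koszul_simps proj_def by (simp add: restrict_PiE_iff eps_closed polysD)

lemma proj_add: "polys c \<Longrightarrow> polys d \<Longrightarrow> proj i c \<oplus>\<^bsub>koszul n I i\<^esub> proj i d = proj i (c + d)"
  unfolding koszul_simps proj_def by (rule restrict_ext) (simp add: eps_add polysD)

lemma proj_smult: "keys p \<subseteq> monomials n \<Longrightarrow> polys c \<Longrightarrow>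
    eps n I p \<odot>\<^bsub>koszul n I i\<^esub> proj i c = proj i (scal p c)"
  unfolding koszul_simps proj_def by (rule restrict_ext) (simp add: eps_mult polysD)

lemma proj_zero: "\<zero>\<^bsub>koszul n I i\<^esub> = proj i 0"
  unfolding koszul_simps proj_def by (rule restrict_ext) (simp add: eps_zero)

lemma proj_eq_iff:
  assumes "c \<in> poly_chains n i" "d \<in> poly_chains n i"
  shows "proj i c = proj i d \<longleftrightarrow> coeffs_in (up G) (c - d)"
proof
  assume eq: "proj i c = proj i d"
  show "coeffs_in (up G) (c - d)"
    unfolding coeffs_in_def
  proof
    fix \<tau>
    show "keys ((c - d) \<tau>) \<subseteq> up G"
    proof (cases "\<tau> \<in> faces n i")
      case True
      then have "eps n I (c \<tau>) = eps n I (d \<tau>)" using fun_cong[OF eq, of \<tau>] by (simp add: proj_def)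
      then show ?thesis
        using eps_eq_iff[OF polysD[OF chains_polys[OF assms(1)]] polysD[OF chains_polys[OF assms(2)]]]
        by simp
    next
      case False
      then have "c \<tau> = 0" "d \<tau> = 0" using assms by (auto simp: poly_chains_def)
      then show ?thesis by simp
    qed
  qed
next
  assume "coeffs_in (up G) (c - d)"
  then have "eps n I (c \<tau>) = eps n I (d \<tau>)" for \<tau>
    using eps_eq_iff[OF polysD[OF chains_polys[OF assms(1)]] polysD[OF chains_polys[OF assms(2)]]]
    by (simp add: coeffs_in_def)
  then show "proj i c = proj i d" by (simp add: proj_def)
qed

lemma proj_surj:
  assumes z: "z \<in> carrier (koszul n I i)"
  obtains c where "c \<in> poly_chains n i" "z = proj i c"
proof -
  have "\<forall>\<tau>\<in>faces n i. \<exists>p. keys p \<subseteq> monomials n \<and> z \<tau> = eps n I p"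
  proof
    fix \<tau> assume "\<tau> \<in> faces n i"
    then have "z \<tau> \<in> carrier Q" using z unfolding koszul_simps by (rule PiE_mem[rotated])
    then show "\<exists>p. keys p \<subseteq> monomials n \<and> z \<tau> = eps n I p" using eps_surj by metis
  qed
  then obtain f where f: "\<And>\<tau>. \<tau> \<in> faces n i \<Longrightarrow> keys (f \<tau>) \<subseteq> monomials n \<and> z \<tau> = eps n I (f \<tau>)"
    by metis
  define c where "c = (\<lambda>\<tau>. if \<tau> \<in> faces n i then f \<tau> else 0)"
  have "c \<in> poly_chains n i" using f by (auto simp: poly_chains_def coeffs_in_def c_def)
  moreover have "z = proj i c"
  proof (rule HOL.ext)
    fix \<tau>
    show "z \<tau> = proj i c \<tau>"
    proof (cases "\<tau> \<in> faces n i")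
      case True
      then show ?thesis using f[OF True] by (simp add: proj_def c_def)
    next
      case False
      then show ?thesis using PiE_arb[OF z[unfolded koszul_simps(1)] False] by (simp add: proj_def)
    qed
  qed
  ultimately show ?thesis using that by blast
qed

lemma proj_finsum:
  assumes "finite A" "\<And>a. a \<in> A \<Longrightarrow> polys (f a)"
  shows "(\<Oplus>\<^bsub>koszul n I i\<^esub> a\<in>A. proj i (f a)) = proj i (\<Sum>a\<in>A. f a)"
  using assms
proof (induction A rule: finite_induct)
  case empty
  interpret K: abelian_group "koszul n I i" by (rule abelian_group_koszul)
  show ?case unfolding sum.empty K.finsum_empty by (rule proj_zero)
next
  case (insert b A)
  interpret K: abelian_group "koszul n I i" by (rule abelian_group_koszul)
  have "(\<Oplus>\<^bsub>koszul n I i\<^esub> a\<in>insert b A. proj i (f a)) =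
      proj i (f b) \<oplus>\<^bsub>koszul n I i\<^esub> (\<Oplus>\<^bsub>koszul n I i\<^esub> a\<in>A. proj i (f a))"
    using insert.hyps insert.prems by (intro K.finsum_insert Pi_I proj_closed) simp_all
  also have "\<dots> = proj i (f b) \<oplus>\<^bsub>koszul n I i\<^esub> proj i (\<Sum>a\<in>A. f a)"
    using insert.IH insert.prems by simp
  also have "\<dots> = proj i (f b + (\<Sum>a\<in>A. f a))"
    by (intro proj_add coeffs_in_sum) (use insert.prems in simp_all)
  also have "f b + (\<Sum>a\<in>A. f a) = (\<Sum>a\<in>insert b A. f a)"
    using insert.hyps by (rule sum.insert[symmetric])
  finally show ?case .
qed

lemma e_wedge_proj:
  assumes "length js = i"
  shows "e_wedge n I js = proj i (wedge_list js)"
  unfolding e_wedge_def proj_def assms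
  by (rule restrict_ext) (simp add: wedge_list_apply eps_zero)

lemma e_basis_proj:
  assumes "finite \<tau>" "card \<tau> = i"
  shows "e_basis n I \<tau> = proj i (unit_chain \<tau>)"
  using e_wedge_proj[of "sorted_list_of_set \<tau>" i] assms by (simp add: wedge_list_sorted)

lemma polys_unit: "polys (unit_chain \<tau>)"
  by (simp add: coeffs_in_def unit_chain_def)

lemma koszul_d_basis_proj:
  assumes \<tau>: "\<tau> \<in> faces n i"
  shows "koszul_d_basis n I i \<tau> = proj (i - 1) (bdry n (unit_chain \<tau>))"
proof -
  interpret K: abelian_group "koszul n I (i - 1)" by (rule abelian_group_koszul)
  have fin: "finite \<tau>" "card \<tau> = i" "\<tau> \<subseteq> {1..n}"
    using \<tau> by (auto simp: faces_def intro: finite_subset)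
  let ?k = "\<lambda>l. sorted_list_of_set \<tau> ! (l - 1)"
  let ?f = "\<lambda>l. scal ((- 1) ^ (l + 1) * xmon {#?k l#}) (unit_chain (\<tau> - {?k l})) :: nat set \<Rightarrow> 'a mpoly"
  have k: "?k l \<in> \<tau>" if "l \<in> {1..i}" for l
  proof -
    have "?k l \<in> set (sorted_list_of_set \<tau>)" using that fin by (intro nth_mem) auto
    then show ?thesis using fin by simp
  qed
  have keys: "keys ((- 1) ^ (l + 1) * xmon {#?k l#} :: 'a mpoly) \<subseteq> monomials n" if "l \<in> {1..i}" for l
    unfolding keys_power_minus_one using k[OF that] fin(3) by auto
  have fp: "polys (?f l)" if "l \<in> {1..i}" for l
    by (intro polys_scal polys_unit keys that)
  have tm: "eps n I ((- 1) ^ (l + 1) * xmon {#?k l#}) \<odot>\<^bsub>koszul n I (i - 1)\<^esub> e_basis n I (\<tau> - {?k l}) =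
      proj (i - 1) (?f l)" if l: "l \<in> {1..i}" for l
  proof -
    have "e_basis n I (\<tau> - {?k l}) = proj (i - 1) (unit_chain (\<tau> - {?k l}))"
      by (rule e_basis_proj) (use fin k[OF l] in auto)
    then show ?thesis using proj_smult[OF keys[OF l] polys_unit] by simp
  qed
  have "koszul_d_basis n I i \<tau> = (\<Oplus>\<^bsub>koszul n I (i - 1)\<^esub> l\<in>{1..i}. proj (i - 1) (?f l))"
    unfolding koszul_d_basis_def Let_def
    by (rule K.finsum_cong'[OF refl _ tm]) (intro Pi_I proj_closed fp)
  also have "\<dots> = proj (i - 1) (\<Sum>l\<in>{1..i}. ?f l)"
    by (rule proj_finsum[OF finite_atLeastAtMost fp])
  also have "(\<Sum>l\<in>{1..i}. ?f l) = bdry n (unit_chain \<tau>)"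
    unfolding bdry_unit_chain[OF \<tau>] Let_def ..
  finally show ?thesis .
qed

lemma polys_bdry: "polys c \<Longrightarrow> polys (bdry n c)"
  unfolding bdry_def by (intro coeffs_in_sum polys_scal coeffs_in_con) auto

text \<open>A polynomial chain is the sum of its coefficients times basis elements, and reduction
  commutes with finite sums and scalars, so the basis elements decide.\<close>

lemma koszul_d_proj:
  assumes c: "c \<in> poly_chains n i"
  shows "koszul_d n I i (proj i c) = proj (i - 1) (bdry n c)"
proof -
  interpret K: abelian_group "koszul n I (i - 1)" by (rule abelian_group_koszul)
  let ?f = "\<lambda>\<tau>. scal (c \<tau>) (bdry n (unit_chain \<tau>))"
  have cp: "keys (c \<tau>) \<subseteq> monomials n" for \<tau> using c by (intro polysD chains_polys)
  have fp: "polys (?f \<tau>)" for \<tau> by (intro polys_scal polys_bdry polys_unit cp)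
  have "koszul_d n I i (proj i c) = (\<Oplus>\<^bsub>koszul n I (i - 1)\<^esub> \<tau>\<in>faces n i. proj (i - 1) (?f \<tau>))"
    unfolding koszul_d_def
  proof (rule K.finsum_cong')
    fix \<tau> assume \<tau>: "\<tau> \<in> faces n i"
    then show "proj i c \<tau> \<odot>\<^bsub>koszul n I (i - 1)\<^esub> koszul_d_basis n I i \<tau> = proj (i - 1) (?f \<tau>)"
      unfolding koszul_d_basis_proj[OF \<tau>]
      using proj_smult[OF cp polys_bdry[OF polys_unit]] by (simp add: proj_def)
  qed (use fp proj_closed in auto)
  also have "\<dots> = proj (i - 1) (\<Sum>\<tau>\<in>faces n i. ?f \<tau>)"
    by (rule proj_finsum[OF finite_faces fp])
  also have "(\<Sum>\<tau>\<in>faces n i. ?f \<tau>) = bdry n c"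
    by (subst (2) chain_eq_sum_units[OF c]) (simp add: bdry_sum bdry_scal)
  finally show ?thesis .
qed

lemma koszul_cycle_proj:
  assumes u: "u \<in> monomials n" "u \<noteq> {#}" and \<sigma>: "\<sigma> \<subseteq> {1..mon_max u - 1}"
  shows "koszul_cycle n I u \<sigma> = proj (Suc (card \<sigma>)) (lift_cycle u \<sigma>)"
proof -
  interpret K: abelian_group "koszul n I (Suc (card \<sigma>))" by (rule abelian_group_koszul)
  let ?js = "\<lambda>F. sorted_list_of_set (\<sigma> - F) @ sl (next_mset u F) @ [mon_max u]"
  let ?p = "\<lambda>F. (- 1) ^ sign_exp u \<sigma> F * xmon (mset_set F + (u - {#mon_max u#}) - next_mset u F) :: 'a mpoly"
  have p: "keys (?p F) \<subseteq> monomials n" if "F \<subseteq> \<sigma>" for F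
    unfolding keys_power_minus_one using lift_cycle_term(3)[OF u \<sigma> that] by simp
  have w: "polys (wedge_list (?js F))" if "F \<subseteq> \<sigma>" for F
    using wedge_list_chain[OF lift_cycle_term(2)[OF u \<sigma> that]] by (rule chains_polys)
  have tm: "eps n I (?p F) \<odot>\<^bsub>koszul n I (Suc (card \<sigma>))\<^esub> e_wedge n I (?js F) =
      proj (Suc (card \<sigma>)) (scal (?p F) (wedge_list (?js F)))" if F: "F \<subseteq> \<sigma>" for F
    unfolding e_wedge_proj[OF lift_cycle_term(1)[OF u \<sigma> F]] by (rule proj_smult[OF p[OF F] w[OF F]])
  have "koszul_cycle n I u \<sigma> = (\<Oplus>\<^bsub>koszul n I (Suc (card \<sigma>))\<^esub> F\<in>Pow \<sigma>.
      proj (Suc (card \<sigma>)) (scal (?p F) (wedge_list (?js F))))"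
    unfolding koszul_cycle_def add_Suc_right add_0_right One_nat_def
    by (rule K.finsum_cong') (use tm p w in \<open>auto intro!: proj_closed polys_scal\<close>)
  also have "\<dots> = proj (Suc (card \<sigma>)) (\<Sum>F\<in>Pow \<sigma>. scal (?p F) (wedge_list (?js F)))"
    by (rule proj_finsum) (use finite_sigma[OF u \<sigma>] p w in \<open>auto intro!: polys_scal\<close>)
  finally show ?thesis by (simp only: lift_cycle_def)
qed

end

section \<open>The homology classes form a basis\<close>

lemma const_poly_one: "const_poly 1 = 1"
  by (simp add: const_poly_def flip: single_one)

lemma const_poly_minus_one: "const_poly (- 1) = - 1"
  by (simp add: const_poly_def single_uminus flip: single_one)

lemma const_poly_add: "const_poly (a + b) = const_poly a + const_poly b"
  by (simp add: const_poly_def single_add)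

context koszul_setting
begin

lemma keys_const [simp]: "keys (const_poly a) \<subseteq> monomials n"
  by (rule keys_const_poly_monomials)

text \<open>Lifts of cycles: their differential need not vanish, it only has its coefficients in
  \<open>I\<close>.\<close>

definition cyc :: "nat \<Rightarrow> (nat set \<Rightarrow> 'a mpoly) set" where
  "cyc i = {z \<in> poly_chains n i. coeffs_in (up G) (bdry n z)}"

definition hc :: "nat \<Rightarrow> (nat set \<Rightarrow> 'a mpoly) \<Rightarrow> (nat set \<Rightarrow> 'a mpoly set) set" where
  "hc i z = homology_class n I i (proj i z)"

lemma cyc_chain: "z \<in> cyc i \<Longrightarrow> z \<in> poly_chains n i"
  by (simp add: cyc_def)

lemma cyc_add: "z \<in> cyc i \<Longrightarrow> z' \<in> cyc i \<Longrightarrow> z + z' \<in> cyc i"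
  by (simp add: cyc_def chains_add bdry_add coeffs_in_add)

lemma cyc_scal: "z \<in> cyc i \<Longrightarrow> scal (const_poly a) z \<in> cyc i"
  by (simp add: cyc_def chains_scal bdry_scal coeffs_in_scal)

lemma cyc_zero: "0 \<in> cyc i"
  by (simp add: cyc_def)

lemma cyc_minus: "z \<in> cyc i \<Longrightarrow> - z \<in> cyc i"
  by (simp add: cyc_def chains_minus bdry_minus)

section \<open>Cycles, boundaries and classes in terms of polynomial lifts\<close>

lemma cycles_eq:
  assumes "i \<ge> 1"
  shows "cycles n I i = proj i ` cyc i"
proof -
  obtain j where i: "i = Suc j" using assms by (cases i) auto
  have iff: "koszul_d n I i (proj i z) = \<zero>\<^bsub>koszul n I (i - 1)\<^esub> \<longleftrightarrow> coeffs_in (up G) (bdry n z)"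
    if z: "z \<in> poly_chains n i" for z
  proof -
    have "bdry n z \<in> poly_chains n j" using z unfolding i by (rule chains_bdry)
    then show ?thesis
      unfolding koszul_d_proj[OF z] proj_zero using proj_eq_iff[of "bdry n z" j 0] by (simp add: i)
  qed
  show ?thesis
  proof (intro equalityI subsetI)
    fix y assume y: "y \<in> cycles n I i"
    then obtain z where z: "z \<in> poly_chains n i" "y = proj i z"
      using proj_surj[of y i] by (auto simp: cycles_def)
    then show "y \<in> proj i ` cyc i" using y iff[OF z(1)] by (auto simp: cycles_def cyc_def)
  next
    fix y assume "y \<in> proj i ` cyc i"
    then obtain z where "z \<in> poly_chains n i" "coeffs_in (up G) (bdry n z)" "y = proj i z"
      by (auto simp: cyc_def)
    then show "y \<in> cycles n I i"
      using iff[of z] proj_closed[OF chains_polys, of z i i] by (simp add: cycles_def)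
  qed
qed

lemma boundaries_eq: "boundaries n I i = (\<lambda>w. proj i (bdry n w)) ` poly_chains n (Suc i)"
proof -
  have "carrier (koszul n I (i + 1)) = proj (i + 1) ` poly_chains n (Suc i)"
  proof (intro equalityI subsetI)
    fix y assume "y \<in> carrier (koszul n I (i + 1))"
    then show "y \<in> proj (i + 1) ` poly_chains n (Suc i)" using proj_surj[of y "i + 1"] by auto
  next
    fix y assume "y \<in> proj (i + 1) ` poly_chains n (Suc i)"
    then show "y \<in> carrier (koszul n I (i + 1))" using proj_closed[OF chains_polys] by auto
  qed
  then have "boundaries n I i = (\<lambda>w. koszul_d n I (i + 1) (proj (i + 1) w)) ` poly_chains n (Suc i)"
    by (simp only: boundaries_def image_image)
  also have "\<dots> = (\<lambda>w. proj i (bdry n w)) ` poly_chains n (Suc i)"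
    by (rule image_cong[OF refl]) (use koszul_d_proj[where i = "Suc i"] in simp)
  finally show ?thesis .
qed

lemma hc_set:
  assumes "polys z"
  shows "hc i z = (\<lambda>w. proj i (bdry n w + z)) ` poly_chains n (Suc i)"
proof -
  have "hc i z = (\<lambda>w. proj i (bdry n w) \<oplus>\<^bsub>koszul n I i\<^esub> proj i z) ` poly_chains n (Suc i)"
    unfolding hc_def homology_class_def a_r_coset_def' boundaries_eq by blast
  also have "\<dots> = (\<lambda>w. proj i (bdry n w + z)) ` poly_chains n (Suc i)"
    by (intro image_cong refl proj_add polys_bdry chains_polys assms)
  finally show ?thesis .
qed

lemma hc_subset:
  assumes z: "z \<in> poly_chains n i" "z' \<in> poly_chains n i" and w: "w \<in> poly_chains n (Suc i)"
    and "coeffs_in (up G) (z - z' - bdry n w)"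
  shows "hc i z \<subseteq> hc i z'"
proof
  fix y assume "y \<in> hc i z"
  then obtain v where v: "v \<in> poly_chains n (Suc i)" "y = proj i (bdry n v + z)"
    using hc_set[OF chains_polys[OF z(1)]] by auto
  have "proj i (bdry n v + z) = proj i (bdry n (v + w) + z')"
  proof (subst proj_eq_iff)
    show "bdry n v + z \<in> poly_chains n i" "bdry n (v + w) + z' \<in> poly_chains n i"
      by (intro chains_add chains_bdry v w z)+
    have eq: "bdry n v + z - (bdry n (v + w) + z') = z - z' - bdry n w" by (simp add: bdry_add)
    show "coeffs_in (up G) (bdry n v + z - (bdry n (v + w) + z'))" unfolding eq by (rule assms(4))
  qed
  then show "y \<in> hc i z'"
    unfolding hc_set[OF chains_polys[OF z(2)]] v(2) using chains_add[OF v(1) w] by blast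
qed

lemma hc_eq_iff:
  assumes z: "z \<in> poly_chains n i" "z' \<in> poly_chains n i"
  shows "hc i z = hc i z' \<longleftrightarrow> (\<exists>w \<in> poly_chains n (Suc i). coeffs_in (up G) (z - z' - bdry n w))"
proof
  assume eq: "hc i z = hc i z'"
  have "proj i (bdry n 0 + z) \<in> hc i z"
    unfolding hc_set[OF chains_polys[OF z(1)]] by (rule image_eqI[OF refl chains_zero])
  then obtain w where w: "w \<in> poly_chains n (Suc i)" "proj i z = proj i (bdry n w + z')"
    unfolding eq hc_set[OF chains_polys[OF z(2)]] by auto
  have "coeffs_in (up G) (z - (bdry n w + z'))"
    using w(2) proj_eq_iff[OF z(1), of "bdry n w + z'"] chains_add[OF chains_bdry[OF w(1)] z(2)]
    by simp
  then show "\<exists>w \<in> poly_chains n (Suc i). coeffs_in (up G) (z - z' - bdry n w)"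
    using w(1) by (intro bexI[of _ w]) (simp_all add: algebra_simps)
next
  assume "\<exists>w \<in> poly_chains n (Suc i). coeffs_in (up G) (z - z' - bdry n w)"
  then obtain w where w: "w \<in> poly_chains n (Suc i)" "coeffs_in (up G) (z - z' - bdry n w)" by blast
  \<comment> \<open>The reverse inclusion of cosets uses \<open>- w\<close> in place of
    \<open>w\<close>.\<close>
  have "coeffs_in (up G) (- (z - z' - bdry n w))" using w(2) by (simp only: coeffs_in_minus)
  also have "- (z - z' - bdry n w) = z' - z - bdry n (- w)" by (simp add: bdry_minus)
  finally have "coeffs_in (up G) (z' - z - bdry n (- w))" .
  then show "hc i z = hc i z'"
    using hc_subset[OF z w] hc_subset[OF z(2,1) chains_minus[OF w(1)]] by blast
qed

section \<open>The vector space structure of the homology\<close>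

abbreviation "H i \<equiv> koszul_homology n I i"

lemma homology_carrier: "i \<ge> 1 \<Longrightarrow> carrier (H i) = hc i ` cyc i"
  unfolding koszul_homology_def by (simp add: cycles_eq hc_def image_image)

lemma homology_zero: "\<zero>\<^bsub>H i\<^esub> = hc i 0"
proof -
  have "polys 0" by simp
  then show ?thesis unfolding koszul_homology_def by (simp add: boundaries_eq hc_set)
qed

lemma homology_add:
  assumes z: "z \<in> poly_chains n i" "z' \<in> poly_chains n i"
  shows "hc i z \<oplus>\<^bsub>H i\<^esub> hc i z' = hc i (z + z')"
proof -
  have p: "polys z" "polys z'" "polys (z + z')"
    using z chains_add[OF z] by (auto intro: chains_polys)
  have "hc i z \<oplus>\<^bsub>H i\<^esub> hc i z' = set_add (koszul n I i) (hc i z) (hc i z')"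
    by (simp add: koszul_homology_def)
  also have "\<dots> = (\<Union>w\<in>poly_chains n (Suc i). \<Union>w'\<in>poly_chains n (Suc i).
      {proj i (bdry n w + z) \<oplus>\<^bsub>koszul n I i\<^esub> proj i (bdry n w' + z')})"
    unfolding set_add_def' hc_set[OF p(1)] hc_set[OF p(2)] by blast
  also have "\<dots> = (\<Union>w\<in>poly_chains n (Suc i). \<Union>w'\<in>poly_chains n (Suc i).
      {proj i (bdry n (w + w') + (z + z'))})"
  proof (rule SUP_cong[OF refl], rule SUP_cong[OF refl])
    fix w w' :: "nat set \<Rightarrow> 'a mpoly"
    assume w: "w \<in> poly_chains n (Suc i)" "w' \<in> poly_chains n (Suc i)"
    have "proj i (bdry n w + z) \<oplus>\<^bsub>koszul n I i\<^esub> proj i (bdry n w' + z') =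
        proj i (bdry n w + z + (bdry n w' + z'))"
      by (intro proj_add coeffs_in_add p polys_bdry chains_polys[OF w(1)] chains_polys[OF w(2)])
    also have "bdry n w + z + (bdry n w' + z') = bdry n (w + w') + (z + z')"
      by (simp add: bdry_add)
    finally show "{proj i (bdry n w + z) \<oplus>\<^bsub>koszul n I i\<^esub> proj i (bdry n w' + z')} =
        {proj i (bdry n (w + w') + (z + z'))}" by (simp only:)
  qed
  also have "\<dots> = hc i (z + z')"
    unfolding hc_set[OF p(3)]
  proof (intro equalityI subsetI)
    fix y assume "y \<in> (\<Union>w\<in>poly_chains n (Suc i). \<Union>w'\<in>poly_chains n (Suc i).
      {proj i (bdry n (w + w') + (z + z'))})"
    then show "y \<in> (\<lambda>w. proj i (bdry n w + (z + z'))) ` poly_chains n (Suc i)"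
      using chains_add by blast
  next
    fix y assume "y \<in> (\<lambda>w. proj i (bdry n w + (z + z'))) ` poly_chains n (Suc i)"
    then obtain w where "w \<in> poly_chains n (Suc i)" "y = proj i (bdry n (w + 0) + (z + z'))" by auto
    then show "y \<in> (\<Union>w\<in>poly_chains n (Suc i). \<Union>w'\<in>poly_chains n (Suc i).
      {proj i (bdry n (w + w') + (z + z'))})" using chains_zero by blast
  qed
  finally show ?thesis .
qed

text \<open>Scalar multiplication is defined as a union over all representatives. Each of them
  yields the same class, and there is at least one, so the union is that single class.\<close>

lemma homology_smult:
  assumes z: "z \<in> poly_chains n i"
  shows "a \<odot>\<^bsub>H i\<^esub> hc i z = hc i (scal (const_poly a) z)"
proof -
  have sz: "scal (const_poly a) z \<in> poly_chains n i" by (rule chains_scal[OF keys_const z])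
  have "a \<odot>\<^bsub>H i\<^esub> hc i z =
      (\<Union>w\<in>poly_chains n (Suc i). homology_class n I i
        (eps n I (const_poly a) \<odot>\<^bsub>koszul n I i\<^esub> proj i (bdry n w + z)))"
    by (simp add: koszul_homology_def hc_set[OF chains_polys[OF z]])
  also have "\<dots> = (\<Union>w\<in>(poly_chains n (Suc i) :: (nat set \<Rightarrow> 'a mpoly) set).
      hc i (scal (const_poly a) z))"
  proof (rule SUP_cong[OF refl])
    fix w :: "nat set \<Rightarrow> 'a mpoly" assume w: "w \<in> poly_chains n (Suc i)"
    have wz: "bdry n w + z \<in> poly_chains n i" by (intro chains_add chains_bdry w z)
    have "homology_class n I i (eps n I (const_poly a) \<odot>\<^bsub>koszul n I i\<^esub> proj i (bdry n w + z)) =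
        hc i (scal (const_poly a) (bdry n w + z))"
      by (simp only: hc_def proj_smult[OF keys_const chains_polys[OF wz]])
    also have "\<dots> = hc i (scal (const_poly a) z)"
    proof (subst hc_eq_iff[OF chains_scal[OF keys_const wz] sz], rule bexI)
      show "scal (const_poly a) w \<in> poly_chains n (Suc i)" by (rule chains_scal[OF keys_const w])
      show "coeffs_in (up G) (scal (const_poly a) (bdry n w + z) - scal (const_poly a) z -
          bdry n (scal (const_poly a) w))"
        by (simp add: scal_add bdry_scal)
    qed
    finally show "homology_class n I i (eps n I (const_poly a) \<odot>\<^bsub>koszul n I i\<^esub> proj i (bdry n w + z)) =
        hc i (scal (const_poly a) z)" .
  qed
  also have "\<dots> = hc i (scal (const_poly a) z)"
    using chains_zero by blast
  finally show ?thesis .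
qed

lemma homology_vectorspace:
  assumes i: "i \<ge> 1"
  shows "vectorspace (class_ring :: 'a ring) (H i)"
proof (rule vs_criteria)
  note C = homology_carrier[OF i]
  note simps = homology_zero homology_add homology_smult cyc_chain cyc_zero cyc_add cyc_scal cyc_minus
  show "field (class_ring :: 'a ring)" by (rule class_field)
  show "\<zero>\<^bsub>H i\<^esub> \<in> carrier (H i)" by (simp add: C simps)
  show "\<forall>v w. v \<in> carrier (H i) \<and> w \<in> carrier (H i) \<longrightarrow> v \<oplus>\<^bsub>H i\<^esub> w \<in> carrier (H i)"
    by (auto simp: C simps)
  show "\<forall>v\<in>carrier (H i). \<exists>neg_v\<in>carrier (H i). v \<oplus>\<^bsub>H i\<^esub> neg_v = \<zero>\<^bsub>H i\<^esub>"
  proof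
    fix v assume "v \<in> carrier (H i)"
    then obtain z where z: "z \<in> cyc i" "v = hc i z" by (auto simp: C)
    then have "hc i (- z) \<in> carrier (H i)" "v \<oplus>\<^bsub>H i\<^esub> hc i (- z) = \<zero>\<^bsub>H i\<^esub>"
      by (simp_all add: C simps)
    then show "\<exists>neg_v\<in>carrier (H i). v \<oplus>\<^bsub>H i\<^esub> neg_v = \<zero>\<^bsub>H i\<^esub>" by blast
  qed
  show "\<forall>c v. c \<in> carrier class_ring \<and> v \<in> carrier (H i) \<longrightarrow> c \<odot>\<^bsub>H i\<^esub> v \<in> carrier (H i)"
    by (auto simp: C simps)
  show "\<forall>v w. v \<in> carrier (H i) \<and> w \<in> carrier (H i) \<longrightarrow> v \<oplus>\<^bsub>H i\<^esub> w = w \<oplus>\<^bsub>H i\<^esub> v"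
    by (auto simp: C simps add.commute)
  show "\<forall>v w x. v \<in> carrier (H i) \<and> w \<in> carrier (H i) \<and> x \<in> carrier (H i) \<longrightarrow>
      v \<oplus>\<^bsub>H i\<^esub> w \<oplus>\<^bsub>H i\<^esub> x = v \<oplus>\<^bsub>H i\<^esub> (w \<oplus>\<^bsub>H i\<^esub> x)"
    by (auto simp: C simps add.assoc)
  show "\<forall>v\<in>carrier (H i). v \<oplus>\<^bsub>H i\<^esub> \<zero>\<^bsub>H i\<^esub> = v"
    by (auto simp: C simps)
  show "\<forall>a b v. a \<in> carrier class_ring \<and> b \<in> carrier class_ring \<and> v \<in> carrier (H i) \<longrightarrow>
      (a \<otimes>\<^bsub>class_ring\<^esub> b) \<odot>\<^bsub>H i\<^esub> v = a \<odot>\<^bsub>H i\<^esub> (b \<odot>\<^bsub>H i\<^esub> v)"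
    by (auto simp: C simps const_poly_mult scal_scal)
  show "\<forall>v\<in>carrier (H i). \<one>\<^bsub>class_ring\<^esub> \<odot>\<^bsub>H i\<^esub> v = v"
    by (auto simp: C simps const_poly_one)
  show "\<forall>a b v. a \<in> carrier class_ring \<and> b \<in> carrier class_ring \<and> v \<in> carrier (H i) \<longrightarrow>
      (a \<oplus>\<^bsub>class_ring\<^esub> b) \<odot>\<^bsub>H i\<^esub> v = a \<odot>\<^bsub>H i\<^esub> v \<oplus>\<^bsub>H i\<^esub> b \<odot>\<^bsub>H i\<^esub> v"
    by (auto simp: C simps const_poly_add scal_left_add)
  show "\<forall>a v w. a \<in> carrier class_ring \<and> v \<in> carrier (H i) \<and> w \<in> carrier (H i) \<longrightarrow>
      a \<odot>\<^bsub>H i\<^esub> (v \<oplus>\<^bsub>H i\<^esub> w) = a \<odot>\<^bsub>H i\<^esub> v \<oplus>\<^bsub>H i\<^esub> a \<odot>\<^bsub>H i\<^esub> w"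
    by (auto simp: C simps scal_add)
qed

end

locale koszul_basis = koszul_setting n I G + linear_quotients n G rank A e
  for n :: nat and I :: "'a::field mpoly set" and G and rank :: "nat multiset \<Rightarrow> 'r::linorder" and A
    and e :: "nat multiset \<Rightarrow> nat set \<Rightarrow> nat set \<Rightarrow> 'a mpoly"
begin

definition cls :: "nat \<Rightarrow> nat multiset \<times> nat set \<Rightarrow> (nat set \<Rightarrow> 'a mpoly set) set" where
  "cls j p = hc (Suc j) (e (fst p) (snd p))"

lemma e_cyc:
  assumes "p \<in> idx G j"
  shows "e (fst p) (snd p) \<in> cyc (Suc j)"
proof -
  have p: "fst p \<in> G" "snd p \<subseteq> A (fst p)" "card (snd p) = j"
    using assms by (auto simp: idx_def)
  have "coeffs_in (up G) (bdry n (e (fst p) (snd p)))"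
    using bdry_e_in_up[OF p(1,2)] by (rule coeffs_in_mono) (use p(1) in \<open>auto intro!: up_mono\<close>)
  then show ?thesis using e_chain[OF p(1,2)] p(3) by (simp add: cyc_def)
qed

lemma comb_cyc: "comb a G j \<in> cyc (Suc j)"
proof -
  have "scal (const_poly (a p)) (e (fst p) (snd p)) \<in> cyc (Suc j)" if "p \<in> idx G j" for p
    using e_cyc[OF that] by (rule cyc_scal)
  then have "comb a G j \<in> poly_chains n (Suc j)" "coeffs_in (up G) (bdry n (comb a G j))"
    unfolding comb_def bdry_sum cyc_def by (auto intro!: chains_sum coeffs_in_sum)
  then show ?thesis by (simp add: cyc_def)
qed

lemma finsum_hc:
  assumes "i \<ge> 1" "finite B" "\<And>b. b \<in> B \<Longrightarrow> f b \<in> cyc i"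
  shows "(\<Oplus>\<^bsub>H i\<^esub> b\<in>B. hc i (f b)) = hc i (\<Sum>b\<in>B. f b)"
proof -
  interpret V: vectorspace "class_ring :: 'a ring" "H i" by (rule homology_vectorspace[OF assms(1)])
  show ?thesis using assms(2,3)
  proof (induction B rule: finite_induct)
    case empty
    show ?case unfolding sum.empty V.finsum_empty by (rule homology_zero)
  next
    case (insert b B)
    have c: "hc i (f x) \<in> carrier (H i)" if "x \<in> insert b B" for x
      unfolding homology_carrier[OF assms(1)] using insert.prems[OF that] by (rule imageI)
    have ch: "f x \<in> poly_chains n i" if "x \<in> insert b B" for x
      using insert.prems[OF that] by (rule cyc_chain)
    have "(\<Oplus>\<^bsub>H i\<^esub> x\<in>insert b B. hc i (f x)) =
        hc i (f b) \<oplus>\<^bsub>H i\<^esub> (\<Oplus>\<^bsub>H i\<^esub> x\<in>B. hc i (f x))"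
      using insert.hyps c by (intro V.finsum_insert Pi_I) simp_all
    also have "(\<Oplus>\<^bsub>H i\<^esub> x\<in>B. hc i (f x)) = hc i (\<Sum>x\<in>B. f x)"
      using insert.prems by (intro insert.IH) simp
    also have "hc i (f b) \<oplus>\<^bsub>H i\<^esub> hc i (\<Sum>x\<in>B. f x) = hc i (f b + (\<Sum>x\<in>B. f x))"
      using ch by (intro homology_add chains_sum) simp_all
    also have "f b + (\<Sum>x\<in>B. f x) = (\<Sum>x\<in>insert b B. f x)"
      using insert.hyps by (rule sum.insert[symmetric])
    finally show ?case .
  qed
qed

lemma comb_boundary_imp_zero:
  assumes "hc (Suc j) (comb a G j) = hc (Suc j) 0" "p \<in> idx G j"
  shows "a p = 0"
proof -
  obtain w where "w \<in> poly_chains n (Suc (Suc j))" "coeffs_in (up G) (comb a G j - 0 - bdry n w)"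
    using assms(1) hc_eq_iff[OF cyc_chain[OF comb_cyc] chains_zero] by blast
  then show ?thesis using cycles_independent[of w j a p] assms(2) by simp
qed

text \<open>A coincidence of two classes is a linear relation with coefficients 1 and -1.
  Injectivity matters because \<open>basis\<close> speaks of a set of vectors, while independence is
  known for a family indexed by \<open>idx G j\<close>.\<close>

lemma cls_inj: "inj_on (cls j) (idx G j)"
proof (rule inj_onI, rule ccontr)
  fix p q assume p: "p \<in> idx G j" and q: "q \<in> idx G j" and eq: "cls j p = cls j q" and ne: "p \<noteq> q"
  define a where "a = (\<lambda>r. if r = p then 1 else if r = q then - 1 else (0 :: 'a))"
  let ?e = "\<lambda>p. e (fst p) (snd p)"
  have fin: "finite (idx G j)" by (rule finite_idx) simp
  have "comb a G j = (\<Sum>r\<in>idx G j. (if r = p then ?e p else 0) - (if r = q then ?e q else 0))"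
    unfolding comb_def
    by (rule sum.cong[OF refl])
      (use ne in \<open>auto simp: a_def const_poly_one const_poly_minus_one scal_left_minus\<close>)
  also have "\<dots> = ?e p - ?e q"
    unfolding sum_subtractf using fin p q by simp
  finally have comb: "comb a G j = ?e p - ?e q" .
  obtain w where w: "w \<in> poly_chains n (Suc (Suc j))" "coeffs_in (up G) (?e p - ?e q - bdry n w)"
    using eq hc_eq_iff[OF cyc_chain[OF e_cyc[OF p]] cyc_chain[OF e_cyc[OF q]]]
    unfolding cls_def by blast
  have "a p = 0"
    by (rule cycles_independent[OF w(1) _ p]) (use w(2) in \<open>simp add: comb\<close>)
  then show False by (simp add: a_def)
qed

lemma homology_basis:
  "vectorspace.basis (class_ring :: 'a ring) (H (Suc j)) (cls j ` idx G j)"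
proof -
  interpret V: vectorspace "class_ring :: 'a ring" "H (Suc j)"
    by (rule homology_vectorspace) simp
  let ?S = "cls j ` idx G j"
  have C: "carrier (H (Suc j)) = hc (Suc j) ` cyc (Suc j)" by (rule homology_carrier) simp
  have fin: "finite (idx G j)" by (rule finite_idx) simp
  have S: "?S \<subseteq> carrier (H (Suc j))"
    using e_cyc by (auto simp: C cls_def)
  have lc: "V.lincomb a ?S = hc (Suc j) (comb (\<lambda>p. a (cls j p)) G j)" for a
  proof -
    have t: "a (cls j p) \<odot>\<^bsub>H (Suc j)\<^esub> cls j p =
        hc (Suc j) (scal (const_poly (a (cls j p))) (e (fst p) (snd p)))" if "p \<in> idx G j" for p
      unfolding cls_def by (rule homology_smult[OF cyc_chain[OF e_cyc[OF that]]])
    have cy: "scal (const_poly (a (cls j p))) (e (fst p) (snd p)) \<in> cyc (Suc j)" if "p \<in> idx G j" for p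
      by (rule cyc_scal[OF e_cyc[OF that]])
    have "V.lincomb a ?S = (\<Oplus>\<^bsub>H (Suc j)\<^esub> p\<in>idx G j. a (cls j p) \<odot>\<^bsub>H (Suc j)\<^esub> cls j p)"
      unfolding V.lincomb_def
      by (rule V.finsum_reindex[OF _ cls_inj]) (use S in auto)
    also have "\<dots> = (\<Oplus>\<^bsub>H (Suc j)\<^esub> p\<in>idx G j.
        hc (Suc j) (scal (const_poly (a (cls j p))) (e (fst p) (snd p))))"
      by (rule V.finsum_cong'[OF refl _ t]) (use cy in \<open>auto simp: C\<close>)
    also have "\<dots> = hc (Suc j) (comb (\<lambda>p. a (cls j p)) G j)"
      unfolding comb_def by (rule finsum_hc[OF _ fin cy]) simp
    finally show ?thesis .
  qed
  have "V.lin_indpt ?S"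
  proof (rule V.finite_lin_indpt2)
    fix a assume "V.lincomb a ?S = \<zero>\<^bsub>H (Suc j)\<^esub>"
    then have "hc (Suc j) (comb (\<lambda>p. a (cls j p)) G j) = hc (Suc j) 0"
      by (simp only: lc homology_zero)
    then have "a (cls j p) = 0" if "p \<in> idx G j" for p
      using comb_boundary_imp_zero[of j "\<lambda>p. a (cls j p)"] that by simp
    then show "\<forall>v\<in>?S. a v = \<zero>\<^bsub>class_ring\<^esub>" by simp
  qed (use fin S in auto)
  moreover have "V.span ?S = carrier (H (Suc j))"
  proof
    show "V.span ?S \<subseteq> carrier (H (Suc j))" by (rule V.span_is_subset2[OF S])
    show "carrier (H (Suc j)) \<subseteq> V.span ?S"
    proof
      fix v assume "v \<in> carrier (H (Suc j))"
      then obtain z where z: "z \<in> cyc (Suc j)" "v = hc (Suc j) z" by (auto simp: C)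
      then obtain a w where w: "w \<in> poly_chains n (Suc (Suc j))"
          "coeffs_in (up G) (z - bdry n w - comb a G j)"
        using cycles_spanned[of z j] unfolding cyc_def by blast
      \<comment> \<open>\<open>lincomb\<close> takes coefficients indexed by classes; they are
        carried over from the index pairs along the inverse of \<open>cls j\<close>.\<close>
      define b where "b = (\<lambda>v. a (the_inv_into (idx G j) (cls j) v))"
      have "comb (\<lambda>p. b (cls j p)) G j = comb a G j"
        unfolding comb_def
        by (rule sum.cong[OF refl]) (simp add: b_def the_inv_into_f_f[OF cls_inj])
      then have "V.lincomb b ?S = hc (Suc j) (comb a G j)" by (simp only: lc)
      also have "\<dots> = v"
      proof -
        have "z - comb a G j - bdry n w = z - bdry n w - comb a G j" by simp
        then show ?thesis
          unfolding z(2) using hc_eq_iff[OF cyc_chain[OF z(1)] cyc_chain[OF comb_cyc], of a] w by metis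
      qed
      finally have "V.lincomb b ?S = v" .
      then show "v \<in> V.span ?S"
        unfolding V.finite_span[OF finite_imageI[OF fin] S] by auto
    qed
  qed
  ultimately show ?thesis using S by (simp add: V.basis_def)
qed

end

text \<open>The polynomials described by supports form an ideal containing the generators.
  Conversely, each term of such a polynomial is a constant times a monomial that some generator
  divides.\<close>

lemma genideal_monomials:
  assumes G: "G \<subseteq> monomials n"
  shows "(p :: 'a::field mpoly) \<in> Idl\<^bsub>poly_ring n\<^esub> (xmon ` G) \<longleftrightarrow> keys p \<subseteq> monomials n \<and> keys p \<subseteq> up G"
proof -
  let ?R = "poly_ring n :: 'a mpoly ring"
  let ?J = "{p :: 'a mpoly. keys p \<subseteq> monomials n \<and> keys p \<subseteq> up G}"
  interpret R: cring ?R by (rule cring_poly_ring)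
  have Gc: "xmon ` G \<subseteq> carrier ?R" using G by auto
  have neg: "\<ominus>\<^bsub>?R\<^esub> q = - q" if "keys q \<subseteq> monomials n" for q
    by (rule R.minus_equality) (use that in \<open>simp_all add: keys_minus_mpoly\<close>)
  have idJ: "ideal ?J ?R"
  proof (rule idealI)
    show "ring ?R" by (rule R.ring_axioms)
    show "subgroup ?J (add_monoid ?R)"
    proof (rule subgroup.intro, goal_cases)
      case (2 x y)
      then show ?case using Poly_Mapping.keys_add[of x y] by simp blast
    next
      case (4 x)
      then show ?case using neg[of x] by (simp add: a_inv_def keys_minus_mpoly)
    qed auto
  next
    fix a x assume a: "a \<in> ?J" and x: "x \<in> carrier ?R"
    have "keys (x * a) \<subseteq> monomials n" "keys (x * a) \<subseteq> up G"
      using a x by (simp_all add: keys_mult_monomials upward_keys_mult)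
    then show "x \<otimes>\<^bsub>?R\<^esub> a \<in> ?J" "a \<otimes>\<^bsub>?R\<^esub> x \<in> ?J" by (simp_all add: mult.commute)
  qed
  interpret I: ideal "Idl\<^bsub>?R\<^esub> (xmon ` G)" ?R by (rule R.genideal_ideal[OF Gc])
  show ?thesis
  proof
    have "xmon ` G \<subseteq> ?J" using G by (auto simp: up_def)
    then have "Idl\<^bsub>?R\<^esub> (xmon ` G) \<subseteq> ?J" by (rule R.genideal_minimal[OF idJ])
    then show "p \<in> Idl\<^bsub>?R\<^esub> (xmon ` G) \<Longrightarrow> keys p \<subseteq> monomials n \<and> keys p \<subseteq> up G" by blast
  next
    assume p: "keys p \<subseteq> monomials n \<and> keys p \<subseteq> up G"
    have mon: "Poly_Mapping.single v a \<in> Idl\<^bsub>?R\<^esub> (xmon ` G)" if v: "v \<in> keys p" for v and a :: 'a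
    proof -
      have "xmon v \<in> Idl\<^bsub>?R\<^esub> (xmon ` G)"
        using xmon_mem_Idl[OF G, of v, where 'a = 'a] p v by (auto simp: up_def)
      then have "const_poly a \<otimes>\<^bsub>?R\<^esub> xmon v \<in> Idl\<^bsub>?R\<^esub> (xmon ` G)"
        by (rule I.I_l_closed) (simp add: keys_const_poly_monomials)
      then show ?thesis by (simp add: const_poly_def xmon_def mult_single)
    qed
    have "(\<Sum>v\<in>B. Poly_Mapping.single v (lookup p v)) \<in> Idl\<^bsub>?R\<^esub> (xmon ` G)"
      if "finite B" "B \<subseteq> keys p" for B
      using that
    proof (induction B rule: finite_induct)
      case empty
      show ?case using I.zero_closed by simp
    next
      case (insert v B)
      then show ?case using I.a_closed[OF mon[of v "lookup p v"]] by simp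
    qed
    from this[OF finite_keys order_refl] show "p \<in> Idl\<^bsub>?R\<^esub> (xmon ` G)"
      by (simp flip: mpoly_eq_sum)
  qed
qed

theorem theorem3p8:
  fixes I :: "'a::field mpoly set"
    and n d i :: nat
    and t :: "nat \<Rightarrow> nat"
  assumes "d \<ge> 2"
    and "I \<subset> carrier (poly_ring n)"
    and "t_spread_strongly_stable n d t I"
    and "i \<ge> 1"
  shows "vectorspace (class_ring :: 'a ring) (koszul_homology n I i) \<and>
    (\<forall>(u, \<sigma>) \<in> cycle_index n t I i. koszul_cycle n I u \<sigma> \<in> cycles n I i) \<and>
    inj_on (\<lambda>(u, \<sigma>). homology_class n I i (koszul_cycle n I u \<sigma>)) (cycle_index n t I i) \<and>
    vectorspace.basis (class_ring :: 'a ring) (koszul_homology n I i)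
      ((\<lambda>(u, \<sigma>). homology_class n I i (koszul_cycle n I u \<sigma>)) ` cycle_index n t I i)"
proof -
  define G where "G = min_gens n I"
  define M where "M = {v \<in> monomials n. xmon v \<in> I}"
  have mon: "monomial_ideal n I" and spread: "\<And>u. u \<in> G \<Longrightarrow> t_spread d t u"
    using assms(3) by (auto simp: t_spread_strongly_stable_def t_spread_ideal_def G_def)
  have Gm: "G \<subseteq> monomials n" and IG: "I = Idl\<^bsub>poly_ring n\<^esub> (xmon ` G)"
    using min_gens_eq[OF mon] by (auto simp: G_def)
  have mem: "p \<in> I \<longleftrightarrow> keys p \<subseteq> monomials n \<and> keys p \<subseteq> up G" for p
    unfolding IG by (rule genideal_monomials[OF Gm])
  have M_iff: "v \<in> M \<longleftrightarrow> v \<in> monomials n \<and> v \<in> up G" for v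
    by (auto simp: M_def mem)
  have "spread_stable n d t M G"
  proof
    show "M \<subseteq> monomials n" by (auto simp: M_def)
    \<comment> \<open>Properness of \<open>I\<close> enters here: if \<open>1\<close> were in
      \<open>I\<close>, it would be a generator and every polynomial would lie in
      \<open>I\<close>.\<close>
    show "{#} \<notin> M"
    proof
      assume "{#} \<in> M"
      then have "{#} \<in> G" by (auto simp: M_iff up_def)
      then have "up G = UNIV" by (auto simp: up_def intro!: bexI[of _ "{#}"])
      then have "carrier (poly_ring n) \<subseteq> I" using mem by auto
      then show False using assms(2) by blast
    qed
    show "G = {u \<in> M. \<forall>v. v \<subset># u \<longrightarrow> v \<notin> M}"
      unfolding G_def min_gens_eq(1)[OF mon] by (auto simp: M_def mem)
    show "t_spread d t u" if "u \<in> G" for u by (rule spread[OF that])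
    show "add_mset j (u - {#i#}) \<in> M"
      if "u \<in> M" "t_spread d t u" "i \<in># u" "1 \<le> j" "j < i" "t_spread d t (add_mset j (u - {#i#}))"
      for u i j
    proof -
      have "xmon (add_mset j (u - {#i#})) \<in> I"
        using assms(3) that unfolding t_spread_strongly_stable_def M_def by blast
      then show ?thesis by (simp add: M_def mem)
    qed
  qed
  then interpret S: spread_stable n d t M G .
  have ideal: "ideal I (poly_ring n)"
  proof -
    interpret R: cring "poly_ring n :: 'a mpoly ring" by (rule cring_poly_ring)
    show ?thesis unfolding IG by (rule R.genideal_ideal) (use Gm in auto)
  qed
  interpret K: koszul_setting n I G by (rule koszul_setting.intro[OF ideal mem])
  interpret L: linear_quotients n G sl "linear_vars t" "lift_cycle :: _ \<Rightarrow> _ \<Rightarrow> _ \<Rightarrow> 'a mpoly"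
    by (rule S.linear_quotients)
  interpret B: koszul_basis n I G sl "linear_vars t" lift_cycle ..
  \<comment> \<open>With \<open>i\<close> written as a successor, the condition
    \<open>card \<sigma> = i - 1\<close> becomes \<open>card \<sigma> = j\<close>, and the cycles
    live in degree \<open>Suc j\<close>.\<close>
  obtain j where i: "i = Suc j" using assms(4) by (cases i) auto
  have idx: "cycle_index n t I i = L.idx G j"
    by (auto simp: cycle_index_def L.idx_def linear_vars_def G_def i)
  have cyc: "koszul_cycle n I u \<sigma> = K.proj i (lift_cycle u \<sigma>)" if "(u, \<sigma>) \<in> L.idx G j" for u \<sigma>
  proof -
    have u: "u \<in> G" "\<sigma> \<subseteq> linear_vars t u" "card \<sigma> = j" using that by (auto simp: L.idx_def)
    then show ?thesis
      using K.koszul_cycle_proj[OF S.linear_vars_subset(3,4)[OF u(1)], of \<sigma>]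
        S.linear_vars_subset(1)[OF u(1)] by (simp add: i)
  qed
  have cls: "(\<lambda>(u, \<sigma>). homology_class n I i (koszul_cycle n I u \<sigma>)) p = B.cls j p"
    if "p \<in> L.idx G j" for p
    using that cyc by (cases p) (simp add: B.cls_def K.hc_def i)
  have "inj_on (\<lambda>(u, \<sigma>). homology_class n I i (koszul_cycle n I u \<sigma>)) (L.idx G j)"
    using B.cls_inj[of j] by (simp only: cls cong: inj_on_cong)
  moreover have "(\<lambda>(u, \<sigma>). homology_class n I i (koszul_cycle n I u \<sigma>)) ` L.idx G j = B.cls j ` L.idx G j"
    by (rule image_cong[OF refl cls])
  moreover have "koszul_cycle n I u \<sigma> \<in> cycles n I i" if "(u, \<sigma>) \<in> L.idx G j" for u \<sigma>
    using B.e_cyc[OF that] unfolding cyc[OF that] K.cycles_eq[OF assms(4)] by (auto simp: i)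
  moreover have "vectorspace (class_ring :: 'a ring) (koszul_homology n I i)"
    by (rule K.homology_vectorspace[OF assms(4)])
  moreover have "vectorspace.basis (class_ring :: 'a ring) (koszul_homology n I i) (B.cls j ` L.idx G j)"
    unfolding i by (rule B.homology_basis)
  ultimately show ?thesis unfolding idx by auto
qed

end
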